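(* Let $N\ge1$, let $Q$ be a real symmetric positive definite $N\times N$ matrix, let $B\neq0$ be a real $N\times N$ matrix, and let $s>0$ and $T>0$. Let $(\mathcal{T}(t))_{t\ge0}$ be the fractional Ornstein-Uhlenbeck semigroup on $L^2(\mathbb{R}^N)$ defined in the context. There exists a constant $c=c(s,T)\in(0,1]$ such that, for every $u_0\in L^2(\mathbb{R}^N)$, the solution $u(t)=\mathcal{T}(t)u_0$ satisfies $$\|u(t)\|_{L^2(\mathbb{R}^N)}\le e^{-\frac{\mathrm{tr}(B)}{2}(1-c)t}\,\|u_0\|_{L^2(\mathbb{R}^N)}^{1-c\frac{t}{T}}\,\|u(T)\|_{L^2(\mathbb{R}^N)}^{c\frac{t}{T}},\qquad t\in[0,T].$$
   Context: Equation: $\partial_tu=-\mathrm{tr}^s(-Q\nabla^2u)+Bx\cdot\nabla u$ on $(0,T)\times\mathbb{R}^N$, $u|_{t=0}=u_0$, where $\mathrm{tr}^s(-Q\nabla^2\cdot)$ is the Fourier multiplier with symbol $\langle Q\xi,\xi\rangle^s$ and $Bx\cdot\nabla u=\sum_{i,j}b_{ij}x_j\partial_{x_i}u$. The operator $\mathcal{A}=-\mathrm{tr}^s(-Q\nabla^2\cdot)+Bx\cdot\nabla\cdot$ with domain $D(\mathcal{A})=\{u\in L^2(\mathbb{R}^N):\mathcal{A}u\in L^2(\mathbb{R}^N)\}$ generates a $C_0$-semigroup $(\mathcal{T}(t))_{t\ge0}$ on $L^2(\mathbb{R}^N)$ (Lebesgue measure), given with $\widehat g(\xi)=\int_{\mathbb{R}^N}g(x)e^{-\mathrm{i}x\cdot\xi}dx$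 by $$\widehat{\mathcal{T}(t)u_0}(\xi)=e^{-\mathrm{tr}(B)t}\exp\left[-\int_0^t\left|Q^{\frac12}e^{-\tau B^\top}\xi\right|^{2s}d\tau\right]\widehat{u_0}\left(e^{-tB^\top}\xi\right).$$ The matrices $Q,B$ and the dimension $N$ are fixed, so dependence of $c$ on them is allowed and not displayed; $c$ does not depend on $u_0$ or $t$. *)

theory Defs
  imports "HOL-Analysis.Analysis"
begin

section \<open>Matrices\<close>

definition pos_semidef :: "real^'n^'n \<Rightarrow> bool" where
  "pos_semidef A \<longleftrightarrow> transpose A = A \<and> (\<forall>v. 0 \<le> v \<bullet> (A *v v))"

definition pos_def :: "real^'n^'n \<Rightarrow> bool" where
  "pos_def A \<longleftrightarrow> transpose A = A \<and> (\<forall>v. v \<noteq> 0 \<longrightarrow> 0 < v \<bullet> (A *v v))"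

text \<open>Every positive semidefinite matrix has exactly one positive semidefinite square root.\<close>

definition mat_sqrt :: "real^'n^'n \<Rightarrow> real^'n^'n" where
  "mat_sqrt A = (THE R. pos_semidef R \<and> R ** R = A)"

text \<open>Multiplication on \<^typ>\<open>real^'n^'n\<close> as a type class operation is entrywise, so neither
  the library's power nor its exponential function is the matrix one.\<close>

definition mat_exp :: "real^'n^'n \<Rightarrow> real^'n^'n" where
  "mat_exp A = (\<Sum>k. (1 / fact k) *\<^sub>R (((\<lambda>M. A ** M) ^^ k) (mat 1)))"


section \<open>Square integrable functions and their Fourier transform\<close>

text \<open>Elements of \<open>L\<^sup>2\<close> are represented by Borel measurable functions; equality in \<open>L\<^sup>2\<close> is equality
  almost everywhere.\<close>

definition L2_space :: "(real^'n \<Rightarrow> complex) set" where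
  "L2_space = {f. f \<in> borel_measurable lborel \<and> integrable lborel (\<lambda>x. (cmod (f x))\<^sup>2)}"

definition L2_norm :: "(real^'n \<Rightarrow> complex) \<Rightarrow> real" where
  "L2_norm f = sqrt (\<integral>x. (cmod (f x))\<^sup>2 \<partial>lborel)"

definition fourier_integral :: "(real^'n \<Rightarrow> complex) \<Rightarrow> real^'n \<Rightarrow> complex" where
  "fourier_integral g \<xi> = (\<integral>x. g x * exp (- \<i> * of_real (x \<bullet> \<xi>)) \<partial>lborel)"

text \<open>On \<open>L\<^sup>2\<close> the defining integral need not converge, and the transform is the \<open>L\<^sup>2\<close>-limit of the
  transforms of the truncations to balls (Plancherel); it is determined up to null sets. The
  distance is an extended nonnegative integral because a Bochner integral would silently be \<open>0\<close> for a
  difference that is not square integrable.\<close>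

definition fourier_L2 :: "(real^'n \<Rightarrow> complex) \<Rightarrow> real^'n \<Rightarrow> complex" where
  "fourier_L2 g = (SOME h. h \<in> L2_space \<and>
     (\<lambda>n. \<integral>\<^sup>+\<xi>. ennreal
        ((cmod (fourier_integral (\<lambda>x. indicator (cball 0 (real n)) x *\<^sub>R g x) \<xi> - h \<xi>))\<^sup>2)
        \<partial>lborel) \<longlonglongrightarrow> 0)"


section \<open>The fractional Ornstein-Uhlenbeck semigroup\<close>

text \<open>The element of \<open>L\<^sup>2\<close> with the prescribed Fourier transform; it is determined up to null sets.\<close>

definition frac_OU_semigroup ::
    "real \<Rightarrow> real^'n^'n \<Rightarrow> real^'n^'n \<Rightarrow> real \<Rightarrow> (real^'n \<Rightarrow> complex) \<Rightarrow> real^'n \<Rightarrow> complex" where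
  "frac_OU_semigroup s Q B t u0 = (SOME u. u \<in> L2_space \<and>
     (AE \<xi> in lborel. fourier_L2 u \<xi> =
        of_real (exp (- trace B * t) *
          exp (- integral {0..t} (\<lambda>\<tau>.
            norm (mat_sqrt Q *v (mat_exp (- \<tau> *\<^sub>R transpose B) *v \<xi>)) powr (2 * s)))) *
        fourier_L2 u0 (mat_exp (- t *\<^sub>R transpose B) *v \<xi>)))"

end

theory Submission
  imports Defs "HOL-Probability.Probability"
begin

text \<open>Let \<open>E t = exp (t B\<^sup>T)\<close> and let \<open>\<psi> t \<eta>\<close> be the integral of \<open>\<bar>Q\<^sup>1\<^sup>/\<^sup>2 E \<tau> \<eta>\<bar>\<^sup>2\<^sup>s\<close> over \<open>\<tau> \<in> [0, t]\<close>. By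
  Plancherel and the substitution \<open>\<xi> = E t \<eta>\<close>, whose Jacobian is \<open>exp (t tr B)\<close>, the square of the
  norm of \<open>u t\<close> is a constant times \<open>exp (- t tr B)\<close> times the integral of
  \<open>exp (- 2 \<psi> t \<eta>) \<bar>F u\<^sub>0 \<eta>\<bar>\<^sup>2\<close>. By homogeneity and compactness the integrand of \<open>\<psi>\<close> lies between two
  positive multiples \<open>a \<bar>\<eta>\<bar>\<^sup>2\<^sup>s\<close> and \<open>b \<bar>\<eta>\<bar>\<^sup>2\<^sup>s\<close> for \<open>\<tau> \<in> [0, T]\<close>, so \<open>\<psi> t \<eta> \<ge> c (t / T) \<psi> T \<eta>\<close> with
  \<open>c = a / b\<close>, and the claim follows from Hoelder's inequality with weights \<open>1 - c t / T\<close> and \<open>c t / T\<close>.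
  That the semigroup is well defined requires the Fourier transform to map \<open>L\<^sup>2\<close> onto \<open>L\<^sup>2\<close>.\<close>

section \<open>The matrix exponential\<close>

text \<open>In the variable \<eta> the solutions at all times share the one density
  \<open>|F u0 \<eta>|^2\<close> and differ only in their weights; this is what lets Hoelder
  interpolate between the times 0 and \<open>T\<close>. If the integrand of \<psi> did not depend on
  \<tau>, \<psi> would be linear in time and c could be 1; the ratio a / b is the price of the
  motion of \<eta> under \<open>E\<close>, and it depends on \<open>T\<close> because both extrema
  are taken over the times in [0, \<open>T\<close>].

  The exponential in the claim collects two Jacobians: with \<theta> = c t / T, the factor exp (- t
  tr B) at time t meets the \<theta>-th power of exp (T tr B) from time T, which is exp (c t tr B),
  and a square root is taken.

  The matrix root, the transform on L2 and the semigroup are given by \<open>THE\<close> and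
  \<open>SOME\<close>, which say nothing until an object with the required property is exhibited.
  Hence the fixed point construction and the uniqueness proof for the root, the completeness of L2
  for the transform, and the surjectivity of the transform for the semigroup.\<close>

text \<open>The library has no Banach algebra of matrices or endomorphisms: \<^typ>\<open>real^'n^'n\<close> is multiplied
  entrywise and the bounded linear maps carry no multiplication. With this type the results
  on \<^const>\<open>exp\<close> and the contraction argument for square roots apply.\<close>

typedef (overloaded) 'a endo = "UNIV :: ('a::real_normed_vector \<Rightarrow>\<^sub>L 'a) set"
  morphisms blinfun_of_endo Endo ..

setup_lifting type_definition_endo

instantiation endo :: (real_normed_vector) real_normed_algebra
begin

lift_definition zero_endo :: "'a endo" is 0 .
lift_definition plus_endo :: "'a endo \<Rightarrow> 'a endo \<Rightarrow> 'a endo" is "(+)" .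
lift_definition minus_endo :: "'a endo \<Rightarrow> 'a endo \<Rightarrow> 'a endo" is "(-)" .
lift_definition uminus_endo :: "'a endo \<Rightarrow> 'a endo" is uminus .
lift_definition times_endo :: "'a endo \<Rightarrow> 'a endo \<Rightarrow> 'a endo" is "(o\<^sub>L)" .
lift_definition scaleR_endo :: "real \<Rightarrow> 'a endo \<Rightarrow> 'a endo" is "(*\<^sub>R)" .
lift_definition norm_endo :: "'a endo \<Rightarrow> real" is norm .
definition dist_endo :: "'a endo \<Rightarrow> 'a endo \<Rightarrow> real" where "dist_endo x y = norm (x - y)"
definition sgn_endo :: "'a endo \<Rightarrow> 'a endo" where "sgn_endo x = inverse (norm x) *\<^sub>R x"
definition uniformity_endo :: "('a endo \<times> 'a endo) filter"
  where "uniformity_endo = (INF e\<in>{0<..}. principal {(x, y). dist x y < e})"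
definition open_endo :: "'a endo set \<Rightarrow> bool"
  where "open_endo S = (\<forall>x\<in>S. \<forall>\<^sub>F (x', y) in uniformity. x' = x \<longrightarrow> y \<in> S)"

instance
proof
  fix a b c :: "'a endo" and r :: real
  show "a * b * c = a * (b * c)"
    by transfer (auto intro: blinfun_eqI)
  show "(a + b) * c = a * c + b * c" "a * (b + c) = a * b + a * c"
    by (transfer, simp add: bounded_bilinear.add_left[OF bounded_bilinear_blinfun_compose]
        bounded_bilinear.add_right[OF bounded_bilinear_blinfun_compose])+
  show "r *\<^sub>R a * b = r *\<^sub>R (a * b)" "a * r *\<^sub>R b = r *\<^sub>R (a * b)"
    by (transfer, simp add: bounded_bilinear.scaleR_left[OF bounded_bilinear_blinfun_compose]
        bounded_bilinear.scaleR_right[OF bounded_bilinear_blinfun_compose])+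
  show "norm (a * b) \<le> norm a * norm b"
    by transfer (rule norm_blinfun_compose)
  show "norm (a + b) \<le> norm a + norm b"
    by transfer (rule norm_triangle_ineq)
  show "norm a = 0 \<longleftrightarrow> a = 0" "norm (r *\<^sub>R a) = \<bar>r\<bar> * norm a"
    by (transfer, simp)+
qed (unfold dist_endo_def sgn_endo_def uniformity_endo_def open_endo_def, (rule refl | (transfer, simp add: algebra_simps))+)

end

text \<open>On the zero space the identity has norm 0; \<open>perfect_space\<close> excludes this,
  so that \<open>norm 1 = 1\<close> and \<open>0 \<noteq> 1\<close> can hold.\<close>

instantiation endo :: ("{real_normed_vector, perfect_space}") real_normed_algebra_1
begin
lift_definition one_endo :: "'a endo" is id_blinfun .
instance
proof
  fix a :: "'a endo"
  show "1 * a = a" "a * 1 = a"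
    by (transfer, rule blinfun_eqI, simp)+
  show norm_1: "norm (1 :: 'a endo) = 1"
    by transfer simp
  have "norm (0 :: 'a endo) = 0"
    by transfer simp
  then show "(0 :: 'a endo) \<noteq> 1"
    using norm_1 by force
qed
end

instance endo :: (banach) banach
proof
  fix X :: "nat \<Rightarrow> 'a endo"
  assume "Cauchy X"
  then have "Cauchy (\<lambda>n. blinfun_of_endo (X n))"
    by (simp add: Cauchy_def dist_norm) (transfer, simp)
  then obtain L where "(\<lambda>n. blinfun_of_endo (X n)) \<longlonglongrightarrow> L"
    using Cauchy_convergent convergent_def by blast
  then have "X \<longlonglongrightarrow> Endo L"
    by (simp add: LIMSEQ_iff norm_endo.rep_eq minus_endo.rep_eq Endo_inverse)
  then show "convergent X"
    by (auto simp: convergent_def)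
qed

definition endo_of_matrix :: "real^'n^'n \<Rightarrow> (real^'n) endo" where
  "endo_of_matrix A = Endo (Blinfun ((*v) A))"

definition matrix_of_endo :: "(real^'n) endo \<Rightarrow> real^'n^'n" where
  "matrix_of_endo f = matrix (blinfun_apply (blinfun_of_endo f))"

lemma apply_endo_of_matrix: "blinfun_apply (blinfun_of_endo (endo_of_matrix A)) = (*v) A"
  by (simp add: endo_of_matrix_def Endo_inverse bounded_linear_Blinfun_apply matrix_vector_mul_bounded_linear)

lemma matrix_of_endo_of_matrix [simp]: "matrix_of_endo (endo_of_matrix A) = A"
  by (simp add: matrix_of_endo_def apply_endo_of_matrix)

lemma matrix_of_endo_vector_mult: "matrix_of_endo f *v x = blinfun_apply (blinfun_of_endo f) x"
  by (simp add: matrix_of_endo_def matrix_works bounded_linear.linear blinfun.bounded_linear_right)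

lemma matrix_of_endo_mult: "matrix_of_endo (f * g) = matrix_of_endo f ** matrix_of_endo g"
  by (simp add: matrix_eq matrix_of_endo_vector_mult times_endo.rep_eq flip: matrix_vector_mul_assoc)

lemma matrix_of_endo_one: "matrix_of_endo 1 = mat 1"
  by (simp add: matrix_eq matrix_of_endo_vector_mult one_endo.rep_eq)

text \<open>Each entry is a coordinate of the image of a unit vector, hence at most the operator
  norm; summing over all entries costs the square of the dimension. Continuity is what carries
  series, derivatives and closed conditions from \<open>endo\<close> over to matrices.\<close>

lemma bounded_linear_matrix_of_endo: "bounded_linear matrix_of_endo"
proof (rule linear_conv_bounded_linear[THEN iffD1, THEN bounded_linear.bounded_linear] bounded_linear_intro)
  fix f g :: "(real^'n) endo" and r :: real
  show "matrix_of_endo (f + g) = matrix_of_endo f + matrix_of_endo g"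
    by (simp add: matrix_eq matrix_of_endo_vector_mult plus_endo.rep_eq matrix_vector_mult_add_rdistrib
        plus_blinfun.rep_eq)
  show "matrix_of_endo (r *\<^sub>R f) = r *\<^sub>R matrix_of_endo f"
    by (simp add: matrix_eq matrix_of_endo_vector_mult scaleR_endo.rep_eq scaleR_blinfun.rep_eq
        flip: scaleR_matrix_vector_assoc)
  have entry: "\<bar>matrix_of_endo f $ i $ j\<bar> \<le> norm f" for i j
  proof -
    have "\<bar>matrix_of_endo f $ i $ j\<bar> \<le> norm (blinfun_apply (blinfun_of_endo f) (axis j 1))"
      by (simp add: matrix_of_endo_def matrix_def component_le_norm_cart)
    also have "\<dots> \<le> norm f"
      using norm_blinfun[of "blinfun_of_endo f" "axis j 1"] by (simp add: norm_endo.rep_eq)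
    finally show ?thesis .
  qed
  have "norm (matrix_of_endo f $ i) \<le> (\<Sum>j\<in>(UNIV::'n set). norm f)" for i
    by (rule order_trans[OF norm_le_l1_cart]) (intro sum_mono entry)
  then have "norm (matrix_of_endo f) \<le> (\<Sum>i\<in>(UNIV::'n set). \<Sum>j\<in>(UNIV::'n set). norm f)"
    unfolding norm_vec_def[of "matrix_of_endo f"]
    by (intro order_trans[OF L2_set_le_sum] sum_mono) (simp_all add: norm_vec_def[symmetric])
  then show "norm (matrix_of_endo f) \<le> norm f * (real CARD('n) * real CARD('n))"
    by (simp add: mult_ac)
qed

text \<open>\<open>matrix_of_endo\<close> is continuous, linear and multiplicative, so it maps the
  power series of \<open>exp\<close> term by term to the series that defines \<open>mat_exp\<close>.
  All laws of the matrix exponential below come through this bridge.\<close>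

lemma mat_exp_eq: "mat_exp A = matrix_of_endo (exp (endo_of_matrix A))"
proof -
  have pow: "matrix_of_endo (endo_of_matrix A ^ k) = ((\<lambda>M. A ** M) ^^ k) (mat 1)" for k
    by (induction k) (simp_all add: matrix_of_endo_one matrix_of_endo_mult)
  have "matrix_of_endo (exp (endo_of_matrix A))
      = (\<Sum>k. matrix_of_endo (endo_of_matrix A ^ k /\<^sub>R fact k))"
    unfolding exp_def
    by (rule bounded_linear.suminf[OF bounded_linear_matrix_of_endo summable_exp_generic])
  then show ?thesis
    by (simp add: mat_exp_def linear_cmul[OF bounded_linear.linear[OF bounded_linear_matrix_of_endo]] pow divide_inverse)
qed

lemma endo_of_matrix_scaleR: "endo_of_matrix (r *\<^sub>R A) = r *\<^sub>R endo_of_matrix A"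
proof -
  have "blinfun_of_endo (endo_of_matrix (r *\<^sub>R A)) = blinfun_of_endo (r *\<^sub>R endo_of_matrix A)"
    by (rule blinfun_eqI) (simp add: scaleR_endo.rep_eq apply_endo_of_matrix scaleR_blinfun.rep_eq
        flip: scaleR_matrix_vector_assoc)
  then show ?thesis
    by (simp add: blinfun_of_endo_inject)
qed

lemma mat_exp_scaleR_add: "mat_exp ((r + s) *\<^sub>R A) = mat_exp (r *\<^sub>R A) ** mat_exp (s *\<^sub>R A)"
proof -
  have "exp ((r + s) *\<^sub>R endo_of_matrix A) = exp (r *\<^sub>R endo_of_matrix A) * exp (s *\<^sub>R endo_of_matrix A)"
    unfolding scaleR_add_left by (rule exp_add_commuting) (simp add: mult_ac)
  then show ?thesis
    by (simp only: mat_exp_eq endo_of_matrix_scaleR matrix_of_endo_mult)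
qed

lemma mat_exp_0: "mat_exp 0 = (mat 1 :: real^'n^'n)"
proof -
  have "endo_of_matrix 0 = (0 :: (real^'n) endo)"
    using endo_of_matrix_scaleR[of 0 "0::real^'n^'n"] by simp
  then show ?thesis
    by (simp add: mat_exp_eq matrix_of_endo_one)
qed

lemma has_vector_derivative_mat_exp:
  "((\<lambda>t. mat_exp (t *\<^sub>R A)) has_vector_derivative mat_exp (t *\<^sub>R A) ** A) (at t)"
  using bounded_linear.has_vector_derivative[OF bounded_linear_matrix_of_endo
      exp_scaleR_has_vector_derivative_right[of "endo_of_matrix A" t UNIV]]
  by (simp add: mat_exp_eq endo_of_matrix_scaleR matrix_of_endo_mult)

lemma continuous_on_mat_exp: "continuous_on S (\<lambda>t. mat_exp (t *\<^sub>R A))"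
  by (intro continuous_at_imp_continuous_on ballI has_vector_derivative_continuous[OF has_vector_derivative_mat_exp])

section \<open>Liouville's formula for the determinant of the exponential\<close>

text \<open>A permutation that moves \<open>k\<close> also moves \<open>p k\<close>, so it moves at
  least two points, and omitting the single index \<open>i\<close> still leaves a factor 0. In the
  product rule at the identity matrix this removes every permutation except
  \<open>id\<close>.\<close>

lemma prod_fixpoints_eq_0:
  fixes p :: "'n::finite \<Rightarrow> 'n"
  assumes p: "p permutes UNIV" and "p \<noteq> id"
  shows "(\<Prod>j\<in>UNIV - {i}. of_bool (j = p j)) = (0::real)"
proof -
  obtain k where k: "p k \<noteq> k"
    using \<open>p \<noteq> id\<close> by (auto simp: fun_eq_iff)
  have pk: "p (p k) \<noteq> p k"
    using k permutes_inj[OF p] by (auto dest: injD)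
  obtain l where "l \<noteq> i" "p l \<noteq> l"
    using k pk by (cases "k = i") auto
  then show ?thesis
    by (intro prod_zero) (auto intro!: bexI[of _ l])
qed

text \<open>Differentiate the Leibniz formula. At \<open>t = 0\<close> the undifferentiated factors
  are entries of the identity matrix, so only the permutation \<open>id\<close> survives, and it
  contributes the sum of the diagonal entries of \<open>A\<close>.\<close>

lemma has_derivative_det_mat_exp_0:
  fixes A :: "real^'n^'n"
  shows "((\<lambda>t. det (mat_exp (t *\<^sub>R A))) has_real_derivative trace A) (at 0)"
proof -
  have "((\<lambda>t. mat_exp (t *\<^sub>R A)) has_vector_derivative A) (at 0)"
    using has_vector_derivative_mat_exp[of A 0] by (simp add: mat_exp_0)
  then have "((\<lambda>t. mat_exp (t *\<^sub>R A) $ i $ j) has_vector_derivative A $ i $ j) (at 0)" for i j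
    using bounded_linear.has_vector_derivative[OF bounded_linear_compose[OF bounded_linear_vec_nth bounded_linear_vec_nth]]
    by blast
  then have entry: "((\<lambda>t. mat_exp (t *\<^sub>R A) $ i $ j) has_real_derivative A $ i $ j) (at 0)" for i j
    by (simp add: has_real_derivative_iff_has_vector_derivative)
  let ?D = "\<lambda>p. \<Sum>i\<in>UNIV. A $ i $ p i * (\<Prod>j\<in>UNIV - {i}. mat_exp (0 *\<^sub>R A) $ j $ p j)"
  have "((\<lambda>t. det (mat_exp (t *\<^sub>R A))) has_real_derivative
      (\<Sum>p | p permutes UNIV. of_int (sign p) * ?D p)) (at 0)"
    unfolding det_def
    by (intro DERIV_sum DERIV_cmult has_field_derivative_prod entry)
  also have "(\<Sum>p | p permutes UNIV. of_int (sign p) * ?D p) = trace A"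
  proof -
    have D: "?D p = (\<Sum>i\<in>UNIV. A $ i $ p i * (\<Prod>j\<in>UNIV - {i}. of_bool (j = p j)))" for p
      by (simp add: mat_exp_0 mat_def of_bool_def)
    have "(\<Sum>p | p permutes UNIV. of_int (sign p) * ?D p)
        = (\<Sum>p | p permutes (UNIV :: 'n set). if p = id then trace A else 0)"
      unfolding D
      by (rule sum.cong[OF refl]) (auto simp: prod_fixpoints_eq_0 trace_def)
    also have "\<dots> = trace A"
      by (simp add: sum.delta' permutes_id finite_permutations)
    finally show ?thesis .
  qed
  finally show ?thesis .
qed

text \<open>\<open>f\<close> turns sums into products, so its derivative at 0 determines it
  everywhere: f' = f tr A. Therefore f(t) exp (- t tr A) is constant, and comparing t = 1 with t = 0
  gives the formula.\<close>

theorem det_mat_exp: "det (mat_exp A) = exp (trace A)"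
proof -
  define f where "f t = det (mat_exp (t *\<^sub>R A))" for t
  have f_add: "f (s + t) = f s * f t" for s t
    by (simp add: f_def mat_exp_scaleR_add det_mul)
  have f': "(f has_real_derivative f t * trace A) (at t)" for t
  proof -
    have "((\<lambda>x. f (x - t)) has_real_derivative trace A) (at t)"
      using has_derivative_det_mat_exp_0[of A] DERIV_shift[of f "trace A" t "- t"]
      by (simp add: f_def[abs_def])
    then have "((\<lambda>x. f t * f (x - t)) has_real_derivative f t * trace A) (at t)"
      by (rule DERIV_cmult)
    then show ?thesis
      by (simp flip: f_add)
  qed
  have "((\<lambda>t. f t * exp (- (t * trace A))) has_real_derivative 0) (at t)" for t
    by (rule derivative_eq_intros f' refl | simp add: algebra_simps)+
  then have "f 1 * exp (- (1 * trace A)) = f 0 * exp (- (0 * trace A))"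
    by (intro DERIV_isconst_all) auto
  then show ?thesis
    by (simp add: f_def mat_exp_0 exp_minus field_simps)
qed


section \<open>The square root of a positive definite matrix\<close>

text \<open>The form may be degenerate, so the usual inequality for inner products does not apply
  directly. The polynomial t \<mapsto> (u + t v) A (u + t v) is nonnegative: if its leading
  coefficient vanishes its slope must vanish too, and otherwise the inequality is its value at the
  minimiser.\<close>

lemma pos_semidef_Cauchy_Schwarz:
  assumes "pos_semidef A"
  shows "(u \<bullet> (A *v v))\<^sup>2 \<le> (u \<bullet> (A *v u)) * (v \<bullet> (A *v v))"
proof -
  have sym: "v \<bullet> (A *v u) = u \<bullet> (A *v v)"
    using assms by (metis dot_lmul_matrix inner_commute pos_semidef_def vector_transpose_matrix)
  have "0 \<le> u \<bullet> (A *v u) + 2 * t * (u \<bullet> (A *v v)) + t\<^sup>2 * (v \<bullet> (A *v v))" for t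
  proof -
    have "0 \<le> (u + t *\<^sub>R v) \<bullet> (A *v (u + t *\<^sub>R v))"
      using assms by (simp add: pos_semidef_def)
    also have "\<dots> = u \<bullet> (A *v u) + 2 * t * (u \<bullet> (A *v v)) + t\<^sup>2 * (v \<bullet> (A *v v))"
      by (simp add: matrix_vector_right_distrib inner_add_left inner_add_right sym
          power2_eq_square algebra_simps flip: scaleR_matrix_vector_assoc matrix_vector_mult_scaleR)
         (simp add: matrix_vector_mult_scaleR sym algebra_simps)
    finally show ?thesis .
  qed
  note q = this
  have nonneg: "0 \<le> u \<bullet> (A *v u)" "0 \<le> v \<bullet> (A *v v)"
    using assms by (simp_all add: pos_semidef_def)
  show ?thesis
  proof (cases "v \<bullet> (A *v v) = 0")
    case True
    have "u \<bullet> (A *v v) = 0"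
    proof (rule ccontr)
      assume "u \<bullet> (A *v v) \<noteq> 0"
      \<comment> \<open>At this t the polynomial, which is affine here, takes the value -1.\<close>
      then show False
        using q[of "- (u \<bullet> (A *v u) + 1) / (2 * (u \<bullet> (A *v v)))"] True by (simp add: field_simps)
    qed
    then show ?thesis
      using nonneg by simp
  next
    case False
    then have "0 < v \<bullet> (A *v v)"
      using nonneg by simp
    then show ?thesis
      using q[of "- (u \<bullet> (A *v v)) / (v \<bullet> (A *v v))"] by (simp add: field_simps power2_eq_square)
  qed
qed

text \<open>If v A v = 0, Cauchy-Schwarz for the pair A v and v bounds the fourth power of the norm
  of A v by 0, against injectivity.\<close>

lemma pos_semidef_imp_pos_def:
  assumes "pos_semidef A" "\<And>v. v \<noteq> 0 \<Longrightarrow> A *v v \<noteq> 0"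
  shows "pos_def A"
  unfolding pos_def_def
proof (intro conjI allI impI)
  fix v :: "real^'a"
  assume "v \<noteq> 0"
  have "v \<bullet> (A *v v) \<noteq> 0"
  proof
    assume "v \<bullet> (A *v v) = 0"
    then have "((A *v v) \<bullet> (A *v v))\<^sup>2 \<le> 0"
      using pos_semidef_Cauchy_Schwarz[OF assms(1), of "A *v v" v] by simp
    then show False
      using assms(2)[OF \<open>v \<noteq> 0\<close>] by simp
  qed
  then show "0 < v \<bullet> (A *v v)"
    using assms(1) by (simp add: pos_semidef_def less_le)
qed (use assms(1) in \<open>simp add: pos_semidef_def\<close>)

lemma inner_matrix_vector_mult_symmetric:
  fixes A :: "real^'n^'n"
  assumes "transpose A = A"
  shows "u \<bullet> (A *v v) = (A *v u) \<bullet> v"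
  using assms by (metis dot_lmul_matrix vector_transpose_matrix)

lemma trace_eq_sum_inner: "trace (A :: real^'n^'n) = (\<Sum>i\<in>UNIV. axis i 1 \<bullet> (A *v axis i 1))"
  by (simp add: trace_def inner_axis' matrix_vector_mul_component row_def inner_axis
      matrix_vector_mult_basis column_def)

text \<open>A trace argument takes the place of simultaneous diagonalisation. With D = R - S,
  equality of the squares reads R D + D S = 0. Multiplying by D on the left and taking traces gives
  tr (D R D) + tr (D S D) = 0 with both summands nonnegative, so both vanish; R is definite by
  injectivity, which forces every column of D to be 0.\<close>

lemma pos_semidef_sqrt_unique:
  assumes "pos_semidef R" "pos_semidef S" "R ** R = S ** S" and R_inj: "\<And>v. v \<noteq> 0 \<Longrightarrow> R *v v \<noteq> 0"
  shows "R = S"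
proof -
  define D where "D = R - S"
  have D: "transpose D = D"
    using assms(1,2) by (simp add: D_def pos_semidef_def transpose_def vec_eq_iff)
  have tr: "trace (D ** (A ** D)) = (\<Sum>i\<in>UNIV. (D *v axis i 1) \<bullet> (A *v (D *v axis i 1)))" for A :: "real^'a^'a"
    by (simp add: trace_eq_sum_inner inner_matrix_vector_mult_symmetric[OF D] flip: matrix_vector_mul_assoc)
  have "R ** D + D ** S = R ** R - S ** S"
    by (simp add: D_def vec_eq_iff matrix_matrix_mult_def algebra_simps sum_subtractf)
  then have "R ** D + D ** S = 0"
    by (simp add: assms(3))
  then have "D ** (R ** D) + D ** (D ** S) = 0"
    by (simp flip: matrix_add_ldistrib)
  then have "trace (D ** (R ** D)) + trace (D ** (D ** S)) = 0"
    by (metis mat_0 trace_0 trace_add)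
  then have "trace (D ** (R ** D)) + trace (D ** (S ** D)) = 0"
    by (metis matrix_mul_assoc trace_mul_sym)
  moreover have "0 \<le> trace (D ** (S ** D))"
    unfolding tr using assms(2) by (auto intro!: sum_nonneg simp: pos_semidef_def)
  moreover have R: "0 \<le> (D *v axis i 1) \<bullet> (R *v (D *v axis i 1))" for i
    using assms(1) by (simp add: pos_semidef_def)
  ultimately have "(\<Sum>i\<in>UNIV. (D *v axis i 1) \<bullet> (R *v (D *v axis i 1))) = 0"
    using sum_nonneg[of UNIV "\<lambda>i. (D *v axis i 1) \<bullet> (R *v (D *v axis i 1))"] by (simp add: tr)
  then have "(D *v axis i 1) \<bullet> (R *v (D *v axis i 1)) = 0" for i
    using R by (simp add: sum_nonneg_eq_0_iff)
  then have "D *v axis i 1 = 0" for i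
    using pos_semidef_imp_pos_def[OF assms(1) R_inj] by (metis less_irrefl pos_def_def)
  then have "D = 0"
    by (simp add: matrix_vector_mult_basis column_def vec_eq_iff)
  then show ?thesis
    by (simp add: D_def)
qed

lemma norm_apply_endo: "norm (blinfun_apply (blinfun_of_endo f) x) \<le> norm f * norm x"
  by (simp add: norm_endo.rep_eq norm_blinfun)

lemma norm_endo_bound:
  "0 \<le> b \<Longrightarrow> (\<And>x. norm (blinfun_apply (blinfun_of_endo f) x) \<le> b * norm x) \<Longrightarrow> norm f \<le> b"
  by (simp add: norm_endo.rep_eq norm_blinfun_bound)

text \<open>The minimum of the form on the compact unit sphere is attained and hence positive;
  homogeneity does the rest. This \<open>m\<close> keeps the contraction ratio of the square root
  iteration strictly below 1.\<close>

lemma pos_def_lower_bound: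
  fixes A :: "real^'n^'n"
  assumes "pos_def A"
  obtains m where "0 < m" "\<And>v. m * (v \<bullet> v) \<le> v \<bullet> (A *v v)"
proof -
  let ?S = "sphere (0 :: real^'n) 1"
  have "axis undefined 1 \<in> ?S"
    by simp
  moreover have "continuous_on ?S (\<lambda>v. v \<bullet> (A *v v))"
    by (intro continuous_on_inner continuous_on_id linear_continuous_on matrix_vector_mul_bounded_linear)
  ultimately obtain w where w: "w \<in> ?S" "\<And>v. v \<in> ?S \<Longrightarrow> w \<bullet> (A *v w) \<le> v \<bullet> (A *v v)"
    using continuous_attains_inf[OF compact_sphere, of "0 :: real^'n" 1] by blast
  have "w \<bullet> (A *v w) * (v \<bullet> v) \<le> v \<bullet> (A *v v)" for v
  proof (cases "v = 0")
    case False
    have "w \<bullet> (A *v w) \<le> (v /\<^sub>R norm v) \<bullet> (A *v (v /\<^sub>R norm v))"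
      using False by (intro w) simp
    then show ?thesis
      using False
      by (simp add: matrix_vector_mult_scaleR divide_simps dot_square_norm power2_eq_square mult_ac)
  qed simp
  moreover have "0 < w \<bullet> (A *v w)"
    using assms w(1) by (metis mem_sphere_0 norm_zero pos_def_def zero_neq_one)
  ultimately show thesis
    using that by blast
qed

text \<open>The square root is \<open>sqrt M *\<^sub>R (1 - X)\<close>, where \<open>X\<close> is the fixed point of the contraction
  \<open>X \<mapsto> (A + X\<^sup>2) / 2\<close> with \<open>A = 1 - Q / M\<close>.\<close>

lemma pos_def_sqrt_exists:
  fixes Q :: "real^'n^'n"
  assumes Q: "pos_def Q"
  shows "\<exists>R. pos_semidef R \<and> R ** R = Q"
proof -
  obtain m where m: "0 < m" "\<And>v. m * (v \<bullet> v) \<le> v \<bullet> (Q *v v)"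
    using pos_def_lower_bound[OF Q] by blast
  \<comment> \<open>The operator norm alone would bound the form from above; adding \<open>m\<close>
    makes M >= m evident, so that \<open>\<rho>\<close> = 1 - m / M lies in [0, 1).\<close>
  define M where "M = onorm ((*v) Q) + m"
  have M: "0 < M" "m \<le> M"
    using m(1) onorm_pos_le[OF matrix_vector_mul_bounded_linear, of Q] by (simp_all add: M_def)
  have upper: "v \<bullet> (Q *v v) \<le> M * (v \<bullet> v)" for v
  proof -
    have "v \<bullet> (Q *v v) \<le> norm v * (onorm ((*v) Q) * norm v)"
      using norm_cauchy_schwarz[of v "Q *v v"] onorm[OF matrix_vector_mul_bounded_linear, of Q v]
      by (meson mult_left_mono norm_ge_zero order_trans)
    also have "\<dots> \<le> M * (v \<bullet> v)"
      using m(1) by (simp add: M_def dot_square_norm power2_eq_square algebra_simps)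
    finally show ?thesis .
  qed
  define A where "A = mat 1 - (1 / M) *\<^sub>R Q"
  define \<rho> where "\<rho> = 1 - m / M"
  have \<rho>: "0 \<le> \<rho>" "\<rho> < 1"
    using M m(1) by (simp_all add: \<rho>_def)
  have A_apply: "A *v v = v - (1 / M) *\<^sub>R (Q *v v)" for v
    by (simp add: A_def matrix_vector_mult_diff_rdistrib flip: scaleR_matrix_vector_assoc)
  have A_sym: "transpose A = A"
    using Q by (simp add: A_def pos_def_def transpose_def vec_eq_iff mat_def)
  have A_psd: "pos_semidef A"
    using upper M A_sym by (simp add: pos_semidef_def A_apply inner_diff_right field_simps)
  have A_upper: "v \<bullet> (A *v v) \<le> \<rho> * (v \<bullet> v)" for v
    using m(2)[of v] M by (simp add: A_apply inner_diff_right \<rho>_def field_simps)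
  \<comment> \<open>Cauchy-Schwarz for the pair A v and v upgrades the bound on the quadratic form
    to a bound on the operator norm, with the same constant.\<close>
  have A_norm: "norm (A *v v) \<le> \<rho> * norm v" for v
  proof (cases "A *v v = 0")
    case False
    have "((A *v v) \<bullet> (A *v v))\<^sup>2 \<le> ((A *v v) \<bullet> (A *v (A *v v))) * (v \<bullet> (A *v v))"
      by (rule pos_semidef_Cauchy_Schwarz[OF A_psd])
    also have "\<dots> \<le> (\<rho> * ((A *v v) \<bullet> (A *v v))) * (\<rho> * (v \<bullet> v))"
      using A_psd \<rho> by (intro mult_mono A_upper) (simp_all add: pos_semidef_def)
    finally have "(norm (A *v v))\<^sup>2 \<le> (\<rho> * norm v)\<^sup>2"
      using False by (simp add: dot_square_norm power2_eq_square algebra_simps)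
    then show ?thesis
      using \<rho>(1) by (simp add: power2_le_iff_abs_le)
  qed (use \<rho> in simp)
  define a where "a = endo_of_matrix A"
  have a_norm: "norm a \<le> \<rho>"
    by (rule norm_endo_bound) (simp_all add: \<rho> a_def apply_endo_of_matrix A_norm)
  define F where "F X = (1/2) *\<^sub>R (a + X * X)" for X
  \<comment> \<open>The invariant set carries what the fixed point has to inherit: symmetry, a
    closed condition preserved by \<open>F\<close>, and norm at most \<rho> < 1, which makes 1 - X
    positive.\<close>
  define S where "S = {X :: (real^'n) endo. norm X \<le> \<rho> \<and> transpose (matrix_of_endo X) = matrix_of_endo X}"
  have "closed S"
    unfolding S_def transpose_def vec_eq_iff vec_lambda_beta
    by (intro closed_Collect_conj closed_Collect_le closed_Collect_all closed_Collect_eq continuous_intros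
        bounded_linear.continuous_on[OF bounded_linear_matrix_of_endo])
  note complete_eq_closed[THEN iffD2, OF this]
  moreover have "S \<noteq> {}"
    using \<rho>(1) by (auto simp: S_def transpose_def vec_eq_iff
        linear_0[OF bounded_linear.linear[OF bounded_linear_matrix_of_endo]] intro!: exI[of _ 0])
  moreover have "F ` S \<subseteq> S"
  proof clarify
    fix X
    assume "X \<in> S"
    then have X: "norm X \<le> \<rho>" "transpose (matrix_of_endo X) = matrix_of_endo X"
      by (simp_all add: S_def)
    have "norm (X * X) \<le> \<rho> * 1"
      using X(1) \<rho> by (intro order_trans[OF norm_mult_ineq] mult_mono) auto
    then have "norm (F X) \<le> \<rho>"
      using a_norm norm_triangle_ineq[of a "X * X"] by (simp add: F_def)
    moreover have "matrix_of_endo (F X) = (1/2) *\<^sub>R (A + matrix_of_endo X ** matrix_of_endo X)"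
      by (simp only: F_def a_def matrix_of_endo_mult matrix_of_endo_of_matrix
          linear_cmul[OF bounded_linear.linear[OF bounded_linear_matrix_of_endo]]
          linear_add[OF bounded_linear.linear[OF bounded_linear_matrix_of_endo]])
    moreover have "transpose (matrix_of_endo X ** matrix_of_endo X) = matrix_of_endo X ** matrix_of_endo X"
      by (simp add: matrix_transpose_mul X)
    ultimately have "transpose (matrix_of_endo (F X)) = matrix_of_endo (F X)"
      using A_sym by (simp add: transpose_def vec_eq_iff del: eq_divide_eq_numeral1)
    then show "F X \<in> S"
      using \<open>norm (F X) \<le> \<rho>\<close> by (simp add: S_def)
  qed
  moreover have "dist (F X) (F Y) \<le> \<rho> * dist X Y" if "X \<in> S" "Y \<in> S" for X Y
  proof -
    \<comment> \<open>This splitting of X^2 - Y^2 does not assume that X and Y commute. Each of the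
      two terms is at most \<rho> times the distance, and the factor 1/2 averages them.\<close>
    have "F X - F Y = (1/2) *\<^sub>R (X * (X - Y) + (X - Y) * Y)"
      by (simp add: F_def left_diff_distrib right_diff_distrib flip: scaleR_diff_right)
    moreover have "norm (X * (X - Y)) \<le> \<rho> * norm (X - Y)" "norm ((X - Y) * Y) \<le> norm (X - Y) * \<rho>"
      using that \<rho>(1) by (auto simp: S_def intro!: order_trans[OF norm_mult_ineq] mult_mono)
    moreover have "norm (F X - F Y) = norm (X * (X - Y) + (X - Y) * Y) / 2"
      unfolding \<open>F X - F Y = _\<close> by simp
    ultimately show ?thesis
      using norm_triangle_ineq[of "X * (X - Y)" "(X - Y) * Y"] mult.commute[of \<rho> "norm (X - Y)"]
      unfolding dist_norm by linarith
  qed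
  ultimately obtain X where X: "X \<in> S" "F X = X"
    using Banach_fix[of S \<rho> F] \<rho> by blast
  define R where "R = sqrt M *\<^sub>R matrix_of_endo (1 - X)"
  have R_apply: "matrix_of_endo (1 - X) *v v = v - matrix_of_endo X *v v" for v
    by (simp add: matrix_of_endo_vector_mult minus_endo.rep_eq one_endo.rep_eq blinfun.diff_left)
  have "transpose (matrix_of_endo (1 - X)) = matrix_of_endo (1 - X)"
  proof -
    have "transpose (mat 1 - B) = mat 1 - B" if "transpose B = B" for B :: "real^'n^'n"
      using that by (simp add: transpose_def vec_eq_iff mat_def)
    then show ?thesis
      using X(1) unfolding S_def matrix_of_endo_one
        linear_diff[OF bounded_linear.linear[OF bounded_linear_matrix_of_endo]] by blast
  qed
  moreover have "0 \<le> v \<bullet> (matrix_of_endo (1 - X) *v v)" for v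
  proof -
    have "v \<bullet> (matrix_of_endo X *v v) \<le> norm v * (norm X * norm v)"
      using norm_cauchy_schwarz[of v "matrix_of_endo X *v v"] norm_apply_endo[of X v]
      unfolding matrix_of_endo_vector_mult by (meson mult_left_mono norm_ge_zero order_trans)
    also have "\<dots> \<le> norm v * (1 * norm v)"
      using X(1) \<rho> by (intro mult_left_mono mult_right_mono) (auto simp: S_def)
    finally show ?thesis
      by (simp add: R_apply inner_diff_right dot_square_norm power2_eq_square)
  qed
  ultimately have "pos_semidef R"
    using M by (simp add: R_def pos_semidef_def transpose_def vec_eq_iff flip: scaleR_matrix_vector_assoc)
  moreover have "R ** R = Q"
  proof -
    \<comment> \<open>Reading the fixed point equation as a + X^2 = 2 X gives (1 - X)^2 = 1 - a,
      whose matrix is Q / M.\<close>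
    have "a + X * X = 2 *\<^sub>R X"
      using arg_cong[OF X(2), of "\<lambda>Y. 2 *\<^sub>R Y"] unfolding F_def by simp
    then have "a = X + X - X * X"
      by (simp add: scaleR_2 eq_diff_eq)
    then have "(1 - X) * (1 - X) = 1 - a"
      by (simp add: left_diff_distrib right_diff_distrib)
    then have "matrix_of_endo (1 - X) ** matrix_of_endo (1 - X) = matrix_of_endo (1 - a)"
      by (metis matrix_of_endo_mult)
    also have "\<dots> = mat 1 - A"
      by (simp add: a_def matrix_of_endo_one linear_diff[OF bounded_linear.linear[OF bounded_linear_matrix_of_endo]])
    also have "\<dots> = (1 / M) *\<^sub>R Q"
      by (simp add: A_def)
    finally have *: "matrix_of_endo (1 - X) ** matrix_of_endo (1 - X) = (1 / M) *\<^sub>R Q" .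
    have "R ** R = (sqrt M * sqrt M) *\<^sub>R (matrix_of_endo (1 - X) ** matrix_of_endo (1 - X))"
      by (simp only: R_def matrix_scalar_ac scalar_matrix_assoc[symmetric] scaleR_scaleR)
    then show ?thesis
      using M by (simp add: *)
  qed
  ultimately show ?thesis
    by blast
qed

text \<open>\<open>THE\<close> requires existence and uniqueness. Uniqueness applies because a root
  of the injective matrix \<open>Q\<close> is itself injective.\<close>

lemma mat_sqrt_pos_def:
  assumes "pos_def Q"
  shows "pos_semidef (mat_sqrt Q)" "mat_sqrt Q ** mat_sqrt Q = Q"
proof -
  obtain R where R: "pos_semidef R" "R ** R = Q"
    using pos_def_sqrt_exists[OF assms] by blast
  have inj: "R *v v \<noteq> 0" if "v \<noteq> 0" for v
  proof
    assume "R *v v = 0"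
    then have "Q *v v = 0"
      by (simp flip: R(2) matrix_vector_mul_assoc)
    then show False
      using assms that by (auto simp: pos_def_def)
  qed
  have "mat_sqrt Q = R"
    unfolding mat_sqrt_def
  proof (rule the_equality)
    fix S
    assume "pos_semidef S \<and> S ** S = Q"
    then show "S = R"
      using pos_semidef_sqrt_unique[OF R(1) _ _ inj, of S] R(2) by metis
  qed (use R in blast)
  then show "pos_semidef (mat_sqrt Q)" "mat_sqrt Q ** mat_sqrt Q = Q"
    using R by auto
qed

lemma mat_sqrt_eq_0_iff:
  assumes "pos_def Q"
  shows "mat_sqrt Q *v v = 0 \<longleftrightarrow> v = 0"
proof
  assume "mat_sqrt Q *v v = 0"
  then have "Q *v v = 0"
    by (metis mat_sqrt_pos_def(2)[OF assms] matrix_vector_mul_assoc matrix_vector_mult_0_right)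
  then show "v = 0"
    using assms by (auto simp: pos_def_def)
qed simp

section \<open>Linear substitutions in Lebesgue integrals\<close>

lemma nn_integral_lborel_shift:
  fixes f :: "'a::euclidean_space \<Rightarrow> ennreal"
  assumes [measurable]: "f \<in> borel_measurable borel"
  shows "(\<integral>\<^sup>+x. f (c + x) \<partial>lborel) = (\<integral>\<^sup>+x. f x \<partial>lborel)"
proof -
  have "(\<integral>\<^sup>+x. f x \<partial>lborel) = (\<integral>\<^sup>+x. f x \<partial>distr lborel borel ((+) c))"
    by (simp add: lborel_distr_plus)
  also have "\<dots> = (\<integral>\<^sup>+x. f (c + x) \<partial>lborel)"
    by (rule nn_integral_distr) simp_all
  finally show ?thesis ..
qed

lemma borel_measurable_matrix_vector_mult [measurable]: "(\<lambda>x. A *v x) \<in> borel_measurable borel"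
  for A :: "real^'n^'m"
  by (intro borel_measurable_continuous_onI linear_continuous_on matrix_vector_mul_bounded_linear)

lemma borel_measurable_indicator_matrix_vector_mult [measurable]:
  fixes A :: "real^'n^'m"
  shows "(\<lambda>x. indicator (cball 0 1) (A *v x) :: ennreal) \<in> borel_measurable borel"
  by (rule measurable_compose[OF borel_measurable_matrix_vector_mult]) (rule borel_measurable_indicator, simp)

definition ball_integral :: "real^'n^'n \<Rightarrow> ennreal" where
  "ball_integral A = (\<integral>\<^sup>+x. indicator (cball 0 1) (A *v x) \<partial>lborel)"

lemma ball_integral_one:
  "0 < ball_integral (mat 1 :: real^'n^'n)" "ball_integral (mat 1 :: real^'n^'n) < \<infinity>"
proof -
  have *: "ball_integral (mat 1 :: real^'n^'n) = emeasure lborel (cball (0 :: real^'n) 1)"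
    by (simp add: ball_integral_def)
  show "ball_integral (mat 1 :: real^'n^'n) < \<infinity>"
    unfolding * by (rule emeasure_lborel_cball_finite)
  have "emeasure lborel (ball (0 :: real^'n) 1) \<le> emeasure lborel (cball (0 :: real^'n) 1)"
    by (intro emeasure_mono ball_subset_cball) simp
  moreover have "0 < emeasure lborel (ball (0 :: real^'n) 1)"
    by (simp add: emeasure_ball unit_ball_vol_pos)
  ultimately show "0 < ball_integral (mat 1 :: real^'n^'n)"
    unfolding * by (metis less_le_trans)
qed

text \<open>Uniqueness of Haar measure for the image of Lebesgue measure under \<open>A\<close>: integrate
  \<open>g (A x) \<chi>(y - A x)\<close> over \<open>x\<close> and \<open>y\<close> in both orders, with \<open>\<chi>\<close> the indicator of the unit ball.\<close>

lemma nn_integral_linear_ball_integral: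
  fixes A :: "real^'n^'n"
  assumes "invertible A" and [measurable]: "g \<in> borel_measurable borel"
  shows "(\<integral>\<^sup>+x. g (A *v x) \<partial>lborel) * ball_integral (mat 1 :: real^'n^'n) = ball_integral A * (\<integral>\<^sup>+x. g x \<partial>lborel)"
proof -
  obtain B where B: "A ** B = mat 1"
    using assms(1) by (auto simp: invertible_def)
  let ?k = "indicator (cball 0 1) :: real^'n \<Rightarrow> ennreal"
  have [measurable]: "?k \<in> borel_measurable borel"
    by (rule borel_measurable_indicator) simp
  have AB: "A *v (B *v y) = y" for y
    by (simp add: matrix_vector_mul_assoc B)
  have "(\<integral>\<^sup>+x. g (A *v x) \<partial>lborel) * ball_integral (mat 1 :: real^'n^'n)
      = (\<integral>\<^sup>+x. g (A *v x) * (\<integral>\<^sup>+y. ?k y \<partial>lborel) \<partial>lborel)"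
    by (simp add: ball_integral_def nn_integral_multc)
  also have "\<dots> = (\<integral>\<^sup>+x. (\<integral>\<^sup>+y. g (A *v x) * ?k (- (A *v x) + y) \<partial>lborel) \<partial>lborel)"
  proof (rule nn_integral_cong)
    fix x
    have "(\<integral>\<^sup>+y. ?k (- (A *v x) + y) \<partial>lborel) = (\<integral>\<^sup>+y. ?k y \<partial>lborel)"
      by (rule nn_integral_lborel_shift) measurable
    then show "g (A *v x) * (\<integral>\<^sup>+y. ?k y \<partial>lborel) = (\<integral>\<^sup>+y. g (A *v x) * ?k (- (A *v x) + y) \<partial>lborel)"
      using measurable_compose[of "\<lambda>y. - (A *v x) + y" lborel borel ?k borel]
      by (subst nn_integral_cmult) simp_all
  qed
  also have "\<dots> = (\<integral>\<^sup>+y. (\<integral>\<^sup>+x. g (A *v x) * ?k (- (A *v x) + y) \<partial>lborel) \<partial>lborel)"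
    by (rule lborel_pair.Fubini') measurable
  \<comment> \<open>Translating x by B y, where A B = 1, turns the argument of g into A x + y and
    that of the indicator into - A x. The ball is symmetric, so the sign disappears and the two
    integrals separate.\<close>
  also have "\<dots> = (\<integral>\<^sup>+y. (\<integral>\<^sup>+x. g (A *v (B *v y + x)) * ?k (- (A *v (B *v y + x)) + y) \<partial>lborel) \<partial>lborel)"
    by (subst nn_integral_lborel_shift) simp_all
  also have "\<dots> = (\<integral>\<^sup>+y. (\<integral>\<^sup>+x. g (A *v x + y) * ?k (A *v x) \<partial>lborel) \<partial>lborel)"
    by (simp add: matrix_vector_right_distrib AB add.commute indicator_def)
  also have "\<dots> = (\<integral>\<^sup>+x. (\<integral>\<^sup>+y. g (A *v x + y) * ?k (A *v x) \<partial>lborel) \<partial>lborel)"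
    by (rule lborel_pair.Fubini') measurable
  also have "\<dots> = ball_integral A * (\<integral>\<^sup>+x. g x \<partial>lborel)"
    by (simp add: nn_integral_multc nn_integral_lborel_shift ball_integral_def nn_integral_cmult mult.commute)
  finally show ?thesis .
qed

section \<open>The Jacobian factor of a linear map\<close>

text \<open>This will turn out to be 1 / |det A| for invertible A, but it is defined by measures
  alone so that multiplicativity follows from integration. As \<open>enn2real\<close> sends infinity
  to 0, finiteness of the quotient must be proved before the number means anything.\<close>

definition linear_factor :: "real^'n^'n \<Rightarrow> real" where
  "linear_factor A = enn2real (ball_integral A / ball_integral (mat 1 :: real^'n^'n))"

text \<open>Apply the Haar identity to the inverse \<open>B\<close> and the indicator of the
  preimage of the ball under \<open>A\<close>: the product of the two ball integrals is the square
  of the volume of the unit ball, hence finite and nonzero, so neither factor can be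
  infinite.\<close>

lemma ball_integral_finite:
  fixes A :: "real^'n^'n"
  assumes "invertible A"
  shows "ball_integral A < \<infinity>"
proof -
  obtain B where B: "A ** B = mat 1" "B ** A = mat 1"
    using assms by (auto simp: invertible_def)
  then have "invertible B"
    by (auto simp: invertible_def)
  have "ball_integral (mat 1 :: real^'n^'n) * ball_integral (mat 1 :: real^'n^'n) = ball_integral B * ball_integral A"
    using nn_integral_linear_ball_integral[OF \<open>invertible B\<close>, of "\<lambda>x. indicator (cball 0 1) (A *v x)"] B
    by (simp add: ball_integral_def matrix_vector_mul_assoc)
  moreover have "ball_integral (mat 1 :: real^'n^'n) * ball_integral (mat 1 :: real^'n^'n) < \<infinity>"
    using ball_integral_one[where 'n='n] by (simp add: ennreal_mult_less_top)
  ultimately have "ball_integral B * ball_integral A < \<infinity>"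
    by simp
  moreover have "ball_integral B \<noteq> 0"
    using ball_integral_one(1)[where 'n='n] \<open>_ = ball_integral B * ball_integral A\<close> by auto
  ultimately show ?thesis
    by (auto simp: ennreal_mult_less_top)
qed

lemma nn_integral_linear_factor:
  fixes A :: "real^'n^'n"
  assumes "invertible A" and [measurable]: "g \<in> borel_measurable borel"
  shows "(\<integral>\<^sup>+x. g (A *v x) \<partial>lborel) = ennreal (linear_factor A) * (\<integral>\<^sup>+x. g x \<partial>lborel)"
proof -
  note V = ball_integral_one[where 'n='n]
  have fin: "ball_integral A / ball_integral (mat 1 :: real^'n^'n) < \<infinity>"
    using ball_integral_finite[OF assms(1)] V by (auto simp: ennreal_divide_eq_top_iff less_top[symmetric])
  have "(\<integral>\<^sup>+x. g (A *v x) \<partial>lborel)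
      = (\<integral>\<^sup>+x. g (A *v x) \<partial>lborel) * ball_integral (mat 1 :: real^'n^'n) / ball_integral (mat 1 :: real^'n^'n)"
    using V by (intro ennreal_mult_divide_eq[symmetric]) auto
  also have "\<dots> = ball_integral A / ball_integral (mat 1 :: real^'n^'n) * (\<integral>\<^sup>+x. g x \<partial>lborel)"
    unfolding nn_integral_linear_ball_integral[OF assms]
    by (metis ennreal_times_divide mult.commute)
  also have "ball_integral A / ball_integral (mat 1 :: real^'n^'n) = ennreal (linear_factor A)"
    using fin by (simp add: linear_factor_def)
  finally show ?thesis .
qed

lemma linear_factor_eqI:
  fixes A :: "real^'n^'n"
  assumes "0 \<le> c" "ball_integral A = ennreal c * ball_integral (mat 1 :: real^'n^'n)"
  shows "linear_factor A = c"
  using assms ball_integral_one[where 'n='n]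
  by (simp add: linear_factor_def ennreal_mult_divide_eq)

lemma linear_factor_nonneg: "0 \<le> linear_factor A"
  by (simp add: linear_factor_def)

lemma linear_factor_one: "linear_factor (mat 1 :: real^'n^'n) = 1"
  by (rule linear_factor_eqI) simp_all

lemma linear_factor_mult:
  fixes A B :: "real^'n^'n"
  assumes "invertible A" "invertible B"
  shows "linear_factor (A ** B) = linear_factor A * linear_factor B"
proof (rule linear_factor_eqI)
  have "ball_integral (A ** B) = ennreal (linear_factor B) * ball_integral A"
    using nn_integral_linear_factor[OF assms(2), of "\<lambda>x. indicator (cball 0 1) (A *v x)"]
    by (simp add: ball_integral_def matrix_vector_mul_assoc)
  also have "ball_integral A = ennreal (linear_factor A) * ball_integral (mat 1 :: real^'n^'n)"
    using nn_integral_linear_factor[OF assms(1), of "indicator (cball 0 1)"]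
    by (simp add: ball_integral_def borel_measurable_indicator)
  finally show "ball_integral (A ** B) = ennreal (linear_factor A * linear_factor B) * ball_integral (mat 1 :: real^'n^'n)"
    by (simp add: ennreal_mult linear_factor_nonneg mult_ac)
qed (simp add: linear_factor_nonneg)

lemma linear_factor_pos:
  fixes A :: "real^'n^'n"
  assumes "invertible A"
  shows "0 < linear_factor A"
proof -
  obtain B where "A ** B = mat 1" "B ** A = mat 1"
    using assms by (auto simp: invertible_def)
  then have "linear_factor A * linear_factor B = 1"
    using linear_factor_mult[OF assms, of B] by (auto simp: invertible_def linear_factor_one)
  then have "linear_factor A \<noteq> 0"
    by auto
  then show ?thesis
    using linear_factor_nonneg[of A] by simp
qed

text \<open>The only case in which the factor is computed directly, by scaling Lebesgue measure
  along the coordinate axes. It is an anchor for the reduction to elementary matrices.\<close>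

lemma linear_factor_diagonal:
  fixes A :: "real^'n^'n"
  assumes diag: "\<And>i j. i \<noteq> j \<Longrightarrow> A $ i $ j = 0" and "det A \<noteq> 0"
  shows "linear_factor A * \<bar>det A\<bar> = 1"
proof -
  \<comment> \<open>The diagonal entries as a function of basis vectors, the form in which
    \<open>lborel_affine_euclidean\<close> expects the scaling factors.\<close>
  define d where "d = (\<lambda>b :: real^'n. b \<bullet> (A *v b))"
  have d: "d (axis i 1) = A $ i $ i" for i
    by (simp add: d_def inner_axis' matrix_vector_mult_basis column_def)
  have det: "det A = (\<Prod>i\<in>UNIV. A $ i $ i)"
    by (rule det_diagonal[OF diag])
  have Basis: "Basis = (\<lambda>i. axis i (1::real)) ` (UNIV :: 'n set)"
    by (auto simp: Basis_vec_def)
  have inj: "inj (\<lambda>i::'n. axis i (1::real))"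
    by (simp add: inj_on_def axis_eq_axis)
  have T: "(\<Sum>b\<in>Basis. (d b * (x \<bullet> b)) *\<^sub>R b) = A *v x" for x
  proof -
    have "A $ i $ i * x $ i = (\<Sum>j\<in>UNIV. A $ i $ j * x $ j)" for i
      by (simp add: diag comm_monoid_add_class.sum.remove[where x = i])
    moreover have "(\<Sum>b\<in>Basis. (d b * (x \<bullet> b)) *\<^sub>R b) = (\<Sum>i\<in>UNIV. (A $ i $ i * x $ i) *\<^sub>R axis i 1)"
      by (simp add: Basis sum.reindex[OF inj] d inner_axis)
    moreover have "(\<Sum>j\<in>UNIV. (A $ j $ j * x $ j) *\<^sub>R axis j 1) $ i = A $ i $ i * x $ i" for i
      by (simp add: axis_def if_distrib cong: if_cong)
    ultimately show ?thesis
      by (simp add: vec_eq_iff matrix_vector_mult_def)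
  qed
  have nz: "d b \<noteq> 0" if "b \<in> Basis" for b
    using that assms(2) by (auto simp: Basis d det)
  have "ball_integral (mat 1 :: real^'n^'n)
      = (\<integral>\<^sup>+x. indicator (cball 0 1) x \<partial>density (distr lborel borel (\<lambda>x. 0 + (\<Sum>b\<in>Basis. (d b * (x \<bullet> b)) *\<^sub>R b)))
            (\<lambda>_. (\<Prod>b\<in>Basis. \<bar>d b\<bar>)))"
    unfolding ball_integral_def matrix_vector_mul_lid by (subst lborel_affine_euclidean[where c = d and t = 0, OF nz]) simp_all
  also have "\<dots> = ennreal \<bar>det A\<bar> * ball_integral A"
    unfolding add_0 T
    by (simp add: nn_integral_density nn_integral_distr nn_integral_cmult ball_integral_def
        Basis prod.reindex[OF inj] d det abs_prod borel_measurable_indicator del: nn_integral_indicator)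
  finally have *: "ball_integral (mat 1 :: real^'n^'n) = ennreal \<bar>det A\<bar> * ball_integral A" .
  have "linear_factor A = 1 / \<bar>det A\<bar>"
  proof (rule linear_factor_eqI)
    have "ball_integral A = ennreal (1 / \<bar>det A\<bar>) * (ennreal \<bar>det A\<bar> * ball_integral A)"
      using assms(2) by (simp flip: mult.assoc ennreal_mult)
    then show "ball_integral A = ennreal (1 / \<bar>det A\<bar>) * ball_integral (mat 1 :: real^'n^'n)"
      by (simp flip: *)
  qed simp
  then show ?thesis
    using assms(2) by simp
qed

text \<open>A transposition is an involution and a shear is conjugate to its own square by a diagonal
  matrix, so multiplicativity alone determines their factors.\<close>

theorem linear_factor_eq:
  fixes A :: "real^'n^'n"
  assumes "det A \<noteq> 0"
  shows "linear_factor A * \<bar>det A\<bar> = 1"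
  using assms
proof (induction A rule: induct_matrix_elementary_alt)
  case (1 A B)
  then have "det A \<noteq> 0" "det B \<noteq> 0"
    by (simp_all add: det_mul)
  then have "linear_factor (A ** B) * \<bar>det (A ** B)\<bar> = (linear_factor A * \<bar>det A\<bar>) * (linear_factor B * \<bar>det B\<bar>)"
    by (simp add: linear_factor_mult invertible_det_nz det_mul abs_mult)
  then show ?case
    using 1 \<open>det A \<noteq> 0\<close> \<open>det B \<noteq> 0\<close> by simp
next
  case (2 A i)
  then show ?case
    by (simp add: det_zero_row)
next
  case (3 A)
  then show ?case
    by (simp add: linear_factor_diagonal)
next
  case (4 m n)
  let ?S = "(\<chi> i j. mat 1 $ i $ Transposition.transpose m n j) :: real^'n^'n"
  have "(i = Transposition.transpose m n k) = (k = Transposition.transpose m n i)" for i k :: 'n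
    by (metis transpose_involutory)
  then have "(\<Sum>j\<in>UNIV. (if i = Transposition.transpose m n j then 1 else 0) * x $ j)
      = (\<Sum>j\<in>UNIV. if j = Transposition.transpose m n i then x $ j else 0)" for i and x :: "real^'n"
    by (intro sum.cong) auto
  then have "?S *v x = (\<chi> i. x $ Transposition.transpose m n i)" for x
    by (simp add: vec_eq_iff matrix_vector_mult_def mat_def)
  then have "?S ** ?S = mat 1"
    by (simp add: matrix_eq vec_eq_iff flip: matrix_vector_mul_assoc)
  moreover have "invertible ?S"
    using 4(2) by (simp add: invertible_det_nz)
  ultimately have "(linear_factor ?S)\<^sup>2 = 1" "(det ?S)\<^sup>2 = 1"
    using linear_factor_mult[of ?S ?S] det_mul[of ?S ?S] by (simp_all add: linear_factor_one power2_eq_square)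
  then show ?case
    using linear_factor_nonneg[of ?S] by (auto simp: power2_eq_1_iff)
next
  case (5 m n)
  define E :: "real^'n^'n" where "E = (\<chi> i j. of_bool (i = m \<and> j = n \<or> i = j))"
  define D :: "real \<Rightarrow> real^'n^'n"
    where "D c = (\<chi> i j. if i = j then if i = m then c else 1 else 0)" for c
  have Ex: "E *v x = (\<chi> i. if i = m then x $ m + x $ n else x $ i)" for x
  proof -
    have "(\<Sum>j\<in>UNIV. of_bool (i = m \<and> j = n \<or> i = j) * x $ j)
        = (\<Sum>j\<in>UNIV. (if j = i then x $ j else 0) + (if j = n then if i = m then x $ j else 0 else 0))" for i
      using 5(1) by (intro sum.cong) auto
    then show ?thesis
      by (simp add: vec_eq_iff E_def matrix_vector_mult_def sum.distrib del: of_bool_or_iff)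
  qed
  have Dx: "D c *v x = (\<chi> i. if i = m then c * x $ m else x $ i)" for c and x :: "real^'n"
    by (simp add: vec_eq_iff D_def matrix_vector_mult_def if_distrib[of "\<lambda>y. y * _"] cong: if_cong)
  have "D 2 ** D (1/2) = (mat 1 :: real^'n^'n)"
    by (simp add: matrix_eq Dx vec_eq_iff flip: matrix_vector_mul_assoc)
  have "D (1/2) ** D 2 = (mat 1 :: real^'n^'n)"
    by (simp add: matrix_eq Dx vec_eq_iff flip: matrix_vector_mul_assoc)
  have conj: "D 2 ** (E ** D (1/2)) = E ** E"
    using 5(1) by (simp add: matrix_eq Dx Ex vec_eq_iff flip: matrix_vector_mul_assoc)
  have inv: "invertible (D 2 :: real^'n^'n)" "invertible (D (1/2) :: real^'n^'n)"
    unfolding invertible_def using \<open>D 2 ** D (1/2) = mat 1\<close> \<open>D (1/2) ** D 2 = mat 1\<close> by blast+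
  have E_inv: "invertible E"
    using 5(2)[folded E_def] by (simp add: invertible_det_nz)
  have "linear_factor (D 2 :: real^'n^'n) * linear_factor (D (1/2) :: real^'n^'n) = 1"
    using linear_factor_mult[OF inv] \<open>D 2 ** D (1/2) = mat 1\<close> by (simp add: linear_factor_one)
  moreover have "linear_factor (D 2 :: real^'n^'n) * (linear_factor E * linear_factor (D (1/2) :: real^'n^'n)) = linear_factor E * linear_factor E"
    using arg_cong[OF conj, of linear_factor] inv E_inv by (simp add: linear_factor_mult invertible_mult)
  ultimately have E1: "linear_factor E = 1"
    using linear_factor_pos[OF E_inv] by (simp add: mult_ac)
  \<comment> \<open>The determinant is multiplicative as well, so the same conjugation gives
    \<open>det E = det E * det E\<close>, hence \<open>det E = 1\<close> without expanding
    it.\<close>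
  have "det (D 2 :: real^'n^'n) * det (D (1/2) :: real^'n^'n) = 1"
    using det_mul[of "D 2 :: real^'n^'n" "D (1/2)"] \<open>D 2 ** D (1/2) = mat 1\<close> by simp
  moreover have "det (D 2 :: real^'n^'n) * (det E * det (D (1/2) :: real^'n^'n)) = det E * det E"
    using arg_cong[OF conj, of det] by (simp add: det_mul)
  ultimately have "det E = 1"
    using 5(2)[folded E_def] by (metis mult.assoc mult_cancel_left2 mult.commute)
  with E1 show ?case
    unfolding E_def by simp
qed

corollary nn_integral_linear_substitution:
  fixes A :: "real^'n^'n"
  assumes "det A \<noteq> 0" and [measurable]: "g \<in> borel_measurable borel"
  shows "(\<integral>\<^sup>+x. g x \<partial>lborel) = ennreal \<bar>det A\<bar> * (\<integral>\<^sup>+x. g (A *v x) \<partial>lborel)"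
proof -
  have "ennreal \<bar>det A\<bar> * ennreal (linear_factor A) = 1"
    using linear_factor_eq[OF assms(1)] by (simp add: mult.commute linear_factor_nonneg flip: ennreal_mult)
  then show ?thesis
    using assms by (simp add: nn_integral_linear_factor invertible_det_nz flip: mult.assoc)
qed

section \<open>The Fourier transform of integrable functions\<close>

lemma borel_measurable_cnj [measurable (raw)]:
  "f \<in> borel_measurable M \<Longrightarrow> (\<lambda>x. cnj (f x)) \<in> borel_measurable M"
  by (rule measurable_compose[of f M borel]) (auto intro: borel_measurable_continuous_onI continuous_intros)

lemma integrable_pair_mult:
  fixes f :: "'a::euclidean_space \<Rightarrow> complex" and g :: "'b::euclidean_space \<Rightarrow> complex"
  assumes f: "integrable lborel f" and g: "integrable lborel g"
  shows "integrable (lborel \<Otimes>\<^sub>M lborel) (\<lambda>(x, y). f x * g y)"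
proof (rule lborel_pair.Fubini_integrable)
  have [measurable]: "f \<in> borel_measurable borel" "g \<in> borel_measurable borel"
    using f g by (simp_all add: borel_measurable_integrable flip: measurable_lborel2)
  show "(\<lambda>(x, y). f x * g y) \<in> borel_measurable (lborel \<Otimes>\<^sub>M lborel)"
    by measurable
  show "integrable lborel (\<lambda>x. \<integral>y. norm (case (x, y) of (x, y) \<Rightarrow> f x * g y) \<partial>lborel)"
    using f by (simp add: norm_mult)
  show "AE x in lborel. integrable lborel (\<lambda>y. case (x, y) of (x, y) \<Rightarrow> f x * g y)"
    using g by simp
qed

lemma fourier_integral_measurable [measurable]:
  assumes [measurable]: "g \<in> borel_measurable borel"
  shows "fourier_integral g \<in> borel_measurable borel"
proof -
  have "(\<lambda>(\<xi>, x). g x * exp (- \<i> * of_real (x \<bullet> \<xi>))) \<in> borel_measurable (borel \<Otimes>\<^sub>M lborel)"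
    by measurable
  then show ?thesis
    unfolding fourier_integral_def[abs_def]
    by (rule lborel.borel_measurable_lebesgue_integral)
qed

lemma norm_exp_minus_i [simp]: "cmod (exp (- (\<i> * of_real t))) = 1"
  by (simp add: norm_exp_eq_Re)

lemma integrable_fourier_integrand:
  assumes "integrable lborel g"
  shows "integrable lborel (\<lambda>x. g x * exp (- \<i> * of_real (x \<bullet> \<xi>)))"
proof (rule Bochner_Integration.integrable_bound[OF assms])
  have [measurable]: "g \<in> borel_measurable borel"
    using assms by (simp add: borel_measurable_integrable flip: measurable_lborel2)
  show "(\<lambda>x. g x * exp (- \<i> * of_real (x \<bullet> \<xi>))) \<in> borel_measurable lborel"
    by measurable
qed (simp add: norm_mult)

lemma norm_fourier_integral_le:
  assumes "integrable lborel g"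
  shows "cmod (fourier_integral g \<xi>) \<le> (\<integral>x. cmod (g x) \<partial>lborel)"
  unfolding fourier_integral_def
  by (rule order_trans[OF integral_norm_bound]) (simp add: norm_mult)

text \<open>The multiplication formula: the kernel exp (- i x y) is symmetric and of modulus 1, so
  Fubini applies to f(x) g(y) times the kernel.\<close>

lemma integral_fourier_integral_mult:
  fixes f g :: "real^'n \<Rightarrow> complex"
  assumes f: "integrable lborel f" and g: "integrable lborel g"
  shows "(\<integral>x. fourier_integral f x * g x \<partial>lborel) = (\<integral>x. f x * fourier_integral g x \<partial>lborel)"
proof -
  have [measurable]: "f \<in> borel_measurable borel" "g \<in> borel_measurable borel"
    using f g by (simp_all add: borel_measurable_integrable flip: measurable_lborel2)
  have int: "integrable (lborel \<Otimes>\<^sub>M lborel) (\<lambda>(x, y). f x * exp (- \<i> * of_real (x \<bullet> y)) * g y)"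
    by (rule Bochner_Integration.integrable_bound[OF integrable_pair_mult[OF f g]])
       (measurable, auto simp: norm_mult)
  have "(\<integral>x. fourier_integral f x * g x \<partial>lborel)
      = (\<integral>y. (\<integral>x. f x * exp (- \<i> * of_real (x \<bullet> y)) * g y \<partial>lborel) \<partial>lborel)"
    by (simp add: fourier_integral_def)
  also have "\<dots> = (\<integral>x. (\<integral>y. f x * exp (- \<i> * of_real (x \<bullet> y)) * g y \<partial>lborel) \<partial>lborel)"
    by (rule lborel_pair.Fubini_integral[OF int])
  also have "\<dots> = (\<integral>x. f x * fourier_integral g x \<partial>lborel)"
    unfolding fourier_integral_def
    by (simp add: inner_commute mult.commute mult.left_commute flip: integral_mult_right_zero)
  finally show ?thesis .
qed

section \<open>Gaussian functions and their Fourier transforms\<close>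

lemma integral_lborel_affine:
  fixes f :: "'a::euclidean_space \<Rightarrow> 'b::{banach, second_countable_topology}"
  assumes [measurable]: "f \<in> borel_measurable borel" and "c \<noteq> 0"
  shows "(\<integral>x. f x \<partial>lborel) = \<bar>c\<bar> ^ DIM('a) *\<^sub>R (\<integral>x. f (t + c *\<^sub>R x) \<partial>lborel)"
  by (subst lborel_affine[OF assms(2), of t])
     (simp add: integral_density integral_distr)

lemma integral_prod_Basis:
  fixes f :: "'a::euclidean_space \<Rightarrow> real \<Rightarrow> complex"
  assumes int: "\<And>b. integrable lborel (f b)"
  shows "(\<integral>x. (\<Prod>b\<in>Basis. f b (x \<bullet> b)) \<partial>(lborel :: 'a measure)) = (\<Prod>b\<in>Basis. \<integral>x. f b x \<partial>lborel)"
proof -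
  interpret product_sigma_finite "\<lambda>_::'a. lborel :: real measure" ..
  have [measurable]: "f b \<in> borel_measurable borel" for b
    using int by (simp add: borel_measurable_integrable flip: measurable_lborel2)
  have "(\<integral>x. (\<Prod>b\<in>Basis. f b (x \<bullet> b)) \<partial>(lborel :: 'a measure))
      = (\<integral>x. (\<Prod>b\<in>Basis. f b ((\<Sum>c\<in>Basis. x c *\<^sub>R c) \<bullet> b)) \<partial>(\<Pi>\<^sub>M b\<in>Basis. lborel))"
    by (subst lborel_eq) (simp add: integral_distr)
  also have "\<dots> = (\<integral>x. (\<Prod>b\<in>Basis. f b (x b)) \<partial>(\<Pi>\<^sub>M b\<in>Basis. lborel))"
    by (intro Bochner_Integration.integral_cong prod.cong refl) (simp add: inner_sum_left inner_Basis if_distrib cong: if_cong)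
  also have "\<dots> = (\<Prod>b\<in>Basis. \<integral>x. f b x \<partial>lborel)"
    by (rule product_integral_prod) (simp_all add: int)
  finally show ?thesis .
qed

text \<open>Kept polymorphic so that the Gaussian on \<open>real^'n\<close> factors into the same
  function of the real coordinates. With the exponent halved it reproduces itself under the
  transform up to the factor \<open>sqrt (2 * pi)\<close> per dimension.\<close>

definition gaussian :: "'a::euclidean_space \<Rightarrow> real" where
  "gaussian x = exp (- ((norm x)\<^sup>2 / 2))"

lemma gaussian_measurable [measurable]: "gaussian \<in> borel_measurable borel"
  unfolding gaussian_def[abs_def] by measurable

lemma gaussian_pos: "0 < gaussian x"
  by (simp add: gaussian_def)

lemma gaussian_prod: "gaussian x = (\<Prod>b\<in>Basis. gaussian (x \<bullet> b))"
  by (simp add: gaussian_def power2_norm_eq_inner euclidean_inner[of x x] exp_sum sum_divide_distrib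
      flip: sum_negf power2_eq_square)

lemma integrable_gaussian_real: "integrable lborel (gaussian :: real \<Rightarrow> real)"
proof -
  have "integrable lborel (\<lambda>x::real. sqrt (2 * pi) * std_normal_density x)"
    by (intro integrable_mult_right) simp
  then show ?thesis
    by (simp add: std_normal_density_def gaussian_def[abs_def])
qed

text \<open>Up to normalisation this is the characteristic function of the standard normal
  distribution at - t.\<close>

lemma integral_gaussian_real:
  "(\<integral>x. of_real (gaussian x) * exp (- \<i> * of_real (x * t)) \<partial>lborel) = of_real (sqrt (2 * pi) * gaussian t)"
proof -
  have "(\<integral>x. of_real (gaussian x) * exp (- \<i> * of_real (x * t)) \<partial>lborel)
      = (\<integral>x. sqrt (2 * pi) *\<^sub>R (std_normal_density x *\<^sub>R iexp (- t * x)) \<partial>lborel)"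
    by (intro Bochner_Integration.integral_cong refl)
       (simp add: std_normal_density_def gaussian_def scaleR_conv_of_real mult.commute)
  also have "\<dots> = sqrt (2 * pi) *\<^sub>R char std_normal_distribution (- t)"
    unfolding char_def by (simp add: integral_density normal_density_nonneg del: scaleR_scaleR)
  finally show ?thesis
    by (simp add: char_std_normal_distribution gaussian_def scaleR_conv_of_real)
qed

lemma gaussian_fourier_prod:
  fixes x \<xi> :: "real^'n"
  shows "of_real (gaussian x) * exp (- \<i> * of_real (x \<bullet> \<xi>))
    = (\<Prod>b\<in>Basis. of_real (gaussian (x \<bullet> b)) * exp (- \<i> * of_real ((x \<bullet> b) * (\<xi> \<bullet> b))))"
  by (simp add: gaussian_prod[of x] prod.distrib euclidean_inner[of x \<xi>] sum_distrib_left
      flip: exp_sum sum_negf)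

lemma integrable_gaussian_fourier_real:
  "integrable lborel (\<lambda>x::real. of_real (gaussian x) * exp (- \<i> * of_real (x * t)))"
  by (rule Bochner_Integration.integrable_bound[OF integrable_gaussian_real])
     (measurable, simp add: norm_mult)

lemma fourier_integral_gaussian:
  "fourier_integral (\<lambda>x. of_real (gaussian x)) \<xi> = of_real (sqrt (2 * pi) ^ CARD('n) * gaussian \<xi>)"
  for \<xi> :: "real^'n"
proof -
  have "fourier_integral (\<lambda>x. of_real (gaussian x)) \<xi>
      = (\<Prod>b\<in>Basis. of_real (sqrt (2 * pi) * gaussian (\<xi> \<bullet> b)))"
    unfolding fourier_integral_def gaussian_fourier_prod
    by (subst integral_prod_Basis[OF integrable_gaussian_fourier_real]) (simp only: integral_gaussian_real)
  also have "\<dots> = of_real (sqrt (2 * pi) ^ CARD('n) * gaussian \<xi>)"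
    by (simp add: prod.distrib gaussian_prod[of \<xi>] DIM_cart)
  finally show ?thesis .
qed

text \<open>A Bochner integral of a non-integrable function is 0 by convention, so the nonzero value
  of the transform at the origin already proves integrability.\<close>

lemma integrable_gaussian: "integrable lborel (gaussian :: real^'n \<Rightarrow> real)"
proof -
  have "(\<integral>x. of_real (gaussian x) \<partial>(lborel :: (real^'n) measure)) = complex_of_real (sqrt (2 * pi) ^ CARD('n))"
    using fourier_integral_gaussian[of "0 :: real^'n"] by (simp add: fourier_integral_def gaussian_def)
  then have "(\<integral>x. of_real (gaussian x) \<partial>(lborel :: (real^'n) measure)) \<noteq> (0 :: complex)"
    by simp
  then have "integrable lborel (\<lambda>x :: real^'n. complex_of_real (gaussian x))"
    using not_integrable_integral_eq by blast
  then show ?thesis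
    by (simp add: complex_of_real_integrable_eq)
qed

lemma integral_gaussian: "(\<integral>x. gaussian x \<partial>(lborel :: (real^'n) measure)) = sqrt (2 * pi) ^ CARD('n)"
proof -
  have "complex_of_real (\<integral>x. gaussian x \<partial>(lborel :: (real^'n) measure)) = of_real (sqrt (2 * pi) ^ CARD('n))"
    using fourier_integral_gaussian[of "0 :: real^'n"] by (simp add: fourier_integral_def gaussian_def)
  then show ?thesis
    by (simp only: of_real_eq_iff)
qed

lemma integrable_gaussian_scaled:
  assumes "\<epsilon> \<noteq> 0"
  shows "integrable lborel (\<lambda>x :: real^'n. gaussian (\<epsilon> *\<^sub>R x))"
proof -
  have "(\<integral>x. gaussian (\<epsilon> *\<^sub>R x) \<partial>(lborel :: (real^'n) measure)) \<noteq> 0"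
    using integral_lborel_affine[of "gaussian :: real^'n \<Rightarrow> real" \<epsilon> 0] assms integral_gaussian[where 'n='n]
    by auto
  then show ?thesis
    using not_integrable_integral_eq by blast
qed

text \<open>Taken at \<epsilon> z and with the Jacobian on the left, because this is the combination
  that a substitution of step \<epsilon> produces; the right-hand side no longer contains
  \<epsilon>.\<close>

lemma fourier_integral_gaussian_scaled:
  fixes z :: "real^'n"
  assumes "\<epsilon> \<noteq> 0"
  shows "\<bar>\<epsilon>\<bar> ^ CARD('n) *\<^sub>R fourier_integral (\<lambda>x. of_real (gaussian (\<epsilon> *\<^sub>R x))) (\<epsilon> *\<^sub>R z)
    = of_real (sqrt (2 * pi) ^ CARD('n) * gaussian z)"
proof -
  have "fourier_integral (\<lambda>x. of_real (gaussian x)) z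
      = \<bar>\<epsilon>\<bar> ^ CARD('n) *\<^sub>R fourier_integral (\<lambda>x. of_real (gaussian (\<epsilon> *\<^sub>R x))) (\<epsilon> *\<^sub>R z)"
    unfolding fourier_integral_def
    by (subst integral_lborel_affine[OF _ assms, of _ 0]) (simp_all add: DIM_cart)
  then show ?thesis
    by (simp add: fourier_integral_gaussian)
qed

lemma fourier_integral_cnj:
  "fourier_integral (\<lambda>x. cnj (g (- x))) \<xi> = cnj (fourier_integral g \<xi>)"
  if [measurable]: "g \<in> borel_measurable borel" for g :: "real^'n \<Rightarrow> complex"
proof -
  have "cnj (fourier_integral g \<xi>) = (\<integral>x. cnj (g x) * exp (\<i> * of_real (x \<bullet> \<xi>)) \<partial>lborel)"
    unfolding fourier_integral_def
    by (subst integral_bounded_linear'[OF bounded_linear_cnj bounded_linear_cnj, symmetric]) (simp_all add: exp_cnj)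
  also have "\<dots> = fourier_integral (\<lambda>x. cnj (g (- x))) \<xi>"
    unfolding fourier_integral_def
    by (subst integral_lborel_affine[of _ "-1" 0]) simp_all
  finally show ?thesis ..
qed

lemma integrable_uminus:
  assumes "integrable lborel (g :: real^'n \<Rightarrow> complex)"
  shows "integrable lborel (\<lambda>x. g (- x))"
proof -
  have [measurable]: "g \<in> borel_measurable borel"
    using assms by (simp add: borel_measurable_integrable flip: measurable_lborel2)
  have "(lborel :: (real^'n) measure) = density (distr lborel borel (\<lambda>x. 0 + (-1) *\<^sub>R x)) (\<lambda>_. ennreal (\<bar>- 1\<bar> ^ DIM(real^'n)))"
    using lborel_affine[of "- 1" "0 :: real^'n"] by simp
  then have *: "distr (lborel :: (real^'n) measure) borel uminus = lborel"
    by (simp add: density_1)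
  have "integrable (distr (lborel :: (real^'n) measure) borel uminus) g"
    unfolding * by (rule assms)
  then show ?thesis
    by (simp add: integrable_distr_eq)
qed

text \<open>Two applications of the multiplication formula turn the Gaussian regularisation of
  \<open>\<integral> \<bar>F g\<bar>\<^sup>2\<close> into an approximate identity acting on \<open>g\<close>.\<close>

lemma integral_gaussian_fourier_integral:
  fixes g :: "real^'n \<Rightarrow> complex"
  assumes g: "integrable lborel g" and "\<epsilon> > 0"
  shows "integrable lborel (\<lambda>\<xi>. gaussian (\<epsilon> *\<^sub>R \<xi>) * (cmod (fourier_integral g \<xi>))\<^sup>2)"
    and "of_real (\<integral>\<xi>. gaussian (\<epsilon> *\<^sub>R \<xi>) * (cmod (fourier_integral g \<xi>))\<^sup>2 \<partial>lborel)
      = of_real (sqrt (2 * pi) ^ CARD('n)) *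
        (\<integral>x. g x * (\<integral>z. cnj (g (x - \<epsilon> *\<^sub>R z)) * of_real (gaussian z) \<partial>lborel) \<partial>lborel)"
proof -
  let ?w = "\<lambda>\<xi> :: real^'n. gaussian (\<epsilon> *\<^sub>R \<xi>)"
  let ?F = "fourier_integral g"
  define C where "C = (\<integral>x. cmod (g x) \<partial>lborel)"
  have F_le: "cmod (?F \<xi>) \<le> C" for \<xi>
    unfolding C_def by (rule norm_fourier_integral_le[OF g])
  have C: "0 \<le> C"
    by (simp add: C_def)
  have [measurable]: "g \<in> borel_measurable borel"
    using g by (simp add: borel_measurable_integrable flip: measurable_lborel2)
  have w: "integrable lborel ?w"
    using assms(2) by (intro integrable_gaussian_scaled) simp
  show "integrable lborel (\<lambda>\<xi>. ?w \<xi> * (cmod (?F \<xi>))\<^sup>2)"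
  proof (rule Bochner_Integration.integrable_bound[OF integrable_mult_left[OF w, of "C\<^sup>2"]])
    show "AE \<xi> in lborel. norm (?w \<xi> * (cmod (?F \<xi>))\<^sup>2) \<le> norm (?w \<xi> * C\<^sup>2)"
      using F_le C by (auto simp: abs_mult intro!: mult_left_mono power_mono)
  qed measurable
  define k where "k \<xi> = of_real (?w \<xi>) * cnj (?F \<xi>)" for \<xi>
  have k: "integrable lborel k"
  proof (rule Bochner_Integration.integrable_bound[OF integrable_mult_left[OF w, of C]])
    show "AE \<xi> in lborel. norm (k \<xi>) \<le> norm (?w \<xi> * C)"
      using F_le C by (auto simp: k_def norm_mult abs_mult intro!: mult_left_mono)
  qed (unfold k_def[abs_def], measurable)
  have k_hat: "fourier_integral k x
      = of_real (sqrt (2 * pi) ^ CARD('n)) * (\<integral>z. cnj (g (x - \<epsilon> *\<^sub>R z)) * of_real (gaussian z) \<partial>lborel)" for x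
  proof -
    \<comment> \<open>The conjugate of the transform of g is the transform of the reflected
      conjugate \<open>?g'\<close>. The multiplication formula can thus move the transform onto the
      modulated weight \<open>?wx\<close>, where it becomes a translate of
      \<open>?W\<close>.\<close>
    let ?g' = "\<lambda>y. cnj (g (- y))"
    let ?wx = "\<lambda>\<xi>. of_real (?w \<xi>) * exp (- \<i> * of_real (x \<bullet> \<xi>))"
    let ?W = "fourier_integral (\<lambda>\<xi>. of_real (?w \<xi>))"
    have g': "integrable lborel ?g'"
      using integrable_uminus[OF g] by simp
    have wx: "integrable lborel ?wx"
      by (rule Bochner_Integration.integrable_bound[OF w]) (measurable, simp add: norm_mult)
    have "fourier_integral k x = (\<integral>\<xi>. fourier_integral ?g' \<xi> * ?wx \<xi> \<partial>lborel)"
      unfolding fourier_integral_def[of k] k_def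
      by (simp add: fourier_integral_cnj inner_commute mult_ac)
    also have "\<dots> = (\<integral>y. ?g' y * fourier_integral ?wx y \<partial>lborel)"
      by (rule integral_fourier_integral_mult[OF g' wx])
    also have "\<dots> = (\<integral>y. ?g' y * ?W (x + y) \<partial>lborel)"
    proof -
      have "fourier_integral ?wx y = ?W (x + y)" for y
        unfolding fourier_integral_def
        by (simp add: inner_add_right inner_commute ring_distribs exp_diff exp_minus divide_inverse mult_ac)
      then show ?thesis
        by simp
    qed
    \<comment> \<open>Substituting y = - x + \<epsilon> z centres the kernel at the origin and turns
      \<open>?g' y\<close> into the conjugate of g at x - \<epsilon> z.\<close>
    also have "(\<integral>y. ?g' y * ?W (x + y) \<partial>lborel)
        = \<epsilon> ^ CARD('n) *\<^sub>R (\<integral>z. ?g' (- x + \<epsilon> *\<^sub>R z) * ?W (x + (- x + \<epsilon> *\<^sub>R z)) \<partial>lborel)"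
      using assms(2) by (subst integral_lborel_affine[of _ \<epsilon> "- x"]) (simp_all add: DIM_cart)
    also have "\<dots> = (\<integral>z. cnj (g (x - \<epsilon> *\<^sub>R z)) * (\<epsilon> ^ CARD('n) *\<^sub>R ?W (\<epsilon> *\<^sub>R z)) \<partial>lborel)"
      by (simp flip: integral_scaleR_right)
    also have "\<dots> = (\<integral>z. of_real (sqrt (2 * pi) ^ CARD('n)) * (cnj (g (x - \<epsilon> *\<^sub>R z)) * of_real (gaussian z)) \<partial>lborel)"
    proof -
      have "\<epsilon> ^ CARD('n) *\<^sub>R ?W (\<epsilon> *\<^sub>R z) = of_real (sqrt (2 * pi) ^ CARD('n) * gaussian z)" for z
        using fourier_integral_gaussian_scaled[of \<epsilon> z] assms(2) by simp
      then show ?thesis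
        by (simp only: of_real_mult mult_ac)
    qed
    finally show ?thesis
      by simp
  qed
  have "of_real (\<integral>\<xi>. ?w \<xi> * (cmod (?F \<xi>))\<^sup>2 \<partial>lborel) = (\<integral>\<xi>. ?F \<xi> * k \<xi> \<partial>lborel)"
  proof -
    have "?F \<xi> * k \<xi> = of_real (?w \<xi> * (cmod (?F \<xi>))\<^sup>2)" for \<xi>
      by (simp only: k_def of_real_mult complex_norm_square mult_ac)
    then show ?thesis
      by (simp only: integral_complex_of_real)
  qed
  also have "\<dots> = (\<integral>x. g x * fourier_integral k x \<partial>lborel)"
    by (rule integral_fourier_integral_mult[OF g k])
  also have "\<dots> = of_real (sqrt (2 * pi) ^ CARD('n)) *
        (\<integral>x. g x * (\<integral>z. cnj (g (x - \<epsilon> *\<^sub>R z)) * of_real (gaussian z) \<partial>lborel) \<partial>lborel)"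
    unfolding k_hat
    by (simp only: mult.left_commute[of _ "of_real (sqrt (2 * pi) ^ CARD('n))"] integral_mult_right_zero)
  finally show "of_real (\<integral>\<xi>. ?w \<xi> * (cmod (?F \<xi>))\<^sup>2 \<partial>lborel)
      = of_real (sqrt (2 * pi) ^ CARD('n)) *
        (\<integral>x. g x * (\<integral>z. cnj (g (x - \<epsilon> *\<^sub>R z)) * of_real (gaussian z) \<partial>lborel) \<partial>lborel)" .
qed

section \<open>The space of square integrable functions\<close>

text \<open>The extended value is meaningful before square integrability is known, which is what
  Fatou and monotone convergence need; \<open>L2_norm\<close> would report 0 for a divergent
  integral.\<close>

definition L2_sq :: "(real^'n \<Rightarrow> complex) \<Rightarrow> ennreal" where
  "L2_sq f = (\<integral>\<^sup>+x. ennreal ((cmod (f x))\<^sup>2) \<partial>lborel)"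

lemma L2_space_iff: "f \<in> L2_space \<longleftrightarrow> f \<in> borel_measurable borel \<and> L2_sq f < \<infinity>"
  unfolding L2_space_def L2_sq_def integrable_iff_bounded by auto

lemma L2_space_measurable [measurable_dest]: "f \<in> L2_space \<Longrightarrow> f \<in> borel_measurable borel"
  by (simp add: L2_space_iff)

lemma L2_space_integrable: "f \<in> L2_space \<Longrightarrow> integrable lborel (\<lambda>x. (cmod (f x))\<^sup>2)"
  by (simp add: L2_space_def)

lemma L2_norm_nonneg: "0 \<le> L2_norm f"
  by (simp add: L2_norm_def)

lemma L2_norm_power2: "(L2_norm f)\<^sup>2 = (\<integral>x. (cmod (f x))\<^sup>2 \<partial>lborel)"
  by (simp add: L2_norm_def)

lemma L2_sq_eq: "f \<in> L2_space \<Longrightarrow> L2_sq f = ennreal ((L2_norm f)\<^sup>2)"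
  unfolding L2_sq_def L2_norm_power2
  by (rule nn_integral_eq_integral) (simp_all add: L2_space_integrable)

lemma L2_space_bound:
  assumes [measurable]: "f \<in> borel_measurable borel" and "g \<in> L2_space" "AE x in lborel. cmod (f x) \<le> C * cmod (g x)"
  shows "f \<in> L2_space"
  unfolding L2_space_def
proof safe
  show "integrable lborel (\<lambda>x. (cmod (f x))\<^sup>2)"
  proof (rule Bochner_Integration.integrable_bound[OF integrable_mult_right[OF L2_space_integrable[OF assms(2)], of "C\<^sup>2"]])
    show "AE x in lborel. norm ((cmod (f x))\<^sup>2) \<le> norm (C\<^sup>2 * (cmod (g x))\<^sup>2)"
      using assms(3)
    proof eventually_elim
      case (elim x)
      then show ?case
        using power_mono[OF elim norm_ge_zero, of 2] by (simp add: power_mult_distrib)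
    qed
  qed measurable
qed simp

lemma cmod_add_power2_le: "(cmod (a + b))\<^sup>2 \<le> 2 * (cmod a)\<^sup>2 + 2 * (cmod b)\<^sup>2"
proof -
  have "(cmod (a + b))\<^sup>2 \<le> (cmod a + cmod b)\<^sup>2"
    by (intro power_mono norm_triangle_ineq) simp
  also have "\<dots> \<le> 2 * (cmod a)\<^sup>2 + 2 * (cmod b)\<^sup>2"
    using sum_squares_bound[of "cmod a" "cmod b"] by (simp add: power2_sum)
  finally show ?thesis .
qed

lemma L2_space_add:
  assumes f: "f \<in> L2_space" and g: "g \<in> L2_space"
  shows "(\<lambda>x. f x + g x) \<in> L2_space"
  unfolding L2_space_def
proof safe
  have [measurable]: "f \<in> borel_measurable borel" "g \<in> borel_measurable borel"
    using f g by (simp_all add: L2_space_measurable)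
  show "(\<lambda>x. f x + g x) \<in> borel_measurable lborel"
    by measurable
  have "integrable lborel (\<lambda>x. 2 * (cmod (f x))\<^sup>2 + 2 * (cmod (g x))\<^sup>2)"
    using f g by (intro Bochner_Integration.integrable_add integrable_mult_right L2_space_integrable)
  then show "integrable lborel (\<lambda>x. (cmod (f x + g x))\<^sup>2)"
    by (rule Bochner_Integration.integrable_bound) (auto intro!: order_trans[OF cmod_add_power2_le])
qed

lemma L2_space_cmult: "f \<in> L2_space \<Longrightarrow> (\<lambda>x. c * f x) \<in> L2_space"
  by (rule L2_space_bound[of _ f "cmod c"]) (auto simp: norm_mult L2_space_measurable)

lemma L2_space_cnj: "f \<in> L2_space \<Longrightarrow> (\<lambda>x. cnj (f x)) \<in> L2_space"
  by (rule L2_space_bound[of _ f 1]) (auto simp: L2_space_measurable)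

lemma L2_space_diff: "f \<in> L2_space \<Longrightarrow> g \<in> L2_space \<Longrightarrow> (\<lambda>x. f x - g x) \<in> L2_space"
  using L2_space_add[of f "\<lambda>x. - 1 * g x"] L2_space_cmult[of g "- 1"] by simp

lemma L2_norm_cnj: "L2_norm (\<lambda>x. cnj (f x)) = L2_norm f"
  by (simp add: L2_norm_def)

lemma L2_norm_cmult: "L2_norm (\<lambda>x. c * f x) = cmod c * L2_norm f"
  by (simp add: L2_norm_def norm_mult power_mult_distrib real_sqrt_mult)

lemma L2_norm_diff_commute: "L2_norm (\<lambda>x. f x - g x) = L2_norm (\<lambda>x. g x - f x)"
  by (simp add: L2_norm_def norm_minus_commute)

lemma L2_norm_cong_AE:
  assumes "AE x in lborel. f x = g x"
    and [measurable]: "f \<in> borel_measurable borel" "g \<in> borel_measurable borel"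
  shows "L2_norm f = L2_norm g"
  unfolding L2_norm_def
  by (intro arg_cong[of _ _ sqrt] integral_cong_AE) (use assms(1) in auto)

lemma L2_norm_eq_0_iff:
  assumes "f \<in> L2_space"
  shows "L2_norm f = 0 \<longleftrightarrow> (AE x in lborel. f x = 0)"
  unfolding L2_norm_def
  by (simp add: integral_nonneg_eq_0_iff_AE[OF L2_space_integrable[OF assms]])

text \<open>Cauchy-Schwarz is used for extended integrals, so that integrability of the product is
  an outcome of the estimate and not a precondition.\<close>

lemma L2_mult:
  assumes f: "f \<in> L2_space" and g: "g \<in> L2_space"
  shows integrable_L2_mult: "integrable lborel (\<lambda>x. f x * g x)"
    and L2_mult_bound: "(\<integral>x. cmod (f x) * cmod (g x) \<partial>lborel) \<le> L2_norm f * L2_norm g"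
proof -
  have [measurable]: "f \<in> borel_measurable borel" "g \<in> borel_measurable borel"
    using f g by (simp_all add: L2_space_measurable)
  have "(\<integral>\<^sup>+x. ennreal (cmod (f x) * cmod (g x)) \<partial>lborel)\<^sup>2 \<le> L2_sq f * L2_sq g"
    using Cauchy_Schwarz_nn_integral[of "\<lambda>x. ennreal (cmod (f x))" lborel "\<lambda>x. ennreal (cmod (g x))"]
    by (simp add: L2_sq_def ennreal_mult ennreal_power)
  also have "\<dots> = ennreal ((L2_norm f * L2_norm g)\<^sup>2)"
    using f g by (simp add: L2_sq_eq ennreal_mult power_mult_distrib)
  also have "\<dots> = (ennreal (L2_norm f * L2_norm g))\<^sup>2"
    by (simp add: ennreal_power L2_norm_nonneg)
  finally have le: "(\<integral>\<^sup>+x. ennreal (cmod (f x) * cmod (g x)) \<partial>lborel) \<le> ennreal (L2_norm f * L2_norm g)"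
    by (cases "\<integral>\<^sup>+x. ennreal (cmod (f x) * cmod (g x)) \<partial>lborel" rule: ennreal_cases)
       (simp_all add: ennreal_power L2_norm_nonneg top_unique power_mono_iff)
  then have "(\<integral>\<^sup>+x. ennreal (cmod (f x) * cmod (g x)) \<partial>lborel) < \<infinity>"
    by (rule order_le_less_trans) simp
  then have int: "integrable lborel (\<lambda>x. cmod (f x) * cmod (g x))"
    by (intro integrableI_bounded) simp_all
  then show "integrable lborel (\<lambda>x. f x * g x)"
    by (rule Bochner_Integration.integrable_bound) (simp_all add: norm_mult)
  have "ennreal (\<integral>x. cmod (f x) * cmod (g x) \<partial>lborel) = (\<integral>\<^sup>+x. ennreal (cmod (f x) * cmod (g x)) \<partial>lborel)"
    by (rule nn_integral_eq_integral[OF int, symmetric]) simp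
  with le show "(\<integral>x. cmod (f x) * cmod (g x) \<partial>lborel) \<le> L2_norm f * L2_norm g"
    by (metis ennreal_le_iff L2_norm_nonneg mult_nonneg_nonneg)
qed

lemma norm_integral_L2_mult_le:
  assumes "f \<in> L2_space" "g \<in> L2_space"
  shows "cmod (\<integral>x. f x * g x \<partial>lborel) \<le> L2_norm f * L2_norm g"
  by (rule order_trans[OF integral_norm_bound]) (simp add: norm_mult L2_mult_bound[OF assms])

lemma L2_norm_triangle:
  assumes f: "f \<in> L2_space" and g: "g \<in> L2_space"
  shows "L2_norm (\<lambda>x. f x + g x) \<le> L2_norm f + L2_norm g"
proof -
  have int: "integrable lborel (\<lambda>x. (cmod (f x))\<^sup>2)" "integrable lborel (\<lambda>x. (cmod (g x))\<^sup>2)"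
      "integrable lborel (\<lambda>x. cmod (f x) * cmod (g x))" "integrable lborel (\<lambda>x. (cmod (f x + g x))\<^sup>2)"
    using L2_space_integrable f g L2_space_add[OF f g] integrable_norm[OF integrable_L2_mult[OF f g]]
    by (auto simp: norm_mult)
  have "(L2_norm (\<lambda>x. f x + g x))\<^sup>2
      \<le> (\<integral>x. (cmod (f x))\<^sup>2 + 2 * (cmod (f x) * cmod (g x)) + (cmod (g x))\<^sup>2 \<partial>lborel)"
    unfolding L2_norm_power2
  proof (intro integral_mono Bochner_Integration.integrable_add integrable_mult_right int)
    fix x
    have "(cmod (f x + g x))\<^sup>2 \<le> (cmod (f x) + cmod (g x))\<^sup>2"
      by (intro power_mono norm_triangle_ineq) simp
    then show "(cmod (f x + g x))\<^sup>2 \<le> (cmod (f x))\<^sup>2 + 2 * (cmod (f x) * cmod (g x)) + (cmod (g x))\<^sup>2"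
      by (simp add: power2_sum mult_ac add_ac)
  qed
  also have "\<dots> = (L2_norm f)\<^sup>2 + 2 * (\<integral>x. cmod (f x) * cmod (g x) \<partial>lborel) + (L2_norm g)\<^sup>2"
    by (simp add: L2_norm_power2 int)
  also have "\<dots> \<le> (L2_norm f + L2_norm g)\<^sup>2"
    using L2_mult_bound[OF f g] by (simp add: power2_sum)
  finally show ?thesis
    by (rule power2_le_imp_le) (simp add: L2_norm_nonneg)
qed

lemma L2_norm_triangle_diff:
  assumes f: "f \<in> L2_space" and g: "g \<in> L2_space" and h: "h \<in> L2_space"
  shows "L2_norm (\<lambda>x. f x - h x) \<le> L2_norm (\<lambda>x. f x - g x) + L2_norm (\<lambda>x. g x - h x)"
  using L2_norm_triangle[OF L2_space_diff[OF f g] L2_space_diff[OF g h]] by simp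

lemma L2_norm_tendsto:
  assumes f: "\<And>n. f n \<in> L2_space" "f' \<in> L2_space" and lim: "(\<lambda>n. L2_norm (\<lambda>x. f n x - f' x)) \<longlonglongrightarrow> 0"
  shows "(\<lambda>n. L2_norm (f n)) \<longlonglongrightarrow> L2_norm f'"
proof (rule LIM_zero_cancel, rule Lim_null_comparison[OF _ lim])
  have *: "L2_norm (f n) \<le> L2_norm (\<lambda>x. f n x - f' x) + L2_norm f'" for n
    using L2_norm_triangle[OF L2_space_diff[OF f(1) f(2)] f(2), of n] by simp
  have **: "L2_norm f' \<le> L2_norm (\<lambda>x. f n x - f' x) + L2_norm (f n)" for n
    using L2_norm_triangle[OF L2_space_diff[OF f(2) f(1)] f(1), of n n]
    by (simp add: L2_norm_diff_commute[of f'])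
  show "\<forall>\<^sub>F n in sequentially. norm (L2_norm (f n) - L2_norm f') \<le> L2_norm (\<lambda>x. f n x - f' x)"
  proof (intro always_eventually allI)
    show "norm (L2_norm (f n) - L2_norm f') \<le> L2_norm (\<lambda>x. f n x - f' x)" for n
      using *[of n] **[of n] by simp
  qed
qed

lemma L2_mult_tendsto:
  assumes f: "\<And>n. f n \<in> L2_space" "f' \<in> L2_space" and f_lim: "(\<lambda>n. L2_norm (\<lambda>x. f n x - f' x)) \<longlonglongrightarrow> 0"
    and g: "\<And>n. g n \<in> L2_space" "g' \<in> L2_space" and g_lim: "(\<lambda>n. L2_norm (\<lambda>x. g n x - g' x)) \<longlonglongrightarrow> 0"
  shows "(\<lambda>n. \<integral>x. f n x * g n x \<partial>lborel) \<longlonglongrightarrow> (\<integral>x. f' x * g' x \<partial>lborel)"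
proof (rule LIM_zero_cancel, rule Lim_null_comparison)
  have "(\<integral>x. f n x * g n x \<partial>lborel) - (\<integral>x. f' x * g' x \<partial>lborel)
      = (\<integral>x. (f n x - f' x) * g n x \<partial>lborel) + (\<integral>x. f' x * (g n x - g' x) \<partial>lborel)" for n
    by (simp add: left_diff_distrib right_diff_distrib integrable_L2_mult f g)
  moreover have "cmod (\<integral>x. (f n x - f' x) * g n x \<partial>lborel) \<le> L2_norm (\<lambda>x. f n x - f' x) * L2_norm (g n)" for n
    by (rule norm_integral_L2_mult_le[OF L2_space_diff[OF f] g(1)])
  moreover have "cmod (\<integral>x. f' x * (g n x - g' x) \<partial>lborel) \<le> L2_norm f' * L2_norm (\<lambda>x. g n x - g' x)" for n
    by (rule norm_integral_L2_mult_le[OF f(2) L2_space_diff[OF g]])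
  ultimately show "\<forall>\<^sub>F n in sequentially. norm ((\<integral>x. f n x * g n x \<partial>lborel) - (\<integral>x. f' x * g' x \<partial>lborel))
      \<le> L2_norm (\<lambda>x. f n x - f' x) * L2_norm (g n) + L2_norm f' * L2_norm (\<lambda>x. g n x - g' x)"
    by (intro always_eventually allI) (simp add: norm_triangle_mono)
  have "(\<lambda>n. L2_norm (\<lambda>x. f n x - f' x) * L2_norm (g n) + L2_norm f' * L2_norm (\<lambda>x. g n x - g' x))
      \<longlonglongrightarrow> 0 * L2_norm g' + L2_norm f' * 0"
    by (intro tendsto_intros f_lim g_lim L2_norm_tendsto g)
  then show "(\<lambda>n. L2_norm (\<lambda>x. f n x - f' x) * L2_norm (g n) + L2_norm f' * L2_norm (\<lambda>x. g n x - g' x)) \<longlonglongrightarrow> 0"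
    by simp
qed

lemma L2_norm_le_iff: "f \<in> L2_space \<Longrightarrow> 0 \<le> c \<Longrightarrow> L2_norm f \<le> c \<longleftrightarrow> L2_sq f \<le> ennreal (c\<^sup>2)"
  by (simp add: L2_sq_eq L2_norm_nonneg power_mono_iff)

lemma L2_sq_tendsto_0_iff:
  assumes "\<And>n. f n \<in> L2_space"
  shows "(\<lambda>n. L2_sq (f n)) \<longlonglongrightarrow> 0 \<longleftrightarrow> (\<lambda>n. L2_norm (f n)) \<longlonglongrightarrow> 0"
proof -
  have "(\<lambda>n. L2_sq (f n)) \<longlonglongrightarrow> 0 \<longleftrightarrow> (\<lambda>n. ennreal ((L2_norm (f n))\<^sup>2)) \<longlonglongrightarrow> ennreal 0"
    by (simp add: L2_sq_eq assms)
  also have "\<dots> \<longleftrightarrow> (\<lambda>n. (L2_norm (f n))\<^sup>2) \<longlonglongrightarrow> 0"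
    by (rule tendsto_ennreal_iff) simp_all
  also have "\<dots> \<longleftrightarrow> (\<lambda>n. L2_norm (f n)) \<longlonglongrightarrow> 0"
    using tendsto_real_sqrt[of "\<lambda>n. (L2_norm (f n))\<^sup>2" 0 sequentially] tendsto_power[of "\<lambda>n. L2_norm (f n)" 0 sequentially 2]
    by (auto simp: L2_norm_nonneg)
  finally show ?thesis .
qed

section \<open>Limit theorems and completeness\<close>

lemma L2_sq_Fatou:
  assumes "\<And>n. f n \<in> borel_measurable borel" "f' \<in> borel_measurable borel"
    and "AE x in lborel. (\<lambda>n. f n x) \<longlonglongrightarrow> f' x"
  shows "L2_sq f' \<le> liminf (\<lambda>n. L2_sq (f n))"
proof -
  have [measurable]: "f n \<in> borel_measurable borel" for n
    by fact
  have "L2_sq f' \<le> (\<integral>\<^sup>+x. liminf (\<lambda>n. ennreal ((cmod (f n x))\<^sup>2)) \<partial>lborel)"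
    unfolding L2_sq_def
  proof (rule nn_integral_mono_AE)
    show "AE x in lborel. ennreal ((cmod (f' x))\<^sup>2) \<le> liminf (\<lambda>n. ennreal ((cmod (f n x))\<^sup>2))"
      using assms(3)
    proof eventually_elim
      case (elim x)
      then have "(\<lambda>n. ennreal ((cmod (f n x))\<^sup>2)) \<longlonglongrightarrow> ennreal ((cmod (f' x))\<^sup>2)"
        by (intro tendsto_intros)
      then have "liminf (\<lambda>n. ennreal ((cmod (f n x))\<^sup>2)) = ennreal ((cmod (f' x))\<^sup>2)"
        by (rule lim_imp_Liminf[OF sequentially_bot])
      then show ?case
        by simp
    qed
  qed
  also have "\<dots> \<le> liminf (\<lambda>n. L2_sq (f n))"
    unfolding L2_sq_def by (rule nn_integral_liminf) measurable
  finally show ?thesis .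
qed

lemma L2_dominated_convergence:
  assumes f: "\<And>n. f n \<in> borel_measurable borel" "f' \<in> borel_measurable borel"
    and lim: "AE x in lborel. (\<lambda>n. f n x) \<longlonglongrightarrow> f' x"
    and bound: "\<And>n. AE x in lborel. cmod (f n x) \<le> cmod (w x)" and w: "w \<in> L2_space"
  shows "f n \<in> L2_space" "f' \<in> L2_space" "(\<lambda>n. L2_norm (\<lambda>x. f n x - f' x)) \<longlonglongrightarrow> 0"
proof -
  have [measurable]: "f n \<in> borel_measurable borel" "f' \<in> borel_measurable borel" "w \<in> borel_measurable borel" for n
    using f w by (simp_all add: L2_space_measurable)
  show fn: "f n \<in> L2_space" for n
    by (rule L2_space_bound[of _ w 1]) (use bound w in auto)
  have "AE x in lborel. \<forall>n. cmod (f n x) \<le> cmod (w x)"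
    using bound by (simp add: AE_all_countable)
  with lim have bound': "AE x in lborel. cmod (f' x) \<le> cmod (w x)"
  proof eventually_elim
    case (elim x)
    then show ?case
      by (intro tendsto_upperbound[OF tendsto_norm[OF elim(1)]]) auto
  qed
  show f': "f' \<in> L2_space"
    by (rule L2_space_bound[of _ w 1]) (use bound' w in auto)
  have "(\<lambda>n. L2_sq (\<lambda>x. f n x - f' x)) \<longlonglongrightarrow> (\<integral>\<^sup>+x. 0 \<partial>(lborel :: (real^'a) measure))"
    unfolding L2_sq_def
  \<comment> \<open>The 4 is 2 + 2: the squared modulus of a difference is at most twice the sum of
    the squared moduli, and each of those is at most that of w.\<close>
  proof (rule nn_integral_dominated_convergence[where w = "\<lambda>x. ennreal (4 * (cmod (w x))\<^sup>2)"])
    show "AE x in lborel. ennreal ((cmod (f n x - f' x))\<^sup>2) \<le> ennreal (4 * (cmod (w x))\<^sup>2)" for n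
      using bound[of n] bound'
    proof eventually_elim
      case (elim x)
      then have "(cmod (f n x))\<^sup>2 \<le> (cmod (w x))\<^sup>2" "(cmod (f' x))\<^sup>2 \<le> (cmod (w x))\<^sup>2"
        by (auto intro: power_mono)
      then show ?case
        using cmod_add_power2_le[of "f n x" "- f' x"]
        by (intro ennreal_leI) (simp only: norm_minus_cancel add_uminus_conv_diff)
    qed
    show "(\<integral>\<^sup>+x. ennreal (4 * (cmod (w x))\<^sup>2) \<partial>lborel) < \<infinity>"
      using w by (simp add: ennreal_mult nn_integral_cmult L2_space_iff L2_sq_def ennreal_mult_less_top)
    show "AE x in lborel. (\<lambda>n. ennreal ((cmod (f n x - f' x))\<^sup>2)) \<longlonglongrightarrow> 0"
      using lim
    proof eventually_elim
      case (elim x)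
      then have "(\<lambda>n. ennreal ((cmod (f n x - f' x))\<^sup>2)) \<longlonglongrightarrow> ennreal ((cmod (f' x - f' x))\<^sup>2)"
        by (intro tendsto_intros)
      then show ?case
        by simp
    qed
  qed measurable
  then show "(\<lambda>n. L2_norm (\<lambda>x. f n x - f' x)) \<longlonglongrightarrow> 0"
    by (simp add: L2_sq_tendsto_0_iff[symmetric] L2_space_diff fn f')
qed

text \<open>Riesz-Fischer: a rapidly Cauchy subsequence converges almost everywhere, and Fatou shows
  that its pointwise limit is the L2 limit of the whole sequence.\<close>

theorem L2_complete:
  fixes f :: "nat \<Rightarrow> real^'n \<Rightarrow> complex"
  assumes f: "\<And>n. f n \<in> L2_space"
    and Cauchy: "\<And>e. e > 0 \<Longrightarrow> \<exists>N. \<forall>m\<ge>N. \<forall>n\<ge>N. L2_norm (\<lambda>x. f m x - f n x) < e"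
  obtains f' where "f' \<in> L2_space" "(\<lambda>n. L2_norm (\<lambda>x. f n x - f' x)) \<longlonglongrightarrow> 0"
proof -
  have [measurable]: "f n \<in> borel_measurable borel" for n
    using f by (simp add: L2_space_measurable)
  have "\<exists>N. \<forall>k. \<forall>m\<ge>N k. \<forall>n\<ge>N k. L2_norm (\<lambda>x. f m x - f n x) < (1/4) ^ k"
    by (intro choice allI Cauchy) simp
  then obtain N where N: "\<And>k m n. N k \<le> m \<Longrightarrow> N k \<le> n \<Longrightarrow> L2_norm (\<lambda>x. f m x - f n x) < (1/4) ^ k"
    by blast
  \<comment> \<open>The sum puts \<open>r k\<close> beyond \<open>N j\<close> for every j <= k at
    once; the summand k sends it to infinity.\<close>
  define r where "r k = k + (\<Sum>j\<le>k. N j)" for k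
  have r_ge: "N j \<le> r k" if "j \<le> k" for j k
    using that member_le_sum[of j "{..k}" N] by (simp add: r_def)
  have r_mono: "filterlim r at_top sequentially"
    by (rule filterlim_at_top_mono[OF filterlim_ident]) (simp add: r_def)
  let ?d = "\<lambda>k x. f (r (Suc k)) x - f (r k) x"
  have d: "L2_sq (?d k) \<le> ennreal ((1/16) ^ k)" for k
  proof -
    have "L2_norm (?d k) \<le> (1/4) ^ k"
      by (rule less_imp_le, rule N; rule r_ge; simp)
    then show ?thesis
      by (simp add: L2_norm_le_iff L2_space_diff f power2_eq_square flip: power_mult_distrib)
  qed
  \<comment> \<open>Squared increments have integral at most 16^-k, so the weight 4^k still leaves a
    convergent series. Where that series is finite, the increments are at most a constant times 2^-k
    and therefore summable.\<close>
  have "(\<integral>\<^sup>+x. (\<Sum>k. ennreal (4 ^ k * (cmod (?d k x))\<^sup>2)) \<partial>lborel) = (\<Sum>k. ennreal (4 ^ k) * L2_sq (?d k))"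
    by (subst nn_integral_suminf) (simp_all add: ennreal_mult nn_integral_cmult L2_sq_def)
  also have "\<dots> \<le> (\<Sum>k. ennreal ((1/4) ^ k))"
  proof (intro suminf_le summableI)
    fix k
    have "ennreal (4 ^ k) * L2_sq (?d k) \<le> ennreal (4 ^ k) * ennreal ((1/16) ^ k)"
      by (intro mult_left_mono d) simp
    also have "\<dots> = ennreal ((1/4) ^ k)"
      by (simp flip: ennreal_mult power_mult_distrib)
    finally show "ennreal (4 ^ k) * L2_sq (?d k) \<le> ennreal ((1/4) ^ k)" .
  qed
  also have "(\<Sum>k. ennreal ((1/4) ^ k)) = ennreal (\<Sum>k. (1/4) ^ k)"
    by (rule suminf_ennreal2) (simp_all only: zero_le_power summable_geometric_iff, simp_all)
  also have "\<dots> < \<infinity>"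
    by (rule ennreal_less_top[folded infinity_ennreal_def])
  finally have "AE x in lborel. (\<Sum>k. ennreal (4 ^ k * (cmod (?d k x))\<^sup>2)) \<noteq> \<infinity>"
    by (intro nn_integral_PInf_AE) auto
  then have conv: "AE x in lborel. convergent (\<lambda>k. f (r k) x)"
  proof eventually_elim
    case (elim x)
    define u where "u k = ennreal (4 ^ k * (cmod (?d k x))\<^sup>2)" for k
    obtain M where M: "0 \<le> M" "suminf u = ennreal M"
      using elim unfolding u_def[symmetric] by (cases "suminf u" rule: ennreal_cases) auto
    have bound: "cmod (?d k x) \<le> sqrt M * (1/2) ^ k" for k
    proof -
      have "sum u {k} \<le> suminf u"
        by (rule sum_le_suminf) simp_all
      then have "4 ^ k * (cmod (?d k x))\<^sup>2 \<le> M"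
        using M(1) by (simp add: u_def M(2))
      then have "sqrt (4 ^ k * (cmod (?d k x))\<^sup>2) \<le> sqrt M"
        by (rule real_sqrt_le_mono)
      moreover have "sqrt (4 ^ k * (cmod (?d k x))\<^sup>2) = 2 ^ k * cmod (?d k x)"
        by (simp add: real_sqrt_mult real_sqrt_power)
      ultimately have "2 ^ k * cmod (?d k x) \<le> sqrt M"
        by simp
      then show ?thesis
        by (simp add: field_simps)
    qed
    have "summable (\<lambda>k. ?d k x)"
    proof (rule summable_comparison_test[where g = "\<lambda>k. sqrt M * (1/2) ^ k"])
      show "summable (\<lambda>k. sqrt M * (1/2) ^ k)"
        by (intro summable_mult summable_geometric) simp
    qed (use bound in blast)
    then have "convergent (\<lambda>n. (\<Sum>k<n. ?d k x) + f (r 0) x)"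
      by (intro convergent_add convergent_const) (simp add: summable_iff_convergent)
    then show ?case
      by (simp add: sum_lessThan_telescope[of "\<lambda>k. f (r k) x"])
  qed
  define f' where "f' x = lim (\<lambda>k. f (r k) x)" for x
  have [measurable]: "f' \<in> borel_measurable borel"
    unfolding f'_def[abs_def] by measurable
  have lim: "AE x in lborel. (\<lambda>k. f (r k) x) \<longlonglongrightarrow> f' x"
    using conv by eventually_elim (simp add: f'_def convergent_LIMSEQ_iff)
  \<comment> \<open>Fatou along the subsequence transfers the Cauchy bound between
    \<open>f n\<close> and \<open>f (r k)\<close> to the pointwise limit, for every large n.\<close>
  have close: "L2_sq (\<lambda>x. f n x - f' x) \<le> ennreal (((1/4) ^ j)\<^sup>2)" if "N j \<le> n" for n j
  proof -
    have "AE x in lborel. (\<lambda>k. f n x - f (r k) x) \<longlonglongrightarrow> f n x - f' x"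
      using lim by eventually_elim (intro tendsto_intros)
    then have "L2_sq (\<lambda>x. f n x - f' x) \<le> liminf (\<lambda>k. L2_sq (\<lambda>x. f n x - f (r k) x))"
      by (intro L2_sq_Fatou) measurable
    also have "\<dots> \<le> ennreal (((1/4) ^ j)\<^sup>2)"
    proof (rule Liminf_le[OF _ eventually_sequentiallyI[of j]])
      fix k
      assume "j \<le> k"
      then show "L2_sq (\<lambda>x. f n x - f (r k) x) \<le> ennreal (((1/4) ^ j)\<^sup>2)"
        by (subst L2_norm_le_iff[symmetric]) (auto intro: L2_space_diff f less_imp_le N that r_ge)
    qed simp
    finally show ?thesis .
  qed
  have diff: "(\<lambda>x. f n x - f' x) \<in> L2_space" if "N 0 \<le> n" for n
    using close[OF that] by (auto simp: L2_space_iff intro: order_le_less_trans)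
  then have f': "f' \<in> L2_space"
    using L2_space_diff[OF f diff[of "N 0"], of "N 0"] by simp
  have "(\<lambda>n. L2_norm (\<lambda>x. f n x - f' x)) \<longlonglongrightarrow> 0"
  proof (rule LIMSEQ_I)
    fix e :: real
    assume "e > 0"
    then obtain j where j: "(1/4) ^ j < e"
      using real_arch_pow_inv[of e "1/4"] by auto
    have "L2_norm (\<lambda>x. f n x - f' x) < e" if "N j \<le> n" for n
      using close[OF that] j by (auto simp: L2_norm_le_iff[symmetric] L2_space_diff f f' intro: order_le_less_trans)
    then show "\<exists>no. \<forall>n\<ge>no. norm (L2_norm (\<lambda>x. f n x - f' x) - 0) < e"
      by (auto simp: L2_norm_nonneg)
  qed
  with f' show thesis
    by (rule that)
qed

section \<open>The Fourier transform on square integrable functions\<close>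

text \<open>A class on which the defining integral of the transform converges absolutely; it is
  closed under differences and contains all truncations to balls.\<close>

definition L2_bounded_support :: "(real^'n \<Rightarrow> complex) set" where
  "L2_bounded_support = {f \<in> L2_space. \<exists>R. \<forall>x. R < norm x \<longrightarrow> f x = 0}"

lemma L2_bounded_supportD: "f \<in> L2_bounded_support \<Longrightarrow> f \<in> L2_space"
  by (simp add: L2_bounded_support_def)

lemma L2_bounded_support_diff:
  assumes "f \<in> L2_bounded_support" "g \<in> L2_bounded_support"
  shows "(\<lambda>x. f x - g x) \<in> L2_bounded_support"
proof -
  obtain R S where "\<And>x. R < norm x \<Longrightarrow> f x = 0" "\<And>x. S < norm x \<Longrightarrow> g x = 0"
    using assms by (auto simp: L2_bounded_support_def)
  then have "\<forall>x. max R S < norm x \<longrightarrow> f x - g x = 0"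
    by simp
  then show ?thesis
    using assms L2_space_diff unfolding L2_bounded_support_def by blast
qed

lemma L2_space_indicator_cball: "indicator (cball 0 R) \<in> (L2_space :: (real^'n \<Rightarrow> complex) set)"
proof -
  have *: "(\<lambda>x. (cmod (indicator (cball 0 R) x))\<^sup>2) = (indicator (cball (0 :: real^'n) R) :: _ \<Rightarrow> real)"
    by (auto simp: indicator_def)
  have "integrable lborel (indicator (cball (0 :: real^'n) R) :: _ \<Rightarrow> real)"
    using emeasure_lborel_cball_finite[of "0 :: real^'n" R]
    by (intro integrable_real_indicator) (simp_all add: infinity_ennreal_def)
  then show ?thesis
    unfolding L2_space_def mem_Collect_eq * by (auto intro!: borel_measurable_indicator)
qed

lemma integrable_L2_bounded_support:
  assumes "f \<in> L2_bounded_support"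
  shows "integrable lborel f"
proof -
  obtain R where "\<And>x. R < norm x \<Longrightarrow> f x = 0"
    using assms by (auto simp: L2_bounded_support_def)
  then have "(\<lambda>x. f x * indicator (cball 0 R) x) = f"
    by (auto simp: fun_eq_iff indicator_def)
  then show ?thesis
    using integrable_L2_mult[OF L2_bounded_supportD[OF assms] L2_space_indicator_cball[of R]] by simp
qed

lemma fourier_integral_diff:
  assumes "integrable lborel f" "integrable lborel g"
  shows "fourier_integral (\<lambda>x. f x - g x) \<xi> = fourier_integral f \<xi> - fourier_integral g \<xi>"
  unfolding fourier_integral_def left_diff_distrib
  by (rule Bochner_Integration.integral_diff) (intro integrable_fourier_integrand assms)+

text \<open>Let \<epsilon> tend to 0 in the regularised identity. Continuity and boundedness of g
  give the right-hand side by dominated convergence; the left-hand side converges monotonically, so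
  the transform need not be known to be square integrable. One factor \<open>?c\<close> is the
  constant in the regularised identity, the other the mass of the Gaussian.\<close>

lemma plancherel_continuous:
  fixes g :: "real^'n \<Rightarrow> complex"
  assumes cont: "continuous_on UNIV g" and g: "g \<in> L2_bounded_support"
  shows "L2_sq (fourier_integral g) = ennreal ((2 * pi) ^ CARD('n)) * L2_sq g"
proof -
  let ?F = "fourier_integral g"
  let ?c = "sqrt (2 * pi) ^ CARD('n)"
  have int: "integrable lborel g"
    by (rule integrable_L2_bounded_support[OF g])
  have [measurable]: "g \<in> borel_measurable borel"
    using cont by (rule borel_measurable_continuous_onI)
  obtain R where R: "\<And>x. R < norm x \<Longrightarrow> g x = 0"
    using g by (auto simp: L2_bounded_support_def)
  have "compact (g ` cball 0 R)"
    by (intro compact_continuous_image continuous_on_subset[OF cont] compact_cball) simp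
  then have "bounded (g ` cball 0 R)"
    by (rule compact_imp_bounded)
  then obtain C where "\<forall>y\<in>g ` cball 0 R. cmod y \<le> C"
    unfolding bounded_iff ..
  then have C: "\<And>x. x \<in> cball 0 R \<Longrightarrow> cmod (g x) \<le> C"
    by simp
  have g_le: "cmod (g x) \<le> \<bar>C\<bar>" for x
    using C[of x] R[of x] by (cases "norm x \<le> R") auto
  define \<epsilon> where "\<epsilon> k = 1 / real (Suc k)" for k
  have \<epsilon>: "0 < \<epsilon> k" for k
    by (simp add: \<epsilon>_def)
  have \<epsilon>_lim: "\<epsilon> \<longlonglongrightarrow> 0"
    unfolding \<epsilon>_def[abs_def] by real_asymp
  let ?I = "\<lambda>k x. \<integral>z. cnj (g (x - \<epsilon> k *\<^sub>R z)) * of_real (gaussian z) \<partial>lborel"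
  have I_lim: "(\<lambda>k. ?I k x) \<longlonglongrightarrow> (\<integral>z. cnj (g x) * of_real (gaussian z) \<partial>(lborel :: (real^'n) measure))" for x
  proof (rule integral_dominated_convergence[where w = "\<lambda>z. \<bar>C\<bar> * gaussian z"])
    show "AE z in lborel. (\<lambda>k. cnj (g (x - \<epsilon> k *\<^sub>R z)) * of_real (gaussian z)) \<longlonglongrightarrow> cnj (g x) * of_real (gaussian z)"
    proof (rule AE_I2)
      fix z
      have "(\<lambda>k. x - \<epsilon> k *\<^sub>R z) \<longlonglongrightarrow> x - 0 *\<^sub>R z"
        by (intro tendsto_intros \<epsilon>_lim)
      then have "(\<lambda>k. g (x - \<epsilon> k *\<^sub>R z)) \<longlonglongrightarrow> g x"
        using continuous_on_tendsto_compose[OF cont] by simp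
      then show "(\<lambda>k. cnj (g (x - \<epsilon> k *\<^sub>R z)) * of_real (gaussian z)) \<longlonglongrightarrow> cnj (g x) * of_real (gaussian z)"
        by (intro tendsto_intros)
    qed
    show "AE z in lborel. norm (cnj (g (x - \<epsilon> k *\<^sub>R z)) * of_real (gaussian z)) \<le> \<bar>C\<bar> * gaussian z" for k
      using g_le by (auto simp: norm_mult gaussian_pos less_imp_le intro!: mult_right_mono)
    show "integrable lborel (\<lambda>z :: real^'n. \<bar>C\<bar> * gaussian z)"
      by (intro integrable_mult_right integrable_gaussian)
  qed measurable
  have I_eq: "(\<integral>z. cnj (g x) * of_real (gaussian z) \<partial>(lborel :: (real^'n) measure)) = cnj (g x) * of_real ?c" for x
    by (simp only: integral_mult_right_zero integral_complex_of_real integral_gaussian)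
  have I_le: "cmod (?I k x) \<le> \<bar>C\<bar> * ?c" for k x
  proof -
    have "cmod (?I k x) \<le> (\<integral>z. \<bar>C\<bar> * gaussian z \<partial>(lborel :: (real^'n) measure))"
      using g_le by (intro Bochner_Integration.integral_norm_bound_integral integrable_mult_right integrable_gaussian)
         (auto simp: norm_mult gaussian_pos less_imp_le intro!: mult_right_mono
           Bochner_Integration.integrable_bound[OF integrable_mult_right[OF integrable_gaussian, of "\<bar>C\<bar>"]])
    then show ?thesis
      by (simp add: integral_gaussian)
  qed
  have "(\<lambda>k. \<integral>x. g x * ?I k x \<partial>lborel) \<longlonglongrightarrow> (\<integral>x. g x * (cnj (g x) * of_real ?c) \<partial>lborel)"
  proof (rule integral_dominated_convergence[where w = "\<lambda>x. cmod (g x) * (\<bar>C\<bar> * ?c)"])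
    show "AE x in lborel. (\<lambda>k. g x * ?I k x) \<longlonglongrightarrow> g x * (cnj (g x) * of_real ?c)"
      using I_lim unfolding I_eq by (intro AE_I2 tendsto_intros)
    show "AE x in lborel. norm (g x * ?I k x) \<le> cmod (g x) * (\<bar>C\<bar> * ?c)" for k
      using I_le by (auto simp: norm_mult intro!: mult_left_mono)
    show "integrable lborel (\<lambda>x. cmod (g x) * (\<bar>C\<bar> * ?c))"
      by (intro integrable_mult_left integrable_norm int)
  qed measurable
  also have "(\<integral>x. g x * (cnj (g x) * of_real ?c) \<partial>lborel) = of_real ?c * of_real ((L2_norm g)\<^sup>2)"
  proof -
    have "g x * (cnj (g x) * of_real ?c) = of_real ?c * of_real ((cmod (g x))\<^sup>2)" for x
      by (simp only: complex_norm_square mult_ac)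
    then show ?thesis
      by (simp only: integral_mult_right_zero integral_complex_of_real L2_norm_power2)
  qed
  finally have "(\<lambda>k. of_real ?c * (\<integral>x. g x * ?I k x \<partial>lborel)) \<longlonglongrightarrow> of_real ?c * (of_real ?c * of_real ((L2_norm g)\<^sup>2))"
    by (rule tendsto_mult_left)
  then have "(\<lambda>k. complex_of_real (\<integral>\<xi>. gaussian (\<epsilon> k *\<^sub>R \<xi>) * (cmod (?F \<xi>))\<^sup>2 \<partial>lborel))
      \<longlonglongrightarrow> of_real (?c * (?c * (L2_norm g)\<^sup>2))"
    unfolding integral_gaussian_fourier_integral(2)[OF int \<epsilon>] by simp
  then have "(\<lambda>k. \<integral>\<xi>. gaussian (\<epsilon> k *\<^sub>R \<xi>) * (cmod (?F \<xi>))\<^sup>2 \<partial>lborel) \<longlonglongrightarrow> ?c * (?c * (L2_norm g)\<^sup>2)"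
    unfolding tendsto_of_real_iff .
  then have lim1: "(\<lambda>k. ennreal (\<integral>\<xi>. gaussian (\<epsilon> k *\<^sub>R \<xi>) * (cmod (?F \<xi>))\<^sup>2 \<partial>lborel))
      \<longlonglongrightarrow> ennreal (?c * (?c * (L2_norm g)\<^sup>2))"
    by (rule tendsto_ennrealI)
  have nn: "ennreal (\<integral>\<xi>. gaussian (\<epsilon> k *\<^sub>R \<xi>) * (cmod (?F \<xi>))\<^sup>2 \<partial>lborel)
      = (\<integral>\<^sup>+\<xi>. ennreal (gaussian (\<epsilon> k *\<^sub>R \<xi>) * (cmod (?F \<xi>))\<^sup>2) \<partial>lborel)" for k
    by (rule nn_integral_eq_integral[OF integral_gaussian_fourier_integral(1)[OF int \<epsilon>], symmetric])
       (simp add: gaussian_pos less_imp_le)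
  have "(\<lambda>k. \<integral>\<^sup>+\<xi>. ennreal (gaussian (\<epsilon> k *\<^sub>R \<xi>) * (cmod (?F \<xi>))\<^sup>2) \<partial>lborel) \<longlonglongrightarrow> L2_sq ?F"
    unfolding L2_sq_def
  proof (rule nn_integral_LIMSEQ)
    show "incseq (\<lambda>k \<xi>. ennreal (gaussian (\<epsilon> k *\<^sub>R \<xi>) * (cmod (?F \<xi>))\<^sup>2))"
    proof (intro incseq_SucI le_funI ennreal_leI mult_right_mono)
      fix k and \<xi> :: "real^'n"
      have "\<epsilon> (Suc k) \<le> \<epsilon> k"
        by (simp add: \<epsilon>_def field_simps)
      then show "gaussian (\<epsilon> k *\<^sub>R \<xi>) \<le> gaussian (\<epsilon> (Suc k) *\<^sub>R \<xi>)"
        using \<epsilon>[of k] \<epsilon>[of "Suc k"] by (simp add: gaussian_def mult_right_mono power_mono)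
    qed simp
    show "(\<lambda>k. ennreal (gaussian (\<epsilon> k *\<^sub>R \<xi>) * (cmod (?F \<xi>))\<^sup>2)) \<longlonglongrightarrow> ennreal ((cmod (?F \<xi>))\<^sup>2)" for \<xi>
    proof (rule tendsto_ennrealI)
      have "(\<lambda>k. exp (- ((norm (\<epsilon> k *\<^sub>R \<xi>))\<^sup>2 / 2)) * (cmod (?F \<xi>))\<^sup>2)
          \<longlonglongrightarrow> exp (- ((norm (0 *\<^sub>R \<xi>))\<^sup>2 / 2)) * (cmod (?F \<xi>))\<^sup>2"
        by (intro tendsto_intros \<epsilon>_lim) simp
      then show "(\<lambda>k. gaussian (\<epsilon> k *\<^sub>R \<xi>) * (cmod (?F \<xi>))\<^sup>2) \<longlonglongrightarrow> (cmod (?F \<xi>))\<^sup>2"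
        by (simp add: gaussian_def)
    qed
  qed measurable
  then have "L2_sq ?F = ennreal (?c * (?c * (L2_norm g)\<^sup>2))"
    using lim1 unfolding nn by (rule LIMSEQ_unique)
  also have "?c * (?c * (L2_norm g)\<^sup>2) = (2 * pi) ^ CARD('n) * (L2_norm g)\<^sup>2"
    using real_sqrt_mult_self[of "2 * pi"] unfolding mult.assoc[symmetric] power_mult_distrib[symmetric] by simp
  finally show ?thesis
    by (simp add: L2_sq_eq L2_bounded_supportD[OF g] ennreal_mult)
qed

section \<open>Plancherel's identity for bounded supports\<close>

lemma L2_bounded_supportI:
  assumes "f \<in> borel_measurable borel" "\<And>x. cmod (f x) \<le> C" "\<And>x. R < norm x \<Longrightarrow> f x = 0"
  shows "f \<in> L2_bounded_support"
proof -
  have "cmod (f x) \<le> C * cmod (indicator (cball 0 R) x)" for x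
    using assms(2)[of x] assms(3)[of x] by (cases "norm x \<le> R") auto
  then have "f \<in> L2_space"
    using assms(1) by (intro L2_space_bound[OF _ L2_space_indicator_cball[of R]]) auto
  then show ?thesis
    using assms(3) by (auto simp: L2_bounded_support_def)
qed

lemma fourier_integral_tendsto:
  assumes "\<And>n. f n \<in> borel_measurable borel" "f' \<in> borel_measurable borel" "integrable lborel w"
    and "AE x in lborel. (\<lambda>n. f n x) \<longlonglongrightarrow> f' x" "\<And>n. AE x in lborel. cmod (f n x) \<le> w x"
  shows "(\<lambda>n. fourier_integral (f n) \<xi>) \<longlonglongrightarrow> fourier_integral f' \<xi>"
  unfolding fourier_integral_def
proof (rule integral_dominated_convergence[OF _ _ assms(3)])
  have [measurable]: "f n \<in> borel_measurable borel" "f' \<in> borel_measurable borel" for n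
    using assms by simp_all
  show "(\<lambda>x. f' x * exp (- \<i> * of_real (x \<bullet> \<xi>))) \<in> borel_measurable lborel"
    "(\<lambda>x. f n x * exp (- \<i> * of_real (x \<bullet> \<xi>))) \<in> borel_measurable lborel" for n
    by measurable
  show "AE x in lborel. (\<lambda>n. f n x * exp (- \<i> * of_real (x \<bullet> \<xi>))) \<longlonglongrightarrow> f' x * exp (- \<i> * of_real (x \<bullet> \<xi>))"
    using assms(4) by eventually_elim (intro tendsto_intros)
  show "AE x in lborel. norm (f n x * exp (- \<i> * of_real (x \<bullet> \<xi>))) \<le> w x" for n
    using assms(5)[of n] by eventually_elim (simp add: norm_mult)
qed

text \<open>A bounded support for \<open>w\<close> makes it integrable, so the transforms converge
  pointwise, and square integrable, so the norms on the right converge. Pointwise convergence of the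
  transforms yields only an inequality, by Fatou.\<close>

lemma plancherel_le_limit:
  fixes f :: "nat \<Rightarrow> real^'n \<Rightarrow> complex"
  assumes f: "\<And>n. f n \<in> borel_measurable borel" "f' \<in> borel_measurable borel"
    and w: "w \<in> L2_bounded_support" and bound: "\<And>n. AE x in lborel. cmod (f n x) \<le> cmod (w x)"
    and lim: "AE x in lborel. (\<lambda>n. f n x) \<longlonglongrightarrow> f' x"
    and le: "\<And>n. L2_sq (fourier_integral (f n)) \<le> ennreal C * L2_sq (f n)"
  shows "L2_sq (fourier_integral f') \<le> ennreal C * L2_sq f'"
proof -
  note L2 = L2_dominated_convergence[OF f lim bound L2_bounded_supportD[OF w]]
  have w_int: "integrable lborel (\<lambda>x. cmod (w x))"
    by (intro integrable_norm integrable_L2_bounded_support w)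
  have "L2_sq (fourier_integral f') \<le> liminf (\<lambda>n. L2_sq (fourier_integral (f n)))"
  proof (rule L2_sq_Fatou)
    show "fourier_integral f' \<in> borel_measurable borel" "fourier_integral (f n) \<in> borel_measurable borel" for n
      using f by measurable
    show "AE \<xi> in lborel. (\<lambda>n. fourier_integral (f n) \<xi>) \<longlonglongrightarrow> fourier_integral f' \<xi>"
      by (intro AE_I2 fourier_integral_tendsto[OF f w_int lim bound])
  qed
  also have "\<dots> \<le> liminf (\<lambda>n. ennreal C * L2_sq (f n))"
    by (intro Liminf_mono always_eventually allI le)
  also have "(\<lambda>n. ennreal C * L2_sq (f n)) \<longlonglongrightarrow> ennreal C * L2_sq f'"
  proof (rule tendsto_mult_ennreal)
    show "(\<lambda>n. L2_sq (f n)) \<longlonglongrightarrow> L2_sq f'"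
      using tendsto_power[OF L2_norm_tendsto[OF L2], of 2] by (simp add: L2_sq_eq L2)
  qed (auto simp: L2_sq_eq L2)
  then have "liminf (\<lambda>n. ennreal C * L2_sq (f n)) = ennreal C * L2_sq f'"
    by (rule lim_imp_Liminf[OF sequentially_bot])
  finally show ?thesis .
qed

text \<open>Once the inequality holds on the whole class it applies to the differences
  \<open>f n - f'\<close>; the transforms then converge in norm, and equality survives the
  limit.\<close>

lemma plancherel_eq_limit:
  fixes f :: "nat \<Rightarrow> real^'n \<Rightarrow> complex"
  assumes f: "\<And>n. f n \<in> L2_bounded_support" "f' \<in> L2_bounded_support"
    and lim: "(\<lambda>n. L2_norm (\<lambda>x. f n x - f' x)) \<longlonglongrightarrow> 0"
    and le: "\<And>g. g \<in> (L2_bounded_support :: (real^'n \<Rightarrow> complex) set) \<Longrightarrow> L2_sq (fourier_integral g) \<le> ennreal C * L2_sq g"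
    and eq: "\<And>n. L2_sq (fourier_integral (f n)) = ennreal C * L2_sq (f n)" and "0 \<le> C"
  shows "L2_sq (fourier_integral f') = ennreal C * L2_sq f'"
proof -
  have L2: "fourier_integral g \<in> L2_space" if "g \<in> L2_bounded_support" for g :: "real^'n \<Rightarrow> complex"
  proof -
    have "L2_sq (fourier_integral g) < \<infinity>"
      using le[OF that] L2_bounded_supportD[OF that]
      by (auto simp: L2_space_iff ennreal_mult_less_top intro: order_le_less_trans)
    then show ?thesis
      using L2_bounded_supportD[OF that] by (simp add: L2_space_iff fourier_integral_measurable)
  qed
  have norm_le: "L2_norm (fourier_integral g) \<le> sqrt C * L2_norm g" if "g \<in> L2_bounded_support" for g :: "real^'n \<Rightarrow> complex"
    using le[OF that] L2_bounded_supportD[OF that] \<open>0 \<le> C\<close>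
    by (subst L2_norm_le_iff[OF L2[OF that]])
       (simp_all add: L2_sq_eq ennreal_mult power_mult_distrib L2_norm_nonneg)
  have norm_eq: "L2_norm (fourier_integral (f n)) = sqrt C * L2_norm (f n)" for n
  proof -
    have "ennreal ((L2_norm (fourier_integral (f n)))\<^sup>2) = ennreal ((sqrt C * L2_norm (f n))\<^sup>2)"
      using eq[of n] \<open>0 \<le> C\<close>
      by (simp add: L2_sq_eq L2 f L2_bounded_supportD power_mult_distrib ennreal_mult)
    then show ?thesis
      using \<open>0 \<le> C\<close> by (simp add: L2_norm_nonneg)
  qed
  have "(\<lambda>n. L2_norm (\<lambda>\<xi>. fourier_integral (f n) \<xi> - fourier_integral f' \<xi>)) \<longlonglongrightarrow> 0"
  proof (rule Lim_null_comparison)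
    show "\<forall>\<^sub>F n in sequentially. norm (L2_norm (\<lambda>\<xi>. fourier_integral (f n) \<xi> - fourier_integral f' \<xi>))
        \<le> sqrt C * L2_norm (\<lambda>x. f n x - f' x)"
    proof (intro always_eventually allI)
      fix n
      have "fourier_integral (\<lambda>x. f n x - f' x) = (\<lambda>\<xi>. fourier_integral (f n) \<xi> - fourier_integral f' \<xi>)"
        by (intro ext fourier_integral_diff integrable_L2_bounded_support f)
      then show "norm (L2_norm (\<lambda>\<xi>. fourier_integral (f n) \<xi> - fourier_integral f' \<xi>))
          \<le> sqrt C * L2_norm (\<lambda>x. f n x - f' x)"
        using norm_le[OF L2_bounded_support_diff[OF f], of n] by (simp add: L2_norm_nonneg)
    qed
    show "(\<lambda>n. sqrt C * L2_norm (\<lambda>x. f n x - f' x)) \<longlonglongrightarrow> 0"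
      using tendsto_mult_left[OF lim, of "sqrt C"] by simp
  qed
  then have "(\<lambda>n. sqrt C * L2_norm (f n)) \<longlonglongrightarrow> L2_norm (fourier_integral f')"
    using L2_norm_tendsto[of "\<lambda>n. fourier_integral (f n)"] L2 f by (simp add: norm_eq)
  moreover have "(\<lambda>n. sqrt C * L2_norm (f n)) \<longlonglongrightarrow> sqrt C * L2_norm f'"
    by (intro tendsto_intros L2_norm_tendsto L2_bounded_supportD f lim)
  ultimately have "L2_norm (fourier_integral f') = sqrt C * L2_norm f'"
    by (rule LIMSEQ_unique)
  then show ?thesis
    using \<open>0 \<le> C\<close> by (simp add: L2_sq_eq L2 f L2_bounded_supportD power_mult_distrib ennreal_mult)
qed

text \<open>A measurable function is almost everywhere a limit of continuous ones, but these may be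
  unbounded and spread out. Composing with \<open>clamp\<close>, the radial projection onto the disc
  of radius D, and multiplying by the cutoff \<phi> gives a common majorant \<open>w\<close>;
  neither operation changes the limit, since f is bounded by D and vanishes where \<phi> <
  1.\<close>

lemma L2_bounded_support_approx_continuous:
  fixes f :: "real^'n \<Rightarrow> complex"
  assumes [measurable]: "f \<in> borel_measurable borel" and C: "\<And>x. cmod (f x) \<le> C"
    and R: "\<And>x. R < norm x \<Longrightarrow> f x = 0"
  obtains g w where "\<And>n :: nat. continuous_on UNIV (g n)" "\<And>n. g n \<in> L2_bounded_support"
    "w \<in> L2_bounded_support" "\<And>n x. cmod (g n x) \<le> cmod (w x)"
    "AE x in lborel. (\<lambda>n. g n x) \<longlonglongrightarrow> f x"
proof -
  have "f \<in> borel_measurable lebesgue"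
    by (simp add: measurable_completion)
  then have "f measurable_on UNIV"
    by (rule lebesgue_measurable_imp_measurable_on) simp
  then obtain N h where N: "negligible N" and h: "\<And>n. continuous_on UNIV (h n)"
    and lim: "\<And>x. x \<notin> N \<Longrightarrow> (\<lambda>n. h n x) \<longlonglongrightarrow> f x"
    unfolding measurable_on_def by auto
  define \<phi> where "\<phi> x = max 0 (min 1 (R + 1 - norm x))" for x :: "real^'n"
  \<comment> \<open>At least C, so that \<open>clamp\<close> fixes the values of f, and positive
    even if C = 0, so that dividing by it is sound.\<close>
  define D where "D = max C 1"
  define clamp where "clamp z = z /\<^sub>R max 1 (cmod z / D)" for z
  define g where "g n x = \<phi> x *\<^sub>R clamp (h n x)" for n x
  define w :: "real^'n \<Rightarrow> complex" where "w x = of_real D * indicator (cball 0 (R + 1)) x" for x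
  have D: "0 < D" "C \<le> D"
    by (simp_all add: D_def)
  have clamp_cont: "continuous_on UNIV clamp"
    unfolding clamp_def using D(1) by (intro continuous_intros) (auto simp: max_def)
  have \<phi>_cont: "continuous_on UNIV \<phi>"
    unfolding \<phi>_def by (intro continuous_intros)
  have clamp_le: "cmod (clamp z) \<le> D" for z
  proof -
    have "cmod z = cmod z / D * D"
      using D by simp
    also have "\<dots> \<le> max 1 (cmod z / D) * D"
      using D by (intro mult_right_mono) auto
    finally have "cmod z / max 1 (cmod z / D) \<le> D"
      by (simp add: pos_divide_le_eq mult.commute)
    then show ?thesis
      by (simp add: clamp_def divide_inverse mult.commute)
  qed
  have clamp_id: "clamp z = z" if "cmod z \<le> D" for z
    using that D by (simp add: clamp_def max_def)
  have \<phi>: "0 \<le> \<phi> x" "\<phi> x \<le> 1" for x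
    by (simp_all add: \<phi>_def)
  have g_cont: "continuous_on UNIV (g n)" for n
    unfolding g_def
    by (intro continuous_intros \<phi>_cont continuous_on_compose2[OF clamp_cont h]) simp
  have w: "w \<in> L2_bounded_support"
  proof (rule L2_bounded_supportI[of _ D "R + 1"])
    show "w \<in> borel_measurable borel"
      unfolding w_def[abs_def] by (intro borel_measurable_times borel_measurable_const borel_measurable_indicator) simp
  qed (use D in \<open>auto simp: w_def indicator_def\<close>)
  have g_le: "cmod (g n x) \<le> cmod (w x)" for n x
  proof (cases "norm x \<le> R + 1")
    case True
    then show ?thesis
      using mult_mono[OF \<phi>(2)[of x] clamp_le[of "h n x"]] \<phi>(1)[of x] D by (simp add: g_def w_def)
  next
    case False
    then show ?thesis
      by (simp add: g_def w_def \<phi>_def)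
  qed
  show thesis
  proof (rule that[of g w])
    show "g n \<in> L2_bounded_support" for n
    proof (rule L2_bounded_supportI[of _ D "R + 1"])
      show "g n \<in> borel_measurable borel"
        by (rule borel_measurable_continuous_onI[OF g_cont])
      show "cmod (g n x) \<le> D" for x
        using g_le[of n x] D by (cases "norm x \<le> R + 1") (simp_all add: w_def norm_mult)
      show "g n x = 0" if "R + 1 < norm x" for x
        using g_le[of n x] that by (simp add: w_def)
    qed
    have "AE x in lebesgue. x \<notin> N"
      using N by (intro AE_not_in) (simp add: negligible_iff_null_sets)
    then have "AE x in lborel. x \<notin> N"
      by (simp only: AE_completion_iff)
    then show "AE x in lborel. (\<lambda>n. g n x) \<longlonglongrightarrow> f x"
    proof eventually_elim
      case (elim x)
      have "(\<lambda>n. clamp (h n x)) \<longlonglongrightarrow> clamp (f x)"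
        by (rule continuous_on_tendsto_compose[OF clamp_cont lim[OF elim]]) simp_all
      then have "(\<lambda>n. g n x) \<longlonglongrightarrow> \<phi> x *\<^sub>R clamp (f x)"
        unfolding g_def by (intro tendsto_intros)
      also have "\<phi> x *\<^sub>R clamp (f x) = f x"
      proof (cases "norm x \<le> R")
        case True
        then show ?thesis
          using clamp_id[of "f x"] C[of x] D by (simp add: \<phi>_def)
      qed (simp add: R clamp_id D less_imp_le)
      finally show ?case .
    qed
  qed (fact g_cont w g_le)+
qed

text \<open>Cutting off large values supplies the boundedness that the continuous approximation
  needs; at each point the sequence is eventually constant.\<close>

lemma L2_truncate_values:
  fixes f :: "real^'n \<Rightarrow> complex"
  assumes f: "f \<in> L2_bounded_support"
  defines "g \<equiv> \<lambda>n x. if cmod (f x) \<le> real n then f x else 0"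
  shows "g n \<in> borel_measurable borel" "cmod (g n x) \<le> real n" "cmod (g n x) \<le> cmod (f x)"
    "(\<lambda>n. g n x) \<longlonglongrightarrow> f x"
proof -
  have [measurable]: "f \<in> borel_measurable borel"
    using f by (simp add: L2_bounded_supportD L2_space_measurable)
  show "g n \<in> borel_measurable borel"
    unfolding g_def by measurable
  show "(\<lambda>n. g n x) \<longlonglongrightarrow> f x"
  proof (rule tendsto_eventually, rule eventually_sequentiallyI)
    show "g n x = f x" if "nat \<lceil>cmod (f x)\<rceil> \<le> n" for n
      using that by (simp add: g_def nat_le_iff ceiling_le_iff)
  qed
qed (simp_all add: g_def)

lemma L2_truncate_values_approx:
  fixes f :: "real^'n \<Rightarrow> complex"
  assumes f: "f \<in> L2_bounded_support"
  obtains h w where "\<And>k :: nat. continuous_on UNIV (h k)" "\<And>k. h k \<in> L2_bounded_support"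
    "w \<in> L2_bounded_support" "\<And>k. AE x in lborel. cmod (h k x) \<le> cmod (w x)"
    "AE x in lborel. (\<lambda>k. h k x) \<longlonglongrightarrow> (if cmod (f x) \<le> real n then f x else 0)"
proof -
  obtain R where "\<And>x. R < norm x \<Longrightarrow> f x = 0"
    using f by (auto simp: L2_bounded_support_def)
  then have R: "\<And>x. R < norm x \<Longrightarrow> (if cmod (f x) \<le> real n then f x else 0) = 0"
    by simp
  show thesis
  proof (rule L2_bounded_support_approx_continuous[OF L2_truncate_values(1,2)[OF f] R])
    fix h w
    assume h: "\<And>k :: nat. continuous_on UNIV (h k)" "\<And>k. h k \<in> L2_bounded_support"
      "w \<in> L2_bounded_support" "\<And>k x. cmod (h k x) \<le> cmod (w x)"
      "AE x in lborel. (\<lambda>k. h k x) \<longlonglongrightarrow> (if cmod (f x) \<le> real n then f x else 0)"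
    show thesis
      by (rule that[OF h(1,2,3) _ h(5)]) (intro AE_I2 h(4))
  qed
qed

lemma L2_truncate_values_bounded_support:
  fixes f :: "real^'n \<Rightarrow> complex"
  assumes f: "f \<in> L2_bounded_support"
  shows "(\<lambda>x. if cmod (f x) \<le> real n then f x else 0) \<in> L2_bounded_support"
proof -
  obtain R where "\<And>x. R < norm x \<Longrightarrow> f x = 0"
    using f by (auto simp: L2_bounded_support_def)
  then show ?thesis
    by (intro L2_bounded_supportI[OF L2_truncate_values(1,2)[OF f], of R]) simp
qed

text \<open>Two passages to the limit: from continuous to bounded functions, and from those to f
  through its value truncations.\<close>

lemma plancherel_le:
  fixes f :: "real^'n \<Rightarrow> complex"
  assumes f: "f \<in> L2_bounded_support"
  shows "L2_sq (fourier_integral f) \<le> ennreal ((2 * pi) ^ CARD('n)) * L2_sq f"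
proof (rule plancherel_le_limit[OF L2_truncate_values(1)[OF f] _ f])
  fix n
  let ?g = "\<lambda>x. if cmod (f x) \<le> real n then f x else 0"
  obtain h w where h: "\<And>k :: nat. continuous_on UNIV (h k)" "\<And>k. h k \<in> L2_bounded_support"
    "w \<in> L2_bounded_support" "\<And>k. AE x in lborel. cmod (h k x) \<le> cmod (w x)"
    "AE x in lborel. (\<lambda>k. h k x) \<longlonglongrightarrow> ?g x"
    by (rule L2_truncate_values_approx[OF f, of n]) blast
  show "L2_sq (fourier_integral ?g) \<le> ennreal ((2 * pi) ^ CARD('n)) * L2_sq ?g"
    by (rule plancherel_le_limit[OF borel_measurable_continuous_onI[OF h(1)] L2_truncate_values(1)[OF f]
          h(3,4,5) eq_refl[OF plancherel_continuous[OF h(1,2)]]])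
next
  show "AE x in lborel. cmod (if cmod (f x) \<le> real n then f x else 0) \<le> cmod (f x)" for n
    by (intro AE_I2 L2_truncate_values(3)[OF f])
  show "AE x in lborel. (\<lambda>n. if cmod (f x) \<le> real n then f x else 0) \<longlonglongrightarrow> f x"
    by (intro AE_I2 L2_truncate_values(4)[OF f])
qed (rule L2_space_measurable[OF L2_bounded_supportD[OF f]])

text \<open>The same two passages as for the inequality, which is now available to control
  differences, so that equality is preserved in each.\<close>

theorem plancherel:
  fixes f :: "real^'n \<Rightarrow> complex"
  assumes f: "f \<in> L2_bounded_support"
  shows "L2_sq (fourier_integral f) = ennreal ((2 * pi) ^ CARD('n)) * L2_sq f"
proof (rule plancherel_eq_limit[OF L2_truncate_values_bounded_support[OF f] f _ plancherel_le])
  fix n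
  let ?g = "\<lambda>x. if cmod (f x) \<le> real n then f x else 0"
  obtain h w where h: "\<And>k :: nat. continuous_on UNIV (h k)" "\<And>k. h k \<in> L2_bounded_support"
    "w \<in> L2_bounded_support" "\<And>k. AE x in lborel. cmod (h k x) \<le> cmod (w x)"
    "AE x in lborel. (\<lambda>k. h k x) \<longlonglongrightarrow> ?g x"
    by (rule L2_truncate_values_approx[OF f, of n]) blast
  have "(\<lambda>k. L2_norm (\<lambda>x. h k x - ?g x)) \<longlonglongrightarrow> 0"
    by (rule L2_dominated_convergence(3)[OF borel_measurable_continuous_onI[OF h(1)]
          L2_truncate_values(1)[OF f] h(5,4) L2_bounded_supportD[OF h(3)]])
  then show "L2_sq (fourier_integral ?g) = ennreal ((2 * pi) ^ CARD('n)) * L2_sq ?g"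
    by (rule plancherel_eq_limit[OF h(2) L2_truncate_values_bounded_support[OF f] _ plancherel_le
          plancherel_continuous[OF h(1,2)]]) simp_all
next
  show "(\<lambda>n. L2_norm (\<lambda>x. (if cmod (f x) \<le> real n then f x else 0) - f x)) \<longlonglongrightarrow> 0"
    by (rule L2_dominated_convergence(3)[OF L2_truncate_values(1)[OF f]
          L2_space_measurable[OF L2_bounded_supportD[OF f]] _ _ L2_bounded_supportD[OF f]])
       (intro AE_I2 L2_truncate_values(3,4)[OF f])+
qed simp_all

lemma fourier_integral_L2_bounded_support:
  fixes f :: "real^'n \<Rightarrow> complex"
  assumes f: "f \<in> L2_bounded_support"
  shows "fourier_integral f \<in> L2_space"
    and "L2_norm (fourier_integral f) = sqrt ((2 * pi) ^ CARD('n)) * L2_norm f"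
proof -
  have f_L2: "f \<in> L2_space"
    by (rule L2_bounded_supportD[OF f])
  then have "L2_sq (fourier_integral f) < \<infinity>"
    by (auto simp: plancherel[OF f] L2_space_iff ennreal_mult_less_top)
  then show L2: "fourier_integral f \<in> L2_space"
    using f_L2 by (simp add: L2_space_iff fourier_integral_measurable)
  have "ennreal ((L2_norm (fourier_integral f))\<^sup>2) = ennreal ((sqrt ((2 * pi) ^ CARD('n)) * L2_norm f)\<^sup>2)"
    unfolding L2_sq_eq[OF L2, symmetric] plancherel[OF f] L2_sq_eq[OF f_L2] power_mult_distrib[of _ "L2_norm f"]
    by (subst ennreal_mult) simp_all
  then have "(L2_norm (fourier_integral f))\<^sup>2 = (sqrt ((2 * pi) ^ CARD('n)) * L2_norm f)\<^sup>2"
    by (subst (asm) ennreal_inj) (rule zero_le_power2)+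
  then show "L2_norm (fourier_integral f) = sqrt ((2 * pi) ^ CARD('n)) * L2_norm f"
    by (rule power2_eq_imp_eq) (simp_all add: L2_norm_nonneg)
qed

section \<open>Extension of the transform to all of \<open>L2_space\<close>\<close>

definition truncate :: "nat \<Rightarrow> (real^'n \<Rightarrow> complex) \<Rightarrow> real^'n \<Rightarrow> complex" where
  "truncate n f x = indicator (cball 0 (real n)) x *\<^sub>R f x"

lemma truncate:
  fixes f :: "real^'n \<Rightarrow> complex"
  assumes f: "f \<in> L2_space"
  shows "truncate n f \<in> L2_bounded_support" "(\<lambda>n. L2_norm (\<lambda>x. truncate n f x - f x)) \<longlonglongrightarrow> 0"
proof -
  have [measurable]: "f \<in> borel_measurable borel"
    using f by (rule L2_space_measurable)
  have meas: "truncate n f \<in> borel_measurable borel" for n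
    unfolding truncate_def[abs_def]
    by (intro borel_measurable_scaleR borel_measurable_indicator) simp_all
  have le: "AE x in lborel. cmod (truncate n f x) \<le> cmod (f x)" for n
    by (simp add: truncate_def indicator_def)
  have lim: "AE x in lborel. (\<lambda>n. truncate n f x) \<longlonglongrightarrow> f x"
  proof (intro AE_I2 tendsto_eventually eventually_sequentiallyI)
    show "truncate n f x = f x" if "nat \<lceil>norm x\<rceil> \<le> n" for n x
      using that by (simp add: truncate_def nat_le_iff ceiling_le_iff)
  qed
  note L2 = L2_dominated_convergence[OF meas L2_space_measurable[OF f] lim le f]
  show "(\<lambda>n. L2_norm (\<lambda>x. truncate n f x - f x)) \<longlonglongrightarrow> 0"
    by (rule L2(3))
  show "truncate n f \<in> L2_bounded_support"
    unfolding L2_bounded_support_def mem_Collect_eq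
  proof (intro conjI exI[of _ "real n"] allI impI)
    show "truncate n f \<in> L2_space"
      by (rule L2(1))
  qed (simp add: truncate_def)
qed

text \<open>Plancherel applied to differences of truncations shows that their transforms form a
  Cauchy sequence. Completeness provides a limit, and this witness makes the \<open>SOME\<close> in
  the definition effective.\<close>

lemma fourier_L2:
  fixes f :: "real^'n \<Rightarrow> complex"
  assumes f: "f \<in> L2_space"
  shows fourier_L2_in_L2_space: "fourier_L2 f \<in> L2_space"
    and fourier_integral_truncate_tendsto:
      "(\<lambda>n. L2_norm (\<lambda>\<xi>. fourier_integral (truncate n f) \<xi> - fourier_L2 f \<xi>)) \<longlonglongrightarrow> 0"
proof -
  let ?F = "\<lambda>n. fourier_integral (truncate n f)"
  let ?c = "sqrt ((2 * pi) ^ CARD('n))"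
  have F: "?F n \<in> L2_space" for n
    by (intro fourier_integral_L2_bounded_support truncate f)
  have diff: "L2_norm (\<lambda>\<xi>. ?F m \<xi> - ?F n \<xi>) = ?c * L2_norm (\<lambda>x. truncate m f x - truncate n f x)" for m n
  proof -
    have "(\<lambda>\<xi>. ?F m \<xi> - ?F n \<xi>) = fourier_integral (\<lambda>x. truncate m f x - truncate n f x)"
      by (intro ext fourier_integral_diff[symmetric] integrable_L2_bounded_support truncate f)
    then show ?thesis
      by (simp only:) (intro fourier_integral_L2_bounded_support L2_bounded_support_diff truncate f)
  qed
  obtain h where h: "h \<in> L2_space" "(\<lambda>n. L2_norm (\<lambda>\<xi>. ?F n \<xi> - h \<xi>)) \<longlonglongrightarrow> 0"
  proof (rule L2_complete[of ?F])
    fix e :: real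
    assume "e > 0"
    have c: "0 < ?c"
      by simp
    have "0 < e / (2 * ?c)"
      using \<open>e > 0\<close> c by (simp only: zero_less_divide_iff) auto
    then obtain N where "\<forall>n\<ge>N. norm (L2_norm (\<lambda>x. truncate n f x - f x) - 0) < e / (2 * ?c)"
      using LIMSEQ_D[OF truncate(2)[OF f]] by blast
    then have N: "L2_norm (\<lambda>x. truncate n f x - f x) < e / (2 * ?c)" if "n \<ge> N" for n
      using that by (auto simp: L2_norm_nonneg)
    have "L2_norm (\<lambda>\<xi>. ?F m \<xi> - ?F n \<xi>) < e" if "m \<ge> N" "n \<ge> N" for m n
    proof -
      have "L2_norm (\<lambda>x. truncate m f x - truncate n f x) < e / (2 * ?c) + e / (2 * ?c)"
        using L2_norm_triangle_diff[OF L2_bounded_supportD[OF truncate(1)[OF f, of m]] f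
            L2_bounded_supportD[OF truncate(1)[OF f, of n]]] N[OF that(1)] N[OF that(2)]
          L2_norm_diff_commute[of f "truncate n f"]
        by linarith
      also have "\<dots> = e / ?c"
        by simp
      finally show ?thesis
        unfolding diff using c by (subst mult.commute) (simp only: pos_less_divide_eq)
    qed
    then show "\<exists>N. \<forall>m\<ge>N. \<forall>n\<ge>N. L2_norm (\<lambda>\<xi>. ?F m \<xi> - ?F n \<xi>) < e"
      by blast
  qed (use F in auto)
  let ?P = "\<lambda>h. h \<in> L2_space \<and> (\<lambda>n. \<integral>\<^sup>+\<xi>. ennreal ((cmod (?F n \<xi> - h \<xi>))\<^sup>2) \<partial>lborel) \<longlonglongrightarrow> 0"
  have P_iff: "?P h \<longleftrightarrow> h \<in> L2_space \<and> (\<lambda>n. L2_norm (\<lambda>\<xi>. ?F n \<xi> - h \<xi>)) \<longlonglongrightarrow> 0" for h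
    using L2_sq_tendsto_0_iff[of "\<lambda>n \<xi>. ?F n \<xi> - h \<xi>"] L2_space_diff[OF F] unfolding L2_sq_def by blast
  have "(\<lambda>x. indicator (cball 0 (real n)) x *\<^sub>R f x) = truncate n f" for n
    by (simp add: fun_eq_iff truncate_def)
  then have "?P (fourier_L2 f)"
    unfolding fourier_L2_def
    using someI[of ?P h] h P_iff[of h] by simp
  then show "fourier_L2 f \<in> L2_space" "(\<lambda>n. L2_norm (\<lambda>\<xi>. ?F n \<xi> - fourier_L2 f \<xi>)) \<longlonglongrightarrow> 0"
    unfolding P_iff by auto
qed

theorem L2_norm_fourier_L2:
  fixes f :: "real^'n \<Rightarrow> complex"
  assumes f: "f \<in> L2_space"
  shows "L2_norm (fourier_L2 f) = sqrt ((2 * pi) ^ CARD('n)) * L2_norm f"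
proof (rule LIMSEQ_unique)
  have "(\<lambda>n. L2_norm (fourier_integral (truncate n f))) \<longlonglongrightarrow> L2_norm (fourier_L2 f)"
    by (intro L2_norm_tendsto fourier_integral_truncate_tendsto fourier_L2_in_L2_space
        fourier_integral_L2_bounded_support truncate f)
  then show "(\<lambda>n. sqrt ((2 * pi) ^ CARD('n)) * L2_norm (truncate n f)) \<longlonglongrightarrow> L2_norm (fourier_L2 f)"
    unfolding fourier_integral_L2_bounded_support(2)[OF truncate(1)[OF f]] .
  show "(\<lambda>n. sqrt ((2 * pi) ^ CARD('n)) * L2_norm (truncate n f)) \<longlonglongrightarrow> sqrt ((2 * pi) ^ CARD('n)) * L2_norm f"
    by (intro tendsto_mult_left L2_norm_tendsto truncate f L2_bounded_supportD)
qed

text \<open>The formula holds for the truncations, and the bilinear pairing is continuous under L2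
  convergence of both arguments.\<close>

lemma integral_fourier_L2_mult:
  fixes f g :: "real^'n \<Rightarrow> complex"
  assumes f: "f \<in> L2_space" and g: "g \<in> L2_space"
  shows "(\<integral>x. fourier_L2 f x * g x \<partial>lborel) = (\<integral>x. f x * fourier_L2 g x \<partial>lborel)"
proof (rule LIMSEQ_unique)
  note lim = truncate(2) fourier_integral_truncate_tendsto
  have L2: "truncate n h \<in> L2_space" "fourier_integral (truncate n h) \<in> L2_space" "fourier_L2 h \<in> L2_space"
    if "h \<in> L2_space" for n and h :: "real^'n \<Rightarrow> complex"
    using that by (auto intro: L2_bounded_supportD truncate fourier_integral_L2_bounded_support fourier_L2_in_L2_space)
  show "(\<lambda>n. \<integral>x. fourier_integral (truncate n f) x * truncate n g x \<partial>lborel) \<longlonglongrightarrow> (\<integral>x. fourier_L2 f x * g x \<partial>lborel)"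
    by (intro L2_mult_tendsto L2 lim f g)
  have "(\<lambda>n. \<integral>x. truncate n f x * fourier_integral (truncate n g) x \<partial>lborel) \<longlonglongrightarrow> (\<integral>x. f x * fourier_L2 g x \<partial>lborel)"
    by (intro L2_mult_tendsto L2 lim f g)
  then show "(\<lambda>n. \<integral>x. fourier_integral (truncate n f) x * truncate n g x \<partial>lborel) \<longlonglongrightarrow> (\<integral>x. f x * fourier_L2 g x \<partial>lborel)"
    by (subst integral_fourier_integral_mult) (intro integrable_L2_bounded_support truncate f g)+
qed

text \<open>An isometry \<open>F\<close> (up to scaling) that is symmetric for the bilinear pairing is onto: its adjoint
  \<open>h \<mapsto> cnj (F (cnj h))\<close> is isometric too.\<close>

theorem fourier_L2_surj:
  fixes h :: "real^'n \<Rightarrow> complex"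
  assumes h: "h \<in> L2_space"
  obtains u where "u \<in> L2_space" "AE \<xi> in lborel. fourier_L2 u \<xi> = h \<xi>"
proof -
  define C where "C = (2 * pi) ^ CARD('n)"
  have C: "0 < C"
    by (simp add: C_def)
  let ?k = "fourier_L2 (\<lambda>x. cnj (h x))"
  have k: "?k \<in> L2_space"
    by (intro fourier_L2_in_L2_space L2_space_cnj h)
  have k_norm: "(L2_norm ?k)\<^sup>2 = C * (L2_norm h)\<^sup>2"
    using C unfolding L2_norm_fourier_L2[OF L2_space_cnj[OF h]] C_def[symmetric] by (simp add: power_mult_distrib L2_norm_cnj)
  \<comment> \<open>The inverse transform of h written through the forward one: conjugate before and
    after, and divide by the Plancherel constant.\<close>
  define u where "u x = of_real (1 / C) * cnj (?k x)" for x
  have u: "u \<in> L2_space"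
    unfolding u_def[abs_def] by (intro L2_space_cmult L2_space_cnj k)
  let ?v = "fourier_L2 u"
  have v: "?v \<in> L2_space"
    by (rule fourier_L2_in_L2_space[OF u])
  have u_norm: "L2_norm u = 1 / C * L2_norm ?k"
    using C unfolding u_def[abs_def] L2_norm_cmult L2_norm_cnj by (simp add: norm_divide)
  have "(L2_norm ?v)\<^sup>2 = C * ((1 / C)\<^sup>2 * (C * (L2_norm h)\<^sup>2))"
    using C unfolding L2_norm_fourier_L2[OF u] C_def[symmetric] u_norm
      power_mult_distrib[of "sqrt C"] power_mult_distrib[of "1 / C"] k_norm by simp
  then have v_norm: "(L2_norm ?v)\<^sup>2 = (L2_norm h)\<^sup>2"
    using C by (simp add: power2_eq_square)
  have "(\<integral>\<xi>. ?v \<xi> * cnj (h \<xi>) \<partial>lborel) = (\<integral>\<xi>. u \<xi> * ?k \<xi> \<partial>lborel)"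
    by (rule integral_fourier_L2_mult[OF u L2_space_cnj[OF h]])
  also have "\<dots> = (\<integral>\<xi>. of_real (1 / C) * of_real ((cmod (?k \<xi>))\<^sup>2) \<partial>lborel)"
    unfolding u_def by (simp only: complex_norm_square mult_ac)
  also have "\<dots> = of_real (1 / C * (L2_norm ?k)\<^sup>2)"
    by (simp only: integral_mult_right_zero integral_complex_of_real L2_norm_power2 of_real_mult)
  also have "\<dots> = of_real ((L2_norm h)\<^sup>2)"
    using C by (simp add: k_norm)
  finally have inner: "(\<integral>\<xi>. ?v \<xi> * cnj (h \<xi>) \<partial>lborel) = of_real ((L2_norm h)\<^sup>2)" .
  have int: "integrable lborel (\<lambda>\<xi>. ?v \<xi> * cnj (h \<xi>))"
    by (intro integrable_L2_mult v L2_space_cnj h)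
  \<comment> \<open>The square expands into norms and an inner product. The norms of
    \<open>?v\<close> and h agree and their inner product is the same squared norm, so the distance
    is 0.\<close>
  have "(L2_norm (\<lambda>\<xi>. ?v \<xi> - h \<xi>))\<^sup>2
      = (\<integral>\<xi>. (cmod (?v \<xi>))\<^sup>2 + (cmod (h \<xi>))\<^sup>2 - 2 * Re (?v \<xi> * cnj (h \<xi>)) \<partial>lborel)"
    unfolding L2_norm_power2
    by (intro Bochner_Integration.integral_cong refl)
       (simp only: cmod_power2, simp add: power2_eq_square algebra_simps)
  also have "\<dots> = (L2_norm ?v)\<^sup>2 + (L2_norm h)\<^sup>2 - 2 * Re (\<integral>\<xi>. ?v \<xi> * cnj (h \<xi>) \<partial>lborel)"
    using L2_space_integrable[OF v] L2_space_integrable[OF h] int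
    by (simp only: L2_norm_power2 Bochner_Integration.integral_diff Bochner_Integration.integral_add
        Bochner_Integration.integrable_add integral_mult_right_zero integrable_mult_right integral_Re integrable_Re)
  also have "\<dots> = 0"
    by (simp add: inner v_norm)
  finally have "L2_norm (\<lambda>\<xi>. ?v \<xi> - h \<xi>) = 0"
    by simp
  then have "AE \<xi> in lborel. ?v \<xi> - h \<xi> = 0"
    using L2_norm_eq_0_iff[OF L2_space_diff[OF v h]] by simp
  then show thesis
    using that[OF u] by simp
qed

section \<open>Log-convexity of the semigroup\<close>

lemma continuous_on_matrix_vector_mult [continuous_intros]:
  fixes A :: "'a::topological_space \<Rightarrow> real^'n^'m"
  assumes "continuous_on S A" "continuous_on S v"
  shows "continuous_on S (\<lambda>x. A x *v v x)"
  unfolding matrix_vector_mult_def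
  by (intro continuous_on_vec_lambda continuous_intros assms)

text \<open>Hoelder with exponents 1 / (1 - \<theta>) and 1 / \<theta>, endpoints included:
  normalise by the two integrals a and b, apply Young's inequality pointwise, and integrate against
  v.\<close>

lemma interpolation_inequality:
  fixes e v :: "'a::euclidean_space \<Rightarrow> real"
  assumes v: "integrable lborel v" "\<And>x. 0 \<le> v x" and e: "e \<in> borel_measurable borel" "\<And>x. 0 < e x" "\<And>x. e x \<le> 1"
    and \<theta>: "0 \<le> \<theta>" "\<theta> \<le> 1"
  shows "(\<integral>x. e x powr \<theta> * v x \<partial>lborel) \<le> (\<integral>x. v x \<partial>lborel) powr (1 - \<theta>) * (\<integral>x. e x * v x \<partial>lborel) powr \<theta>"
proof -
  have [measurable]: "e \<in> borel_measurable borel" "v \<in> borel_measurable borel"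
    using e v by (simp_all add: borel_measurable_integrable flip: measurable_lborel2)
  have ev: "integrable lborel (\<lambda>x. e x * v x)"
  proof (rule Bochner_Integration.integrable_bound[OF v(1)])
    show "AE x in lborel. norm (e x * v x) \<le> norm (v x)"
      using e v by (auto simp: abs_mult less_imp_le intro!: mult_left_le_one_le)
  qed measurable
  have ev_le: "e x powr \<theta> * v x \<le> 1 * v x" for x
    using e(2,3)[of x] \<theta> v(2)[of x] powr_mono2[of \<theta> "e x" 1] by (intro mult_right_mono) auto
  have ev': "integrable lborel (\<lambda>x. e x powr \<theta> * v x)"
  proof (rule Bochner_Integration.integrable_bound[OF v(1)])
    show "AE x in lborel. norm (e x powr \<theta> * v x) \<le> norm (v x)"
      using ev_le v(2) by (intro AE_I2) simp
  qed measurable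
  define a where "a = (\<integral>x. v x \<partial>lborel)"
  define b where "b = (\<integral>x. e x * v x \<partial>lborel)"
  show ?thesis
  proof (cases "a = 0")
    case True
    have "(\<integral>x. e x powr \<theta> * v x \<partial>lborel) \<le> a"
      unfolding a_def using ev_le by (intro integral_mono ev' v) simp
    also have "\<dots> \<le> (\<integral>x. v x \<partial>lborel) powr (1 - \<theta>) * (\<integral>x. e x * v x \<partial>lborel) powr \<theta>"
      by (simp add: True)
    finally show ?thesis .
  next
    case False
    then have a: "0 < a"
      using integral_nonneg_AE[of v lborel] v(2) by (simp add: a_def less_le)
    \<comment> \<open>Strict positivity of e enters here. In Isabelle \<open>0 powr 0 = 0\<close>,
      so at \<theta> = 0 a vanishing b would make the right-hand side collapse.\<close>
    have "b \<noteq> 0"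
    proof
      assume "b = 0"
      then have "AE x in lborel. e x * v x = 0"
        using integral_nonneg_eq_0_iff_AE[OF ev] e(2) v(2) by (simp add: b_def less_imp_le)
      then have "AE x in lborel. v x = 0"
        by eventually_elim (metis e(2) less_irrefl mult_eq_0_iff)
      then show False
        using False by (simp add: a_def integral_eq_zero_AE)
    qed
    moreover have "0 \<le> b"
      unfolding b_def using e(2) v(2) by (intro integral_nonneg_AE AE_I2 mult_nonneg_nonneg) (simp_all add: less_imp_le)
    ultimately have b: "0 < b"
      by simp
    let ?K = "a powr (1 - \<theta>) * b powr \<theta>"
    have "(\<integral>x. e x powr \<theta> * v x \<partial>lborel) \<le> (\<integral>x. ?K * ((1 - \<theta>) / a) * v x + ?K * (\<theta> / b) * (e x * v x) \<partial>lborel)"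
    proof (intro integral_mono Bochner_Integration.integrable_add integrable_mult_right ev ev' v(1))
      fix x
      have "(1 / a) powr (1 - \<theta>) * (e x / b) powr \<theta> \<le> (1 - \<theta>) * (1 / a) + \<theta> * (e x / b)"
        using \<theta> a b e(2) by (intro Youngs_inequality_0) auto
      then have "?K * ((1 / a) powr (1 - \<theta>) * (e x / b) powr \<theta>) \<le> ?K * ((1 - \<theta>) * (1 / a) + \<theta> * (e x / b))"
        by (rule mult_left_mono) simp
      also have "?K * ((1 / a) powr (1 - \<theta>) * (e x / b) powr \<theta>) = e x powr \<theta>"
        using a b e(2)[of x] by (simp add: powr_divide)
      finally have "e x powr \<theta> * v x \<le> ?K * ((1 - \<theta>) * (1 / a) + \<theta> * (e x / b)) * v x"
        by (rule mult_right_mono) (rule v(2))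
      then show "e x powr \<theta> * v x \<le> ?K * ((1 - \<theta>) / a) * v x + ?K * (\<theta> / b) * (e x * v x)"
        by (simp add: algebra_simps)
    qed
    also have "\<dots> = ?K * ((1 - \<theta>) / a) * a + ?K * (\<theta> / b) * b"
      by (simp add: v ev flip: a_def b_def)
    also have "\<dots> = ?K * (1 - \<theta>) + ?K * \<theta>"
      using a b by simp
    also have "\<dots> = ?K"
      by (simp add: algebra_simps)
    finally show ?thesis
      by (simp only: a_def b_def)
  qed
qed

section \<open>Decay rates and the norm of the semigroup\<close>

locale frac_OU =
  fixes Q B :: "real^'n^'n" and s T :: real
  assumes Q: "pos_def Q" and s: "s > 0" and T: "T > 0"
begin

definition flow :: "real \<Rightarrow> real^'n^'n" where
  "flow t = mat_exp (t *\<^sub>R transpose B)"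

definition rate :: "real \<Rightarrow> real^'n \<Rightarrow> real" where
  "rate t \<xi> = norm (mat_sqrt Q *v (flow t *v \<xi>)) powr (2 * s)"

text \<open>The exponent as it stands in the semigroup, before the substitution: \<psi> t \<eta> of
  the overview is \<open>decay t (flow t *v \<eta>)\<close>.\<close>

definition decay :: "real \<Rightarrow> real^'n \<Rightarrow> real" where
  "decay t \<xi> = integral {0..t} (\<lambda>\<tau>. rate (- \<tau>) \<xi>)"

lemma flow_add: "flow (t + u) = flow t ** flow u"
  by (simp add: flow_def mat_exp_scaleR_add)

lemma flow_0: "flow 0 = mat 1"
  by (simp add: flow_def mat_exp_0)

lemma det_flow: "det (flow t) = exp (t * trace B)"
  by (simp add: flow_def det_mat_exp) (simp add: trace_def transpose_def sum_distrib_left)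

lemma continuous_on_flow [continuous_intros]:
  "continuous_on S f \<Longrightarrow> continuous_on S (\<lambda>x. flow (f x))"
  unfolding flow_def
  by (rule continuous_on_compose2[OF continuous_on_mat_exp[of UNIV]]) simp_all

lemma continuous_on_rate [continuous_intros]:
  assumes "continuous_on S f" "continuous_on S g"
  shows "continuous_on S (\<lambda>x. rate (f x) (g x))"
  unfolding rate_def using s
  by (intro continuous_on_powr' continuous_on_norm continuous_on_matrix_vector_mult continuous_on_flow
      continuous_on_const assms) auto

lemma rate_integrable: "(\<lambda>\<tau>. rate (f \<tau>) \<xi>) integrable_on {a..b}"
  if "continuous_on {a..b} f" for f :: "real \<Rightarrow> real"
  by (intro integrable_continuous_interval continuous_intros that)

lemma continuous_on_decay: "continuous_on UNIV (decay t)"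
  unfolding decay_def[abs_def] cbox_interval[symmetric]
  by (rule integral_continuous_on_param)
     (unfold case_prod_unfold, intro continuous_intros)

lemma decay_nonneg: "0 \<le> decay t \<xi>"
  unfolding decay_def by (rule integral_nonneg) (intro rate_integrable continuous_intros, simp add: rate_def)

lemma rate_bounds:
  obtains a b where "0 < a" "a \<le> b" "\<And>t \<xi>. t \<in> {0..T} \<Longrightarrow> a * norm \<xi> powr (2 * s) \<le> rate t \<xi>"
    "\<And>t \<xi>. t \<in> {0..T} \<Longrightarrow> rate t \<xi> \<le> b * norm \<xi> powr (2 * s)"
proof -
  let ?K = "{0..T} \<times> sphere (0 :: real^'n) 1"
  have K: "compact ?K" "?K \<noteq> {}"
    using T by (auto intro!: compact_Times)
  have cont: "continuous_on ?K (\<lambda>p. rate (fst p) (snd p))"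
    by (intro continuous_intros)
  obtain p where p: "p \<in> ?K" "\<And>q. q \<in> ?K \<Longrightarrow> rate (fst p) (snd p) \<le> rate (fst q) (snd q)"
    using continuous_attains_inf[OF K cont] by blast
  obtain r where r: "r \<in> ?K" "\<And>q. q \<in> ?K \<Longrightarrow> rate (fst q) (snd q) \<le> rate (fst r) (snd r)"
    using continuous_attains_sup[OF K cont] by blast
  have scale: "rate t (c *\<^sub>R \<xi>) = c powr (2 * s) * rate t \<xi>" if "0 \<le> c" for t c \<xi>
    using that by (simp add: rate_def matrix_vector_mult_scaleR powr_mult)
  have unit: "(t, \<xi> /\<^sub>R norm \<xi>) \<in> ?K" if "t \<in> {0..T}" "\<xi> \<noteq> 0" for t \<xi>
    using that by simp
  have eq: "rate t \<xi> = norm \<xi> powr (2 * s) * rate t (\<xi> /\<^sub>R norm \<xi>)" if "\<xi> \<noteq> 0" for t \<xi>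
    using scale[of "norm \<xi>" t "\<xi> /\<^sub>R norm \<xi>"] that by simp
  have zero: "rate t 0 = 0" for t
    by (simp add: rate_def)
  \<comment> \<open>The minimum is positive because \<open>flow (- t)\<close> inverts
    \<open>flow t\<close> and the root of a positive definite matrix is injective.\<close>
  have "flow (fst p) *v snd p \<noteq> 0"
  proof
    assume "flow (fst p) *v snd p = 0"
    then have "flow (- fst p + fst p) *v snd p = 0"
      by (simp only: flow_add matrix_vector_mul_assoc[symmetric]) simp
    then show False
      using p(1) by (auto simp: flow_0)
  qed
  then have "0 < rate (fst p) (snd p)"
    by (simp add: rate_def mat_sqrt_eq_0_iff[OF Q])
  moreover have "rate (fst p) (snd p) \<le> rate (fst r) (snd r)"
    by (rule p(2)[OF r(1)])
  moreover have "rate (fst p) (snd p) * norm \<xi> powr (2 * s) \<le> rate t \<xi>"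
    and "rate t \<xi> \<le> rate (fst r) (snd r) * norm \<xi> powr (2 * s)" if "t \<in> {0..T}" for t \<xi>
  proof -
    show "rate (fst p) (snd p) * norm \<xi> powr (2 * s) \<le> rate t \<xi>"
    proof (cases "\<xi> = 0")
      case False
      then show ?thesis
        using p(2)[OF unit[OF that False]] by (simp add: eq[OF False] mult.commute mult_right_mono)
    qed (simp add: zero)
    show "rate t \<xi> \<le> rate (fst r) (snd r) * norm \<xi> powr (2 * s)"
    proof (cases "\<xi> = 0")
      case False
      then show ?thesis
        using r(2)[OF unit[OF that False]] by (simp add: eq[OF False] mult.commute mult_right_mono)
    qed (simp add: zero)
  qed
  ultimately show thesis
    using that by blast
qed

lemma decay_comparison:
  obtains c where "0 < c" "c \<le> 1"
    "\<And>t \<xi>. t \<in> {0..T} \<Longrightarrow> c * (t / T) * decay T (flow T *v \<xi>) \<le> decay t (flow t *v \<xi>)"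
proof -
  obtain a b where ab: "0 < a" "a \<le> b"
    and a: "\<And>t \<xi>. t \<in> {0..T} \<Longrightarrow> a * norm \<xi> powr (2 * s) \<le> rate t \<xi>"
    and b: "\<And>t \<xi>. t \<in> {0..T} \<Longrightarrow> rate t \<xi> \<le> b * norm \<xi> powr (2 * s)"
    using rate_bounds by blast
  \<comment> \<open>Along the flow the backward times - \<tau> become t - \<tau>, which stay in
    [0, T], where the rate bounds hold.\<close>
  have decay: "decay t (flow t *v \<xi>) = integral {0..t} (\<lambda>\<tau>. rate (t - \<tau>) \<xi>)" for t \<xi>
    unfolding decay_def rate_def by (simp add: matrix_vector_mul_assoc add.commute flip: flow_add)
  have "a / b * (t / T) * decay T (flow T *v \<xi>) \<le> decay t (flow t *v \<xi>)" if t: "t \<in> {0..T}" for t \<xi>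
  proof -
    have "decay T (flow T *v \<xi>) \<le> integral {0..T} (\<lambda>\<tau>. b * norm \<xi> powr (2 * s))"
      unfolding decay by (rule integral_le) (auto intro!: b rate_integrable continuous_intros)
    then have "decay T (flow T *v \<xi>) \<le> T * (b * norm \<xi> powr (2 * s))"
      using T by (simp add: mult.left_commute)
    then have "a / b * (t / T) * decay T (flow T *v \<xi>) \<le> a / b * (t / T) * (T * (b * norm \<xi> powr (2 * s)))"
      using ab T t by (intro mult_left_mono) auto
    also have "\<dots> = integral {0..t} (\<lambda>\<tau>. a * norm \<xi> powr (2 * s))"
      using ab T t by simp
    also have "\<dots> \<le> decay t (flow t *v \<xi>)"
      unfolding decay using t by (intro integral_le) (auto intro!: a rate_integrable continuous_intros)
    finally show ?thesis .
  qed
  then show thesis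
    using ab by (intro that[of "a / b"]) auto
qed

definition symbol :: "real \<Rightarrow> (real^'n \<Rightarrow> complex) \<Rightarrow> real^'n \<Rightarrow> complex" where
  "symbol t h \<xi> = of_real (exp (- trace B * t) * exp (- decay t \<xi>)) * h (flow (- t) *v \<xi>)"

text \<open>The substitution cancels the inner \<open>flow (- t)\<close> in the argument of h. The
  Jacobian exp (t tr B) meets exp (- 2 t tr B) from the squared prefactor and leaves exp (- t tr
  B).\<close>

lemma symbol:
  assumes h: "h \<in> L2_space"
  shows symbol_L2_space: "symbol t h \<in> L2_space"
    and L2_norm_symbol: "(L2_norm (symbol t h))\<^sup>2
      = exp (- (t * trace B)) * (\<integral>\<xi>. exp (- 2 * decay t (flow t *v \<xi>)) * (cmod (h \<xi>))\<^sup>2 \<partial>lborel)"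
proof -
  have [measurable]: "h \<in> borel_measurable borel"
    using h by (rule L2_space_measurable)
  have [measurable]: "decay t \<in> borel_measurable borel"
    by (rule borel_measurable_continuous_onI[OF continuous_on_decay])
  have meas: "symbol t h \<in> borel_measurable borel"
    unfolding symbol_def[abs_def] by measurable
  then have [measurable]: "symbol t h \<in> borel_measurable borel" .
  let ?v = "\<lambda>\<xi>. exp (- 2 * decay t (flow t *v \<xi>)) * (cmod (h \<xi>))\<^sup>2"
  have v: "integrable lborel ?v"
  proof (rule Bochner_Integration.integrable_bound[OF L2_space_integrable[OF h]])
    show "AE \<xi> in lborel. norm (?v \<xi>) \<le> norm ((cmod (h \<xi>))\<^sup>2)"
      using decay_nonneg by (intro AE_I2) (simp add: mult_left_le_one_le)
  qed measurable
  have "flow (- t) *v (flow t *v \<xi>) = \<xi>" for \<xi>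
    by (simp add: matrix_vector_mul_assoc flow_0 flip: flow_add)
  then have "(cmod (symbol t h (flow t *v \<xi>)))\<^sup>2 = exp (- 2 * trace B * t) * ?v \<xi>" for \<xi>
    by (simp add: symbol_def norm_mult power_mult_distrib exp_double[symmetric] mult_ac flip: exp_of_nat_mult)
  then have "L2_sq (symbol t h)
      = ennreal (exp (t * trace B)) * (\<integral>\<^sup>+\<xi>. ennreal (exp (- 2 * trace B * t)) * ennreal (?v \<xi>) \<partial>lborel)"
    unfolding L2_sq_def
    by (subst nn_integral_linear_substitution[of "flow t"]) (simp_all add: det_flow ennreal_mult)
  also have "\<dots> = ennreal (exp (t * trace B)) * (ennreal (exp (- 2 * trace B * t)) * ennreal (integral\<^sup>L lborel ?v))"
  proof -
    have "(\<integral>\<^sup>+\<xi>. ennreal (exp (- 2 * trace B * t)) * ennreal (?v \<xi>) \<partial>lborel)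
        = ennreal (exp (- 2 * trace B * t)) * (\<integral>\<^sup>+\<xi>. ennreal (?v \<xi>) \<partial>lborel)"
      by (rule nn_integral_cmult) measurable
    also have "(\<integral>\<^sup>+\<xi>. ennreal (?v \<xi>) \<partial>lborel) = ennreal (integral\<^sup>L lborel ?v)"
      by (rule nn_integral_eq_integral[OF v]) simp
    finally show ?thesis
      by (simp only:)
  qed
  also have "\<dots> = ennreal (exp (- (t * trace B)) * integral\<^sup>L lborel ?v)"
    by (simp add: mult_exp_exp integral_nonneg_AE flip: mult.assoc ennreal_mult)
  finally have sq: "L2_sq (symbol t h) = ennreal (exp (- (t * trace B)) * integral\<^sup>L lborel ?v)" .
  then show L2: "symbol t h \<in> L2_space"
    by (simp add: L2_space_iff meas)
  show "(L2_norm (symbol t h))\<^sup>2 = exp (- (t * trace B)) * integral\<^sup>L lborel ?v"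
    using sq unfolding L2_sq_eq[OF L2] by (subst (asm) ennreal_inj) (simp_all add: integral_nonneg_AE)
qed

text \<open>The symbol of a square integrable function is square integrable and the transform is
  onto, so \<open>SOME\<close> has a witness; the choice within its class does not affect
  norms.\<close>

lemma frac_OU_semigroup:
  assumes u0: "u0 \<in> L2_space"
  shows "frac_OU_semigroup s Q B t u0 \<in> L2_space"
    and "AE \<xi> in lborel. fourier_L2 (frac_OU_semigroup s Q B t u0) \<xi> = symbol t (fourier_L2 u0) \<xi>"
proof -
  let ?P = "\<lambda>u. u \<in> L2_space \<and> (AE \<xi> in lborel. fourier_L2 u \<xi> = symbol t (fourier_L2 u0) \<xi>)"
  have "frac_OU_semigroup s Q B t u0 = (SOME u. ?P u)"
    by (simp add: frac_OU_semigroup_def symbol_def decay_def rate_def flow_def)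
  moreover have "\<exists>u. ?P u"
    using fourier_L2_surj[OF symbol_L2_space[OF fourier_L2_in_L2_space[OF u0]]] by metis
  ultimately have "?P (frac_OU_semigroup s Q B t u0)"
    using someI_ex[of ?P] by simp
  then show "frac_OU_semigroup s Q B t u0 \<in> L2_space"
    "AE \<xi> in lborel. fourier_L2 (frac_OU_semigroup s Q B t u0) \<xi> = symbol t (fourier_L2 u0) \<xi>"
    by auto
qed

lemma L2_norm_frac_OU_semigroup:
  assumes u0: "u0 \<in> L2_space"
  shows "(2 * pi) ^ CARD('n) * (L2_norm (frac_OU_semigroup s Q B t u0))\<^sup>2
    = exp (- (t * trace B)) * (\<integral>\<xi>. exp (- 2 * decay t (flow t *v \<xi>)) * (cmod (fourier_L2 u0 \<xi>))\<^sup>2 \<partial>lborel)"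
proof -
  let ?u = "frac_OU_semigroup s Q B t u0"
  have h: "fourier_L2 u0 \<in> L2_space"
    by (rule fourier_L2_in_L2_space[OF u0])
  have "L2_norm (fourier_L2 ?u) = L2_norm (symbol t (fourier_L2 u0))"
    by (intro L2_norm_cong_AE frac_OU_semigroup(2)[OF u0] L2_space_measurable symbol_L2_space h
        fourier_L2_in_L2_space frac_OU_semigroup(1)[OF u0])
  then have "(sqrt ((2 * pi) ^ CARD('n)) * L2_norm ?u)\<^sup>2 = (L2_norm (symbol t (fourier_L2 u0)))\<^sup>2"
    by (simp only: L2_norm_fourier_L2[OF frac_OU_semigroup(1)[OF u0]])
  moreover have "(sqrt ((2 * pi) ^ CARD('n)) * L2_norm ?u)\<^sup>2 = (2 * pi) ^ CARD('n) * (L2_norm ?u)\<^sup>2"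
    unfolding power_mult_distrib[of _ "L2_norm ?u"] by simp
  ultimately show ?thesis
    using L2_norm_symbol[OF h, of t] by simp
qed

theorem log_convexity:
  "\<exists>c::real. 0 < c \<and> c \<le> 1 \<and>
    (\<forall>u0 \<in> L2_space. \<forall>t \<in> {0..T}.
      L2_norm (frac_OU_semigroup s Q B t u0)
        \<le> exp (- (trace B / 2) * (1 - c) * t)
            * L2_norm u0 powr (1 - c * (t / T))
            * L2_norm (frac_OU_semigroup s Q B T u0) powr (c * (t / T)))"
proof -
  obtain c where c: "0 < c" "c \<le> 1"
    and decay: "\<And>t \<xi>. t \<in> {0..T} \<Longrightarrow> c * (t / T) * decay T (flow T *v \<xi>) \<le> decay t (flow t *v \<xi>)"
    using decay_comparison by blast
  have "L2_norm (frac_OU_semigroup s Q B t u0)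
        \<le> exp (- (trace B / 2) * (1 - c) * t)
            * L2_norm u0 powr (1 - c * (t / T))
            * L2_norm (frac_OU_semigroup s Q B T u0) powr (c * (t / T))" (is "?l \<le> ?r")
    if u0: "u0 \<in> L2_space" and t: "t \<in> {0..T}" for u0 :: "real^'n \<Rightarrow> complex" and t
  proof (rule power2_le_imp_le)
    define C where "C = (2 * pi) ^ CARD('n)"
    define \<theta> where "\<theta> = c * (t / T)"
    define v where "v \<xi> = (cmod (fourier_L2 u0 \<xi>))\<^sup>2" for \<xi>
    define J where "J t = (\<integral>\<xi>. exp (- 2 * decay t (flow t *v \<xi>)) * v \<xi> \<partial>lborel)" for t
    let ?u = "\<lambda>t. frac_OU_semigroup s Q B t u0"
    have C: "0 < C"
      by (simp add: C_def)
    have \<theta>: "0 \<le> \<theta>" "\<theta> \<le> 1"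
      unfolding \<theta>_def using c t T by (simp, intro mult_le_one) auto
    have h: "fourier_L2 u0 \<in> L2_space"
      by (rule fourier_L2_in_L2_space[OF u0])
    have v: "integrable lborel v"
      unfolding v_def[abs_def] by (rule L2_space_integrable[OF h])
    have [measurable]: "v \<in> borel_measurable borel"
      using v by (simp add: borel_measurable_integrable flip: measurable_lborel2)
    have [measurable]: "decay t \<in> borel_measurable borel" for t
      by (rule borel_measurable_continuous_onI[OF continuous_on_decay])
    have norm: "C * (L2_norm (?u t))\<^sup>2 = exp (- (t * trace B)) * J t" for t
      unfolding C_def J_def v_def by (rule L2_norm_frac_OU_semigroup[OF u0])
    have norm0: "C * (L2_norm u0)\<^sup>2 = integral\<^sup>L lborel v"
    proof -
      have "integral\<^sup>L lborel v = (L2_norm (fourier_L2 u0))\<^sup>2"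
        by (simp only: L2_norm_power2 v_def[abs_def])
      also have "\<dots> = C * (L2_norm u0)\<^sup>2"
        using C unfolding L2_norm_fourier_L2[OF u0] C_def[symmetric] by (simp add: power_mult_distrib)
      finally show ?thesis ..
    qed
    have J_T: "J T = exp (T * trace B) * (C * (L2_norm (?u T))\<^sup>2)"
      by (simp add: norm mult_exp_exp flip: mult.assoc)
    have "J t \<le> (\<integral>\<xi>. exp (- 2 * decay T (flow T *v \<xi>)) powr \<theta> * v \<xi> \<partial>lborel)"
      unfolding J_def
    proof (rule integral_mono)
      fix \<xi>
      show "exp (- 2 * decay t (flow t *v \<xi>)) * v \<xi> \<le> exp (- 2 * decay T (flow T *v \<xi>)) powr \<theta> * v \<xi>"
      proof (rule mult_right_mono)
        have "- 2 * decay t (flow t *v \<xi>) \<le> - 2 * decay T (flow T *v \<xi>) * \<theta>"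
          using decay[OF t, of \<xi>] unfolding \<theta>_def[symmetric] by (simp add: mult.commute)
        then show "exp (- 2 * decay t (flow t *v \<xi>)) \<le> exp (- 2 * decay T (flow T *v \<xi>)) powr \<theta>"
          by (simp add: exp_powr_real)
      qed (simp add: v_def)
    next
      show "integrable lborel (\<lambda>\<xi>. exp (- 2 * decay t (flow t *v \<xi>)) * v \<xi>)"
        using decay_nonneg
        by (intro Bochner_Integration.integrable_bound[OF v] AE_I2) (measurable, simp add: v_def mult_left_le_one_le)
      show "integrable lborel (\<lambda>\<xi>. exp (- 2 * decay T (flow T *v \<xi>)) powr \<theta> * v \<xi>)"
        using decay_nonneg \<theta>
        by (intro Bochner_Integration.integrable_bound[OF v] AE_I2)
           (measurable, simp add: v_def mult_left_le_one_le exp_powr_real)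
    qed
    also have "\<dots> \<le> integral\<^sup>L lborel v powr (1 - \<theta>) * J T powr \<theta>"
      unfolding J_def using decay_nonneg \<theta>
      by (intro interpolation_inequality v) (measurable, auto simp: v_def)
    \<comment> \<open>The Plancherel constant enters with exponents 1 - \<theta> and \<theta>, so
      exactly one factor C comes out and cancels against the left-hand side.\<close>
    also have "\<dots> = C * ((L2_norm u0)\<^sup>2 powr (1 - \<theta>) * (exp (T * \<theta> * trace B) * (L2_norm (?u T))\<^sup>2 powr \<theta>))"
      using C unfolding norm0[symmetric] J_T
      by (simp add: powr_mult exp_powr_real powr_diff mult_ac)
    finally have "C * (L2_norm (?u t))\<^sup>2 \<le> exp (- (t * trace B)) *
        (C * ((L2_norm u0)\<^sup>2 powr (1 - \<theta>) * (exp (T * \<theta> * trace B) * (L2_norm (?u T))\<^sup>2 powr \<theta>)))"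
      unfolding norm by (rule mult_left_mono) simp
    also have "\<dots> = C * ((exp (- (t * trace B)) * exp (T * \<theta> * trace B)) * (L2_norm u0)\<^sup>2 powr (1 - \<theta>) * (L2_norm (?u T))\<^sup>2 powr \<theta>)"
      by (simp only: mult_ac)
    \<comment> \<open>Since T \<theta> = c t, the exponents add up to - (1 - c) t tr B.\<close>
    also have "exp (- (t * trace B)) * exp (T * \<theta> * trace B) = (exp (- (trace B / 2) * (1 - c) * t))\<^sup>2"
    proof -
      have "- (t * trace B) + T * \<theta> * trace B = 2 * (- (trace B / 2) * (1 - c) * t)"
        using T by (simp add: \<theta>_def field_simps)
      then show ?thesis
        by (simp only: mult_exp_exp exp_double)
    qed
    also have "C * ((exp (- (trace B / 2) * (1 - c) * t))\<^sup>2 * (L2_norm u0)\<^sup>2 powr (1 - \<theta>) * (L2_norm (?u T))\<^sup>2 powr \<theta>) = C * ?r\<^sup>2"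
      by (simp add: \<theta>_def power2_eq_square powr_mult L2_norm_nonneg mult_ac)
    finally show "?l\<^sup>2 \<le> ?r\<^sup>2"
      using C by simp
  qed simp
  with c show ?thesis
    by blast
qed

end

theorem proposition1:
  fixes Q B :: "real^'n^'n" and s T :: real
  assumes "pos_def Q" and "B \<noteq> 0" and "s > 0" and "T > 0"
  shows "\<exists>c::real. 0 < c \<and> c \<le> 1 \<and>
    (\<forall>u0 \<in> L2_space. \<forall>t \<in> {0..T}.
      L2_norm (frac_OU_semigroup s Q B t u0)
        \<le> exp (- (trace B / 2) * (1 - c) * t)
            * L2_norm u0 powr (1 - c * (t / T))
            * L2_norm (frac_OU_semigroup s Q B T u0) powr (c * (t / T)))"
proof -
  interpret frac_OU Q B s T
    by standard fact+
  show ?thesis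
    by (rule log_convexity)
qed

end
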